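(* For every $\tau>0$ there is a constant $C(\tau)>0$ depending only on $\tau$ such that the following holds. Let $m,d,L,G,s$ be positive integers and $\eta\in(0,1)$. Let $\mathcal{I}=\{\mathcal{I}_1,\dots,\mathcal{I}_G\}$ be a group partition of $[dL]$, let $g:=\max_{i\in[G]}|\mathcal{I}_i|$, and let $\Psi$ be a $dL\times dL$ unitary matrix. Let $\Phi$ be the $mL\times dL$ block diagonal random matrix $$\Phi=\begin{pmatrix}\Phi_1&&\\&\ddots&\\&&\Phi_L\end{pmatrix},$$ where $\Phi_1,\dots,\Phi_L$ are $m\times d$ random matrices such that all the entries of all the blocks are i.i.d. subexponential random variables with mean $0$, variance $1$ and subexponential norm $\tau$. If $$m\ge C(\tau)\max\Big(gLs\log\Big(\frac{dL}{gs}\Big),\ \log\eta^{-1}\Big),$$ then with probability at least $1-\eta$ one can exactly recover $s$-group-sparse vectors by group $\ell_1$-minimization; that is, with probability at least $1-\eta$, for every $x\in\Sigma_{\mathcal{I},s}(\mathbb{C}^{dL})$, setting $y=\Phi\Psi x$, the vector $x$ is the unique solution of $$\min_{z\in\mathbb{C}^{dL}}\|z\|_{\mathcal{I},1}\quad\text{subject to}\quad \Phi\Psi z=y.$$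
   Context: For a positive integer $n$, $[n]:=\{1,\dots,n\}$. A group partition of $[n]$ is a collection $\mathcal{I}=\{\mathcal{I}_1,\dots,\mathcal{I}_G\}$ of pairwise disjoint subsets of $[n]$ with union $[n]$. For $a\in\mathbb{C}^n$ and $I\subset[n]$, $a_I\in\mathbb{C}^n$ denotes the vector agreeing with $a$ on the coordinates in $I$ and zero elsewhere. Define $\|a\|_{\mathcal{I},1}:=\sum_{i=1}^G\|a_{\mathcal{I}_i}\|_2$, $\|a\|_{\mathcal{I},0}:=|\{i\in[G]: a_{\mathcal{I}_i}\ne 0\}|$, and $\Sigma_{\mathcal{I},s}(\mathbb{C}^n):=\{a\in\mathbb{C}^n:\|a\|_{\mathcal{I},0}\le s\}$ (the $s$-group-sparse vectors). A random variable $\xi$ is subexponential if for some $K>0$, $\mathbb{P}\{|\xi|\ge t\}\le 2\exp(-t/K)$ for all $t\ge0$; its subexponential norm is $\|\xi\|_{\Psi_1}:=\inf\{t>0:\mathbb{E}\exp(|\xi|/t)\le 2\}$.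
   Formalization: log(dL/(gs)) is replaced by max(1, log(dL/(gs))), since the literal condition is false when gs is near or above dL (e.g. L=g=1, s=d, m<d); the random entries live on probability measures over real-valued arrays, to which any sample space reduces by taking the joint law. *)

theory Defs
  imports
    "HOL-Probability.Probability"
    "Jordan_Normal_Form.Schur_Decomposition"
begin

text \<open>Vectors in \<open>\<complex>\<^sup>n\<close> and matrices are those of the AFP entry Jordan_Normal_Form, whose dimensions
  are natural numbers rather than types. Coordinates are counted from \<open>0\<close>, so \<open>[n]\<close> becomes
  \<open>{..<n}\<close>, and the groups \<open>\<I> 0, \<dots>, \<I> (G - 1)\<close> are indexed by \<open>{..<G}\<close>.\<close>

definition group_partition :: "(nat \<Rightarrow> nat set) \<Rightarrow> nat \<Rightarrow> nat \<Rightarrow> bool" where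
  "group_partition \<I> G n \<longleftrightarrow>
     disjoint_family_on \<I> {..<G} \<and> (\<Union>i<G. \<I> i) = {..<n}"

definition max_group_size :: "(nat \<Rightarrow> nat set) \<Rightarrow> nat \<Rightarrow> nat" where
  "max_group_size \<I> G = Max ((\<lambda>i. card (\<I> i)) ` {..<G})"

definition vec_on :: "complex Matrix.vec \<Rightarrow> nat set \<Rightarrow> complex Matrix.vec" where
  "vec_on a J = Matrix.vec (dim_vec a) (\<lambda>j. if j \<in> J then vec_index a j else 0)"

definition l2norm :: "complex Matrix.vec \<Rightarrow> real" where
  "l2norm a = L2_set (\<lambda>j. cmod (vec_index a j)) {..<dim_vec a}"

definition group_l1 :: "(nat \<Rightarrow> nat set) \<Rightarrow> nat \<Rightarrow> complex Matrix.vec \<Rightarrow> real" where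
  "group_l1 \<I> G a = (\<Sum>i<G. l2norm (vec_on a (\<I> i)))"

definition group_l0 :: "(nat \<Rightarrow> nat set) \<Rightarrow> nat \<Rightarrow> complex Matrix.vec \<Rightarrow> nat" where
  "group_l0 \<I> G a = card {i \<in> {..<G}. vec_on a (\<I> i) \<noteq> 0\<^sub>v (dim_vec a)}"

definition group_sparse ::
    "(nat \<Rightarrow> nat set) \<Rightarrow> nat \<Rightarrow> nat \<Rightarrow> nat \<Rightarrow> complex Matrix.vec set" where
  "group_sparse \<I> G s n = {a \<in> carrier_vec n. group_l0 \<I> G a \<le> s}"

definition unitary_mat :: "nat \<Rightarrow> complex Matrix.mat \<Rightarrow> bool" where
  "unitary_mat n U \<longleftrightarrow>
     U \<in> carrier_mat n n \<and> U * mat_adjoint U = 1\<^sub>m n \<and> mat_adjoint U * U = 1\<^sub>m n"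

definition group_l1_minimizers ::
    "(nat \<Rightarrow> nat set) \<Rightarrow> nat \<Rightarrow> nat \<Rightarrow> complex Matrix.mat \<Rightarrow> complex Matrix.vec
      \<Rightarrow> complex Matrix.vec set" where
  "group_l1_minimizers \<I> G n A y =
     {z \<in> carrier_vec n. A *\<^sub>v z = y \<and>
        (\<forall>w \<in> carrier_vec n. A *\<^sub>v w = y \<longrightarrow> group_l1 \<I> G z \<le> group_l1 \<I> G w)}"

definition block_diag_mat ::
    "nat \<Rightarrow> nat \<Rightarrow> nat \<Rightarrow> (nat \<times> nat \<times> nat \<Rightarrow> real) \<Rightarrow> complex Matrix.mat" where
  "block_diag_mat m d L \<phi> =
     diag_block_mat (map (\<lambda>l. Matrix.mat m d (\<lambda>(i, j). complex_of_real (\<phi> (l, i, j)))) [0..<L])"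

definition subexponential :: "'w measure \<Rightarrow> ('w \<Rightarrow> real) \<Rightarrow> bool" where
  "subexponential M \<xi> \<longleftrightarrow>
     (\<exists>K>0. \<forall>t\<ge>0. \<P>(\<omega> in M. \<bar>\<xi> \<omega>\<bar> \<ge> t) \<le> 2 * exp (- t / K))"

text \<open>The expectation is a nonnegative integral with values in \<open>[0, \<infinity>]\<close>: the Bochner integral of a
  non-integrable function is \<open>0\<close> and would make the constraint hold spuriously.\<close>

definition subexp_norm :: "'w measure \<Rightarrow> ('w \<Rightarrow> real) \<Rightarrow> real" where
  "subexp_norm M \<xi> =
     Inf {t. t > 0 \<and> (\<integral>\<^sup>+\<omega>. ennreal (exp (\<bar>\<xi> \<omega>\<bar> / t)) \<partial>M) \<le> 2}"

definition iid :: "'w measure \<Rightarrow> ('i \<Rightarrow> 'w \<Rightarrow> real) \<Rightarrow> 'i set \<Rightarrow> bool" where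
  "iid M X I \<longleftrightarrow>
     prob_space.indep_vars M (\<lambda>_. borel) X I \<and>
     (\<forall>i\<in>I. \<forall>j\<in>I. distr M borel (X i) = distr M borel (X j))"

text \<open>The sparsity logarithm \<open>log (dL / (gs))\<close> is read with the convention that it is at least \<open>1\<close>.
  It is the plain logarithm whenever \<open>gs \<le> dL / e\<close>. Without the convention the sampling condition
  degenerates as \<open>gs\<close> approaches or exceeds \<open>dL\<close>: for \<open>L = g = 1\<close> and \<open>s = d\<close> it would only ask for
  \<open>m \<ge> C log (1 / \<eta>)\<close>, which allows \<open>m < d\<close>, where a nonzero kernel vector of the measurement
  matrix can never be recovered.\<close>

definition log1 :: "real \<Rightarrow> real" where
  "log1 x = max 1 (ln x)"

text \<open>A constant that must not depend on the probability space has to be chosen before the space,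
  but HOL cannot quantify over types inside a formula. The sample spaces of a random array indexed by
  \<open>'i\<close> are therefore taken to be arbitrary probability measures on the type \<open>'i \<Rightarrow> real\<close>. The next
  lemma shows that this is no restriction: every i.i.d. array on a sample space of any type has a copy
  there with the same marginals, and lower bounds on the probability of a property of the array carry
  over from the copy, without assuming that the property is measurable.\<close>

lemma iid_canonical_sample_space:
  fixes M :: "'w measure" and X :: "'i \<Rightarrow> 'w \<Rightarrow> real"
  assumes M: "prob_space M" and X: "iid M X I" and I: "I \<noteq> {}"
  obtains N :: "('i \<Rightarrow> real) measure" and Y :: "'i \<Rightarrow> ('i \<Rightarrow> real) \<Rightarrow> real"
  where "prob_space N" "iid N Y I"
    "\<And>i. i \<in> I \<Longrightarrow> distr N borel (Y i) = distr M borel (X i)"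
    "\<And>R p. p > 0 \<Longrightarrow> \<P>(\<omega> in N. R (\<lambda>i\<in>I. Y i \<omega>)) \<ge> p \<Longrightarrow> \<P>(\<omega> in M. R (\<lambda>i\<in>I. X i \<omega>)) \<ge> p"
proof -
  interpret prob_space M by (rule M)
  let ?P = "PiM I (\<lambda>_. borel :: real measure)"
  let ?f = "\<lambda>\<omega>. \<lambda>i\<in>I. X i \<omega>"
  define N where "N = distr M ?P ?f"
  define Y where "Y = (\<lambda>i (f :: 'i \<Rightarrow> real). f i)"
  have ind: "indep_vars (\<lambda>_. borel) X I" using X unfolding iid_def by blast
  then have rv: "\<And>i. i \<in> I \<Longrightarrow> random_variable borel (X i)" by (simp add: indep_vars_def)
  have f: "?f \<in> measurable M ?P" using rv by (intro measurable_restrict) auto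
  have N: "prob_space N" unfolding N_def by (rule prob_space_distr[OF f])
  have sN: "sets N = sets ?P" "space N = space ?P" by (simp_all add: N_def)
  have Y: "Y i \<in> borel_measurable ?P" if "i \<in> I" for i
    using that unfolding Y_def by (rule measurable_component_singleton)
  have YN: "Y i \<in> borel_measurable N" if "i \<in> I" for i
    using Y[OF that] measurable_cong_sets[OF sN(1) refl] by blast
  have marg: "distr N borel (Y i) = distr M borel (X i)" if "i \<in> I" for i
    unfolding N_def distr_distr[OF Y[OF that] f]
    by (rule distr_cong) (use that in \<open>auto simp: Y_def\<close>)
  have res: "(\<lambda>i\<in>I. Y i \<omega>) = \<omega>" if "\<omega> \<in> space N" for \<omega>
    using that by (auto simp: sN Y_def space_PiM PiE_def extensional_restrict)
  have "distr N ?P (\<lambda>\<omega>. \<lambda>i\<in>I. Y i \<omega>) = distr N N (\<lambda>\<omega>. \<omega>)"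
    by (rule distr_cong) (auto simp: sN res)
  also have "\<dots> = N" by (rule distr_id)
  also have "\<dots> = (\<Pi>\<^sub>M i\<in>I. distr M borel (X i))"
    unfolding N_def using indep_vars_iff_distr_eq_PiM'[OF I rv] ind by simp
  also have "\<dots> = (\<Pi>\<^sub>M i\<in>I. distr N borel (Y i))"
    by (rule PiM_cong) (auto simp: marg)
  finally have "prob_space.indep_vars N (\<lambda>_. borel) Y I"
    using prob_space.indep_vars_iff_distr_eq_PiM'[OF N I YN] by simp
  moreover have "distr N borel (Y i) = distr N borel (Y j)" if "i \<in> I" "j \<in> I" for i j
    using X that marg[OF that(1)] marg[OF that(2)] unfolding iid_def by metis
  ultimately have "iid N Y I" unfolding iid_def by blast
  moreover have "\<P>(\<omega> in M. R (\<lambda>i\<in>I. X i \<omega>)) \<ge> p"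
    if p: "p > 0" and R: "\<P>(\<omega> in N. R (\<lambda>i\<in>I. Y i \<omega>)) \<ge> p" for R p
  proof -
    let ?E = "{\<omega> \<in> space N. R (\<lambda>i\<in>I. Y i \<omega>)}"
    have "?E \<in> sets N" using p R measure_notin_sets[of ?E N] by force
    then have "measure N ?E = measure M (?f -` ?E \<inter> space M)"
      unfolding N_def by (subst measure_distr[OF f]) simp_all
    also have "?f -` ?E \<inter> space M = {\<omega> \<in> space M. R (\<lambda>i\<in>I. X i \<omega>)}"
      using measurable_space[OF f] by (auto simp: sN res[unfolded sN])
    finally have E: "measure N ?E = \<P>(\<omega> in M. R (\<lambda>i\<in>I. X i \<omega>))" .
    show ?thesis using R unfolding E .
  qed
  ultimately show thesis by (intro that[of N Y] N marg)
qed

end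

theory Submission
  imports Defs
begin

text \<open>An \<open>s\<close>-group-sparse vector is recovered by group \<open>\<ell>\<^sub>1\<close>-minimization for every choice of the vector if
and only if every nonzero kernel vector \<open>v\<close> of \<open>\<Phi>\<Psi>\<close> has the group null space property: on any \<open>s\<close>
groups its mixed norm is smaller than on the remaining groups (\<open>exact_recovery_iff\<close>). As in
compressed sensing with Gaussian matrices, this follows from a restricted isometry property: a
seminorm \<open>F\<close> that vanishes on the kernel and is comparable to the Euclidean norm on all vectors
supported on a constant multiple of \<open>s\<close> groups. The usual choice, the Euclidean norm of \<open>\<Phi>\<Psi>f\<close>, has
tails that are too heavy for subexponential entries. Instead,
\<open>F(f)\<^sup>2 = \<Sum>\<^sub>l (\<Sum>\<^sub>i |\<langle>\<Phi>\<^sub>l\<^sub>,\<^sub>i, (\<Psi>f)\<^sub>l\<rangle>|)\<^sup>2\<close> with \<open>\<Phi>\<^sub>l\<^sub>,\<^sub>i\<close> the \<open>i\<close>-th row of block \<open>l\<close>: an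
\<open>\<ell>\<^sub>1\<close>-norm inside each block and an \<open>\<ell>\<^sub>2\<close>-norm over the blocks (\<open>measurement_norm\<close>).

The inner sums only involve first powers of the subexponential variables \<open>\<langle>\<Phi>\<^sub>l\<^sub>,\<^sub>i, (\<Psi>f)\<^sub>l\<rangle>\<close>, so the
Chernoff bound applies to both tails: outside of an event of probability exponentially small in \<open>m\<close>,
the sum of block \<open>l\<close> is between two constants times \<open>m\<close> times the norm of \<open>(\<Psi>f)\<^sub>l\<close>
(\<open>row_sum_tails\<close>). For the lower tail one needs that a unit linear form in the entries has first
absolute moment bounded below, which holds since its second moment is \<open>1\<close> and its fourth moment is
bounded. The \<open>\<ell>\<^sub>2\<close>-sum over the blocks turns this into two-sided bounds by the norm of \<open>\<Psi>f\<close>, which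
is the norm of \<open>f\<close>, with constants that do not depend on \<open>L\<close>; only the union bound over the \<open>L\<close>
blocks costs a factor \<open>L\<close> in probability.

These bounds pass from one vector to all group-sparse vectors by a net. On a coordinate set \<open>J\<close> the
net consists of Gaussian integer vectors of bounded \<open>\<ell>\<^sub>1\<close>-norm, at most \<open>exp (c |J|)\<close> many
(\<open>gauss_lattice_count\<close>), and a seminorm that is comparable to the Euclidean norm on them is
so on all vectors supported on \<open>J\<close> (\<open>lattice_bounds_extend\<close>). The number of group supports is
controlled by \<open>card_small_subsets\<close>. Altogether the logarithm of the number of net points is at most a
constant times \<open>g s log (dL / (g s))\<close>, which \<open>m\<close> dominates by hypothesis, so that the failure
probability is at most \<open>\<eta>\<close> (\<open>kernel_nsp_failure_prob\<close>).

Finally, the probability of the recovery event is only meaningful if the event is measurable. The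
arrays whose kernel has the null space property form an open set, because the failure is witnessed by
a vector in the compact unit sphere (\<open>open_kernel_nsp\<close>).\<close>

section \<open>Exponential moments of subexponential variables\<close>

text \<open>Integrating the tail over the levels \<open>n K\<close> gives a finite moment \<open>B\<close> of \<open>exp (|\<xi>| / (2 K))\<close>.
Dividing the exponent by a further integer \<open>r \<ge> B\<close> brings the moment below \<open>2\<close>, since by Bernoulli
\<open>y\<^sup>1\<^sup>/\<^sup>r \<le> 1 + (y - 1) / r\<close>. The lemma excludes that the infimum in the subexponential norm is taken
over the empty set, where its value would say nothing.\<close>

lemma exp_moment_of_subexponential:
  fixes \<xi> :: "'w \<Rightarrow> real"
  assumes M: "prob_space M" and [measurable]: "\<xi> \<in> borel_measurable M" and sub: "subexponential M \<xi>"
  shows "\<exists>t>0. (\<integral>\<^sup>+\<omega>. ennreal (exp (\<bar>\<xi> \<omega>\<bar> / t)) \<partial>M) \<le> 2"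
proof -
  interpret prob_space M by (rule M)
  obtain K where K: "K > 0" and tail: "\<And>t. t \<ge> 0 \<Longrightarrow> \<P>(\<omega> in M. \<bar>\<xi> \<omega>\<bar> \<ge> t) \<le> 2 * exp (- t / K)"
    using sub unfolding subexponential_def by blast
  define q where "q = exp (- 1 / 2 :: real)"
  have q: "0 \<le> q" "q < 1" by (auto simp: q_def)
  define B where "B = (\<Sum>n. 2 * exp (1/2) * q ^ n)"
  have sB: "summable (\<lambda>n. 2 * exp (1/2) * q ^ n)"
    using q by (intro summable_mult summable_geometric) auto
  have B0: "B \<ge> 0" unfolding B_def by (intro suminf_nonneg sB) (use q in auto)
  have point: "ennreal (exp (\<bar>\<xi> \<omega>\<bar> / (2 * K)))
      \<le> (\<Sum>n. ennreal (exp ((real n + 1) / 2)) * indicator {\<omega> \<in> space M. \<bar>\<xi> \<omega>\<bar> \<ge> real n * K} \<omega>)"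
    if "\<omega> \<in> space M" for \<omega>
  proof -
    \<comment> \<open>The term of the series whose level set reaches just below the value already dominates.\<close>
    define n where "n = nat \<lfloor>\<bar>\<xi> \<omega>\<bar> / K\<rfloor>"
    have n: "real n \<le> \<bar>\<xi> \<omega>\<bar> / K" "\<bar>\<xi> \<omega>\<bar> / K \<le> real n + 1"
      using K unfolding n_def by (auto simp: of_nat_nat)
    have "ennreal (exp (\<bar>\<xi> \<omega>\<bar> / (2 * K))) \<le> ennreal (exp ((real n + 1) / 2))"
      using n K by (intro ennreal_leI) (simp add: field_simps)
    also have "\<dots> = (\<Sum>k\<in>{n}. ennreal (exp ((real k + 1) / 2)) * indicator {\<omega> \<in> space M. \<bar>\<xi> \<omega>\<bar> \<ge> real k * K} \<omega>)"
      using n K that by (simp add: field_simps)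
    also have "\<dots> \<le> (\<Sum>n. ennreal (exp ((real n + 1) / 2)) * indicator {\<omega> \<in> space M. \<bar>\<xi> \<omega>\<bar> \<ge> real n * K} \<omega>)"
      by (rule sum_le_suminf) auto
    finally show ?thesis .
  qed
  have "(\<integral>\<^sup>+\<omega>. ennreal (exp (\<bar>\<xi> \<omega>\<bar> / (2 * K))) \<partial>M)
      \<le> (\<integral>\<^sup>+\<omega>. (\<Sum>n. ennreal (exp ((real n + 1) / 2)) * indicator {\<omega> \<in> space M. \<bar>\<xi> \<omega>\<bar> \<ge> real n * K} \<omega>) \<partial>M)"
    by (intro nn_integral_mono point)
  also have "\<dots> = (\<Sum>n. \<integral>\<^sup>+\<omega>. ennreal (exp ((real n + 1) / 2)) * indicator {\<omega> \<in> space M. \<bar>\<xi> \<omega>\<bar> \<ge> real n * K} \<omega> \<partial>M)"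
    by (intro nn_integral_suminf) auto
  also have "\<dots> = (\<Sum>n. ennreal (exp ((real n + 1) / 2)) * emeasure M {\<omega> \<in> space M. \<bar>\<xi> \<omega>\<bar> \<ge> real n * K})"
    by (simp add: nn_integral_cmult_indicator)
  also have "\<dots> \<le> (\<Sum>n. ennreal (2 * exp (1/2) * q ^ n))"
  proof (intro suminf_le)
    fix n
    have "\<P>(\<omega> in M. \<bar>\<xi> \<omega>\<bar> \<ge> real n * K) \<le> 2 * exp (- real n)"
      using tail[of "real n * K"] K by simp
    then have "exp ((real n + 1) / 2) * \<P>(\<omega> in M. \<bar>\<xi> \<omega>\<bar> \<ge> real n * K) \<le> exp ((real n + 1) / 2) * (2 * exp (- real n))"
      by (intro mult_left_mono) auto
    also have "\<dots> = 2 * exp (1/2) * q ^ n"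
      unfolding q_def exp_of_nat_mult[symmetric] by (simp add: exp_add[symmetric] field_simps)
    finally show "ennreal (exp ((real n + 1) / 2)) * emeasure M {\<omega> \<in> space M. \<bar>\<xi> \<omega>\<bar> \<ge> real n * K}
       \<le> ennreal (2 * exp (1/2) * q ^ n)"
      by (simp add: emeasure_eq_measure ennreal_mult[symmetric] ennreal_leI)
  qed auto
  also have "\<dots> = ennreal B" unfolding B_def
    by (rule suminf_ennreal2[OF _ sB]) (use q in auto)
  finally have B: "(\<integral>\<^sup>+\<omega>. ennreal (exp (\<bar>\<xi> \<omega>\<bar> / (2 * K))) \<partial>M) \<le> ennreal B" .
  define r where "r = nat \<lceil>B\<rceil> + 1"
  have r: "real r \<ge> B" "r > 0" "real r \<ge> 1" unfolding r_def using B0 by linarith+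
  have "(\<integral>\<^sup>+\<omega>. ennreal (exp (\<bar>\<xi> \<omega>\<bar> / (2 * K * r))) \<partial>M)
     \<le> (\<integral>\<^sup>+\<omega>. ennreal 1 + ennreal (1 / r) * ennreal (exp (\<bar>\<xi> \<omega>\<bar> / (2 * K))) \<partial>M)"
  proof (intro nn_integral_mono)
    fix \<omega>
    let ?e = "exp (\<bar>\<xi> \<omega>\<bar> / (2 * K * r))"
    have "?e ^ r = exp (\<bar>\<xi> \<omega>\<bar> / (2 * K))"
      using r K by (simp add: exp_of_nat_mult[symmetric])
    then have "1 + real r * (?e - 1) \<le> exp (\<bar>\<xi> \<omega>\<bar> / (2 * K))"
      using Bernoulli_inequality[of "?e - 1" r] by simp
    then have "?e \<le> 1 + (exp (\<bar>\<xi> \<omega>\<bar> / (2 * K)) - 1) / r"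
      using r by (simp add: field_simps)
    also have "\<dots> \<le> 1 + 1 / r * exp (\<bar>\<xi> \<omega>\<bar> / (2 * K))"
      using r by (simp add: field_simps)
    finally show "ennreal ?e \<le> ennreal 1 + ennreal (1 / r) * ennreal (exp (\<bar>\<xi> \<omega>\<bar> / (2 * K)))"
      using r by (simp add: ennreal_mult[symmetric] ennreal_plus[symmetric] ennreal_leI del: ennreal_plus ennreal_1)
  qed
  also have "\<dots> = 1 + ennreal (1 / r) * (\<integral>\<^sup>+\<omega>. ennreal (exp (\<bar>\<xi> \<omega>\<bar> / (2 * K))) \<partial>M)"
    by (simp add: nn_integral_add nn_integral_cmult emeasure_space_1)
  also have "\<dots> \<le> 1 + ennreal (1 / r) * ennreal B"
    by (intro add_left_mono mult_left_mono B) auto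
  also have "\<dots> = ennreal (1 + 1 / r * B)"
    using r B0 by (simp add: ennreal_mult[symmetric] ennreal_plus[symmetric] del: ennreal_plus ennreal_1 add: ennreal_1[symmetric])
  also have "\<dots> \<le> ennreal 2"
    using r by (intro ennreal_leI) (simp add: field_simps)
  finally have "(\<integral>\<^sup>+\<omega>. ennreal (exp (\<bar>\<xi> \<omega>\<bar> / (2 * K * r))) \<partial>M) \<le> 2" by simp
  moreover have "2 * K * r > 0" using K r by simp
  ultimately show ?thesis by blast
qed

lemma exp_moment_of_subexp_norm:
  fixes \<xi> :: "'w \<Rightarrow> real"
  assumes M: "prob_space M" and \<xi>: "\<xi> \<in> borel_measurable M" and sub: "subexponential M \<xi>"
    and norm: "subexp_norm M \<xi> < t"
  shows "(\<integral>\<^sup>+\<omega>. ennreal (exp (\<bar>\<xi> \<omega>\<bar> / t)) \<partial>M) \<le> 2"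
proof -
  let ?A = "{t. t > 0 \<and> (\<integral>\<^sup>+\<omega>. ennreal (exp (\<bar>\<xi> \<omega>\<bar> / t)) \<partial>M) \<le> 2}"
  have "?A \<noteq> {}" using exp_moment_of_subexponential[OF M \<xi> sub] by auto
  then obtain u where u: "u \<in> ?A" "u < t"
    using norm cInf_lessD[of ?A t] unfolding subexp_norm_def by blast
  then have "(\<integral>\<^sup>+\<omega>. ennreal (exp (\<bar>\<xi> \<omega>\<bar> / t)) \<partial>M) \<le> (\<integral>\<^sup>+\<omega>. ennreal (exp (\<bar>\<xi> \<omega>\<bar> / u)) \<partial>M)"
    by (intro nn_integral_mono ennreal_leI) (auto intro!: divide_left_mono)
  then show ?thesis using u by auto
qed

lemma exp_le_quadratic: "exp (x::real) \<le> 1 + x + x\<^sup>2 / 2 * exp \<bar>x\<bar>"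
proof -
  obtain t where t: "\<bar>t\<bar> \<le> \<bar>x\<bar>" "exp x = (\<Sum>m<2. x ^ m / fact m) + exp t / fact 2 * x ^ 2"
    using Maclaurin_exp_le[of x 2] by blast
  have "exp t / 2 * x\<^sup>2 \<le> exp \<bar>x\<bar> / 2 * x\<^sup>2" using t by (intro mult_right_mono) auto
  then show ?thesis using t(2) by (simp add: numeral_2_eq_2 field_simps)
qed

lemma power_le_fact_exp: "0 \<le> (x::real) \<Longrightarrow> x ^ n \<le> fact n * exp x"
proof -
  assume x: "0 \<le> x"
  have "(\<Sum>k\<in>{n}. x ^ k /\<^sub>R fact k) \<le> (\<Sum>k. x ^ k /\<^sub>R fact k)"
    using x summable_exp_generic[of x] by (intro sum_le_suminf) auto
  then show ?thesis by (simp add: exp_def field_simps)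
qed

context prob_space begin

text \<open>A centered variable has no linear term, so its moment generating function is Gaussian near \<open>0\<close>; the
quadratic remainder is absorbed by the exponential moment, half of whose exponent pays for the square
and half for \<open>exp |\<theta> \<xi>|\<close>.\<close>

lemma centered_mgf_bound:
  assumes [measurable]: "\<xi> \<in> borel_measurable M" and K: "K > 0"
    and e: "(\<integral>\<^sup>+\<omega>. ennreal (exp (\<bar>\<xi> \<omega>\<bar> / K)) \<partial>M) \<le> 2"
    and mean: "expectation \<xi> = 0" and \<theta>: "\<bar>\<theta>\<bar> \<le> 1 / (2 * K)"
  shows "(\<integral>\<^sup>+\<omega>. ennreal (exp (\<theta> * \<xi> \<omega>)) \<partial>M) \<le> ennreal (exp (8 * K\<^sup>2 * \<theta>\<^sup>2))"
proof -
  let ?E = "\<lambda>\<omega>. exp (\<bar>\<xi> \<omega>\<bar> / K)"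
  have intE: "integrable M ?E"
    by (rule integrableI_bounded) (use e in \<open>auto simp: less_top[symmetric] top_unique\<close>)
  have E2: "expectation ?E \<le> 2"
    using e ennreal_le_iff[of 2 "expectation ?E"] by (simp add: nn_integral_eq_integral[OF intE])
  have int\<xi>: "integrable M \<xi>"
  proof (rule Bochner_Integration.integrable_bound[OF integrable_mult_right[OF intE, of K]])
    show "AE \<omega> in M. norm (\<xi> \<omega>) \<le> norm (K * ?E \<omega>)"
    proof (intro AE_I2)
      fix \<omega>
      show "norm (\<xi> \<omega>) \<le> norm (K * ?E \<omega>)"
        using power_le_fact_exp[of "\<bar>\<xi> \<omega>\<bar> / K" 1] K by (simp add: field_simps)
    qed
  qed auto
  have point: "exp (\<theta> * \<xi> \<omega>) \<le> 1 + \<theta> * \<xi> \<omega> + 4 * K\<^sup>2 * \<theta>\<^sup>2 * ?E \<omega>" for \<omega>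
  proof -
    define y where "y = \<bar>\<xi> \<omega>\<bar> / (2 * K)"
    have y: "y \<ge> 0" "\<bar>\<xi> \<omega>\<bar> = 2 * K * y" using K by (auto simp: y_def)
    have "\<bar>\<theta> * \<xi> \<omega>\<bar> \<le> y"
      using mult_right_mono[OF \<theta>, of "\<bar>\<xi> \<omega>\<bar>"] by (simp add: y_def abs_mult)
    then have "(\<theta> * \<xi> \<omega>)\<^sup>2 / 2 * exp \<bar>\<theta> * \<xi> \<omega>\<bar> \<le> (\<theta> * \<xi> \<omega>)\<^sup>2 / 2 * exp y"
      by (intro mult_left_mono) auto
    also have "\<dots> = 2 * K\<^sup>2 * \<theta>\<^sup>2 * (y\<^sup>2 * exp y)"
    proof -
      have "(\<xi> \<omega>)\<^sup>2 = (2 * K * y)\<^sup>2" using y(2) by (metis power2_abs)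
      then show ?thesis by (simp add: power_mult_distrib)
    qed
    also have "\<dots> \<le> 2 * K\<^sup>2 * \<theta>\<^sup>2 * ((2 * exp y) * exp y)"
      using power_le_fact_exp[OF y(1), of 2] K by (intro mult_left_mono mult_right_mono) (auto simp: numeral_2_eq_2)
    also have "\<dots> = 4 * K\<^sup>2 * \<theta>\<^sup>2 * ?E \<omega>"
      using K by (simp add: mult_exp_exp y_def)
    finally show ?thesis using exp_le_quadratic[of "\<theta> * \<xi> \<omega>"] by linarith
  qed
  have int: "integrable M (\<lambda>\<omega>. 1 + \<theta> * \<xi> \<omega> + 4 * K\<^sup>2 * \<theta>\<^sup>2 * ?E \<omega>)"
    using intE int\<xi> by auto
  have "(\<integral>\<^sup>+\<omega>. ennreal (exp (\<theta> * \<xi> \<omega>)) \<partial>M) \<le> (\<integral>\<^sup>+\<omega>. ennreal (1 + \<theta> * \<xi> \<omega> + 4 * K\<^sup>2 * \<theta>\<^sup>2 * ?E \<omega>) \<partial>M)"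
    by (intro nn_integral_mono ennreal_leI point)
  also have "\<dots> = ennreal (expectation (\<lambda>\<omega>. 1 + \<theta> * \<xi> \<omega> + 4 * K\<^sup>2 * \<theta>\<^sup>2 * ?E \<omega>))"
    by (rule nn_integral_eq_integral[OF int])
       (use point in \<open>auto intro!: AE_I2 order_trans[OF less_imp_le[OF exp_gt_zero]]\<close>)
  also have "expectation (\<lambda>\<omega>. 1 + \<theta> * \<xi> \<omega> + 4 * K\<^sup>2 * \<theta>\<^sup>2 * ?E \<omega>) = 1 + 4 * K\<^sup>2 * \<theta>\<^sup>2 * expectation ?E"
    using intE int\<xi> mean by (simp add: prob_space)
  also have "\<dots> \<le> 1 + 4 * K\<^sup>2 * \<theta>\<^sup>2 * 2"
    using E2 by (intro add_left_mono mult_left_mono) auto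
  also have "\<dots> \<le> exp (8 * K\<^sup>2 * \<theta>\<^sup>2)"
    using exp_ge_add_one_self[of "8 * K\<^sup>2 * \<theta>\<^sup>2"] by (simp add: mult.assoc)
  finally show ?thesis by (simp add: ennreal_leI)
qed

text \<open>Unit linear combinations inherit the Gaussian bound with the same constants, by independence; the
range of \<open>\<theta>\<close> does not shrink because each coefficient is at most \<open>1\<close> in absolute value.\<close>

lemma linear_mgf_bound:
  assumes fin: "finite J" and ind: "indep_vars (\<lambda>_. borel) \<xi> J" and K: "K > 0"
    and e: "\<And>j. j \<in> J \<Longrightarrow> (\<integral>\<^sup>+\<omega>. ennreal (exp (\<bar>\<xi> j \<omega>\<bar> / K)) \<partial>M) \<le> 2"
    and mean: "\<And>j. j \<in> J \<Longrightarrow> expectation (\<xi> j) = 0"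
    and a: "(\<Sum>j\<in>J. (a j)\<^sup>2) = 1" and \<theta>: "\<bar>\<theta>\<bar> \<le> 1 / (2 * K)"
  shows "(\<integral>\<^sup>+\<omega>. ennreal (exp (\<theta> * (\<Sum>j\<in>J. a j * \<xi> j \<omega>))) \<partial>M) \<le> ennreal (exp (8 * K\<^sup>2 * \<theta>\<^sup>2))"
proof -
  have rv: "\<xi> j \<in> borel_measurable M" if "j \<in> J" for j using ind that by (simp add: indep_vars_def)
  have a1: "\<bar>a j\<bar> \<le> 1" if "j \<in> J" for j
  proof -
    have "(a j)\<^sup>2 \<le> 1" unfolding a[symmetric] by (rule member_le_sum) (use that fin in auto)
    then show ?thesis by (simp add: abs_square_le_1)
  qed
  have "(\<integral>\<^sup>+\<omega>. ennreal (exp (\<theta> * (\<Sum>j\<in>J. a j * \<xi> j \<omega>))) \<partial>M)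
      = (\<integral>\<^sup>+\<omega>. (\<Prod>j\<in>J. ennreal (exp ((\<theta> * a j) * \<xi> j \<omega>))) \<partial>M)"
    by (simp add: prod_ennreal exp_sum[OF fin, symmetric] sum_distrib_left mult.assoc)
  also have "\<dots> = (\<Prod>j\<in>J. \<integral>\<^sup>+\<omega>. ennreal (exp ((\<theta> * a j) * \<xi> j \<omega>)) \<partial>M)"
    by (intro indep_vars_nn_integral fin indep_vars_compose2[OF ind]) auto
  also have "\<dots> \<le> (\<Prod>j\<in>J. ennreal (exp (8 * K\<^sup>2 * (\<theta> * a j)\<^sup>2)))"
  proof (intro prod_mono_ennreal)
    fix j assume j: "j \<in> J"
    have "\<bar>\<theta> * a j\<bar> \<le> 1 / (2 * K) * 1"
      unfolding abs_mult using \<theta> a1[OF j] K by (intro mult_mono) auto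
    then show "(\<integral>\<^sup>+\<omega>. ennreal (exp ((\<theta> * a j) * \<xi> j \<omega>)) \<partial>M) \<le> ennreal (exp (8 * K\<^sup>2 * (\<theta> * a j)\<^sup>2))"
      by (intro centered_mgf_bound rv j K e mean) simp
  qed
  also have "\<dots> = ennreal (exp (\<Sum>j\<in>J. 8 * K\<^sup>2 * (\<theta> * a j)\<^sup>2))"
    by (simp add: prod_ennreal exp_sum[OF fin, symmetric])
  also have "(\<Sum>j\<in>J. 8 * K\<^sup>2 * (\<theta> * a j)\<^sup>2) = 8 * K\<^sup>2 * \<theta>\<^sup>2 * (\<Sum>j\<in>J. (a j)\<^sup>2)"
    by (simp add: sum_distrib_left power_mult_distrib mult_ac)
  finally show ?thesis by (simp add: a)
qed

lemma linear_exp_abs_bound: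
  assumes fin: "finite J" and ind: "indep_vars (\<lambda>_. borel) \<xi> J" and K: "K > 0"
    and e: "\<And>j. j \<in> J \<Longrightarrow> (\<integral>\<^sup>+\<omega>. ennreal (exp (\<bar>\<xi> j \<omega>\<bar> / K)) \<partial>M) \<le> 2"
    and mean: "\<And>j. j \<in> J \<Longrightarrow> expectation (\<xi> j) = 0"
    and a: "(\<Sum>j\<in>J. (a j)\<^sup>2) = 1"
  shows "(\<integral>\<^sup>+\<omega>. ennreal (exp (\<bar>\<Sum>j\<in>J. a j * \<xi> j \<omega>\<bar> / (2 * K))) \<partial>M) \<le> ennreal (2 * exp 2)"
proof -
  have rv[measurable]: "\<xi> j \<in> borel_measurable M" if "j \<in> J" for j using ind that by (simp add: indep_vars_def)
  define Y where "Y \<omega> = (\<Sum>j\<in>J. a j * \<xi> j \<omega>)" for \<omega>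
  have [measurable]: "Y \<in> borel_measurable M" unfolding Y_def by measurable
  have bd: "(\<integral>\<^sup>+\<omega>. ennreal (exp (\<theta> * Y \<omega>)) \<partial>M) \<le> ennreal (exp 2)" if "\<bar>\<theta>\<bar> = 1 / (2 * K)" for \<theta>
  proof -
    have "\<theta>\<^sup>2 = (1 / (2 * K))\<^sup>2" using that by (metis power2_abs)
    then have "8 * K\<^sup>2 * \<theta>\<^sup>2 = 2" using K by (simp add: power_divide power_mult_distrib)
    then show ?thesis unfolding Y_def using linear_mgf_bound[OF assms, of \<theta>] that by (metis order.refl)
  qed
  have "(\<integral>\<^sup>+\<omega>. ennreal (exp (\<bar>Y \<omega>\<bar> / (2 * K))) \<partial>M)
      \<le> (\<integral>\<^sup>+\<omega>. ennreal (exp (1 / (2 * K) * Y \<omega>)) + ennreal (exp (- 1 / (2 * K) * Y \<omega>)) \<partial>M)"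
    by (intro nn_integral_mono) (auto simp: ennreal_plus[symmetric] abs_if simp del: ennreal_plus intro!: ennreal_leI)
  also have "\<dots> = (\<integral>\<^sup>+\<omega>. ennreal (exp (1 / (2 * K) * Y \<omega>)) \<partial>M) + (\<integral>\<^sup>+\<omega>. ennreal (exp (- 1 / (2 * K) * Y \<omega>)) \<partial>M)"
    by (intro nn_integral_add) auto
  also have "\<dots> \<le> ennreal (exp 2) + ennreal (exp 2)"
    using K by (intro add_mono bd) auto
  also have "\<dots> = ennreal (2 * exp 2)" by (simp add: ennreal_plus[symmetric] del: ennreal_plus)
  finally show ?thesis unfolding Y_def .
qed

lemma linear_second_moment:
  fixes \<xi> :: "'i \<Rightarrow> 'a \<Rightarrow> real"
  assumes fin: "finite J" and ind: "indep_vars (\<lambda>_. borel) \<xi> J"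
    and int: "\<And>j. j \<in> J \<Longrightarrow> integrable M (\<xi> j)" and sq: "\<And>j. j \<in> J \<Longrightarrow> integrable M (\<lambda>\<omega>. (\<xi> j \<omega>)\<^sup>2)"
    and mean: "\<And>j. j \<in> J \<Longrightarrow> expectation (\<xi> j) = 0"
    and var: "\<And>j. j \<in> J \<Longrightarrow> expectation (\<lambda>\<omega>. (\<xi> j \<omega>)\<^sup>2) = 1"
  shows "expectation (\<lambda>\<omega>. (\<Sum>j\<in>J. a j * \<xi> j \<omega>)\<^sup>2) = (\<Sum>j\<in>J. (a j)\<^sup>2)"
    and "integrable M (\<lambda>\<omega>. (\<Sum>j\<in>J. a j * \<xi> j \<omega>)\<^sup>2)"
proof -
  have prod: "integrable M (\<lambda>\<omega>. \<xi> i \<omega> * \<xi> j \<omega>) \<and> expectation (\<lambda>\<omega>. \<xi> i \<omega> * \<xi> j \<omega>) = (if i = j then 1 else 0)"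
    if "i \<in> J" "j \<in> J" for i j
  proof (cases "i = j")
    case True
    then show ?thesis using sq var that by (simp add: power2_eq_square)
  next
    case False
    have ij: "indep_vars (\<lambda>_. borel) \<xi> {i, j}" by (rule indep_vars_subset[OF ind]) (use that in auto)
    have "integrable M (\<lambda>\<omega>. \<Prod>k\<in>{i,j}. \<xi> k \<omega>)"
      by (rule indep_vars_integrable[OF _ ij]) (use int that in auto)
    moreover have "expectation (\<lambda>\<omega>. \<Prod>k\<in>{i,j}. \<xi> k \<omega>) = (\<Prod>k\<in>{i,j}. expectation (\<xi> k))"
      by (rule indep_vars_lebesgue_integral[OF _ ij]) (use int that in auto)
    ultimately show ?thesis using False mean that by simp
  qed
  have eq: "(\<Sum>j\<in>J. a j * \<xi> j \<omega>)\<^sup>2 = (\<Sum>i\<in>J. \<Sum>j\<in>J. (a i * a j) * (\<xi> i \<omega> * \<xi> j \<omega>))" for \<omega>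
    by (simp add: power2_eq_square sum_product mult_ac)
  show "integrable M (\<lambda>\<omega>. (\<Sum>j\<in>J. a j * \<xi> j \<omega>)\<^sup>2)"
    unfolding eq using prod by (intro Bochner_Integration.integrable_sum) auto
  have "expectation (\<lambda>\<omega>. (\<Sum>j\<in>J. a j * \<xi> j \<omega>)\<^sup>2) = (\<Sum>i\<in>J. \<Sum>j\<in>J. (a i * a j) * (if i = j then 1 else 0))"
    unfolding eq using prod by (simp add: Bochner_Integration.integral_sum)
  also have "\<dots> = (\<Sum>j\<in>J. (a j)\<^sup>2)"
    using fin by (simp add: power2_eq_square if_distrib[of "\<lambda>x. _ * x"] cong: if_cong)
  finally show "expectation (\<lambda>\<omega>. (\<Sum>j\<in>J. a j * \<xi> j \<omega>)\<^sup>2) = (\<Sum>j\<in>J. (a j)\<^sup>2)" .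
qed

text \<open>The first moment is bounded below by interpolation between the second and the fourth moment: with
\<open>t = |Y| / B\<close> one has \<open>t \<ge> t\<^sup>2 - t\<^sup>4\<close>, hence \<open>E |Y| \<ge> (1 - E Y\<^sup>4 / B\<^sup>2) / B\<close>, and the choice of \<open>B\<close> of
order \<open>K\<^sup>2\<close> with \<open>B\<^sup>2 \<ge> 2 E Y\<^sup>4\<close> leaves \<open>1 / (2 B)\<close>.\<close>

lemma first_moment_lower_bound:
  assumes [measurable]: "Y \<in> borel_measurable M" and K: "K > 0"
    and e: "(\<integral>\<^sup>+\<omega>. ennreal (exp (\<bar>Y \<omega>\<bar> / (2 * K))) \<partial>M) \<le> ennreal (2 * exp 2)"
    and var: "expectation (\<lambda>\<omega>. (Y \<omega>)\<^sup>2) = 1"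
  shows "1 / (222 * K\<^sup>2) \<le> expectation (\<lambda>\<omega>. \<bar>Y \<omega>\<bar>)" and "integrable M Y"
proof -
  let ?E = "\<lambda>\<omega>. exp (\<bar>Y \<omega>\<bar> / (2 * K))"
  have intE: "integrable M ?E"
    by (rule integrableI_bounded) (use e in \<open>auto simp: less_top[symmetric] top_unique\<close>)
  have E2: "expectation ?E \<le> 2 * exp 2"
    using e by (simp add: nn_integral_eq_integral[OF intE])
  have pw: "\<bar>Y \<omega>\<bar> ^ n \<le> (2 * K) ^ n * fact n * ?E \<omega>" for n \<omega>
    using power_le_fact_exp[of "\<bar>Y \<omega>\<bar> / (2 * K)" n] K by (simp add: field_simps power_divide)
  have int: "integrable M (\<lambda>\<omega>. \<bar>Y \<omega>\<bar> ^ n)" for n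
    by (rule Bochner_Integration.integrable_bound[OF integrable_mult_right[OF intE, of "(2 * K) ^ n * fact n"]])
       (use pw[of _ n] K in \<open>auto intro!: AE_I2 simp: abs_mult\<close>)
  show intY: "integrable M Y"
    using int[of 1] by (simp add: integrable_abs_iff)
  have e8: "exp 2 \<le> (8::real)"
  proof -
    have "exp 2 = exp 1 * exp (1::real)" by (simp add: mult_exp_exp)
    also have "\<dots> \<le> (2.8::real) * 2.8" using e_less_272 by (intro mult_mono) auto
    finally show ?thesis by simp
  qed
  define B where "B = 111 * K\<^sup>2"
  have B: "B > 0" using K by (simp add: B_def)
  have "expectation (\<lambda>\<omega>. \<bar>Y \<omega>\<bar> ^ 4) \<le> expectation (\<lambda>\<omega>. (2 * K) ^ 4 * fact 4 * ?E \<omega>)"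
    by (intro integral_mono pw int integrable_mult_right intE)
  also have "\<dots> \<le> (2 * K) ^ 4 * fact 4 * (2 * 8)"
    using E2 e8 K by simp
  also have "\<dots> \<le> B\<^sup>2 / 2"
    using K by (simp add: B_def fact_numeral power_mult_distrib)
  finally have M4: "expectation (\<lambda>\<omega>. \<bar>Y \<omega>\<bar> ^ 4) \<le> B\<^sup>2 / 2" .
  have point: "(Y \<omega>)\<^sup>2 / B - \<bar>Y \<omega>\<bar> ^ 4 / B ^ 3 \<le> \<bar>Y \<omega>\<bar>" for \<omega>
  proof -
    define t where "t = \<bar>Y \<omega>\<bar> / B"
    have t: "t \<ge> 0" "\<bar>Y \<omega>\<bar> = B * t" using B by (auto simp: t_def)
    have "t\<^sup>2 - t ^ 4 \<le> t"
    proof (cases "t \<le> 1")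
      case True
      then have "t\<^sup>2 \<le> t" using t by (simp add: power2_eq_square mult_left_le)
      moreover have "t ^ 4 \<ge> 0" by simp
      ultimately show ?thesis by linarith
    next
      case False
      then have "t\<^sup>2 \<le> t ^ 4" by (intro power_increasing) auto
      then show ?thesis using t by linarith
    qed
    then have "B * (t\<^sup>2 - t ^ 4) \<le> B * t" using B by (intro mult_left_mono) auto
    moreover have "(Y \<omega>)\<^sup>2 = (B * t)\<^sup>2" using t(2) by (metis power2_abs)
    moreover have "B * t\<^sup>2 = (B * t)\<^sup>2 / B" "B * t ^ 4 = (B * t) ^ 4 / B ^ 3"
      using B by (simp_all add: power_mult_distrib power2_eq_square power_numeral_reduce)
    ultimately show ?thesis unfolding t(2) by (simp add: right_diff_distrib)
  qed
  have sq: "integrable M (\<lambda>\<omega>. (Y \<omega>)\<^sup>2)" using int[of 2] by simp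
  have "1 / B - B\<^sup>2 / 2 / B ^ 3 \<le> 1 / B - expectation (\<lambda>\<omega>. \<bar>Y \<omega>\<bar> ^ 4) / B ^ 3"
    using M4 B by (intro diff_left_mono divide_right_mono) auto
  also have "\<dots> = expectation (\<lambda>\<omega>. (Y \<omega>)\<^sup>2 / B - \<bar>Y \<omega>\<bar> ^ 4 / B ^ 3)"
    using int[of 4] sq var by simp
  also have "\<dots> \<le> expectation (\<lambda>\<omega>. \<bar>Y \<omega>\<bar>)"
    using int[of 4] sq intY by (intro integral_mono point) auto
  also have "1 / B - B\<^sup>2 / 2 / B ^ 3 = 1 / (222 * K\<^sup>2)"
    using B by (simp add: field_simps power2_eq_square power3_eq_cube B_def)
  finally show "1 / (222 * K\<^sup>2) \<le> expectation (\<lambda>\<omega>. \<bar>Y \<omega>\<bar>)" .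
qed

text \<open>Since \<open>exp (-x) \<le> 1 - x + x\<^sup>2/2\<close> for \<open>x \<ge> 0\<close>, the lower tail of \<open>|Y|\<close> is governed by its first two
moments.\<close>

lemma laplace_abs_bound:
  assumes [measurable]: "Y \<in> borel_measurable M" and int: "integrable M Y" "integrable M (\<lambda>\<omega>. (Y \<omega>)\<^sup>2)"
    and var: "expectation (\<lambda>\<omega>. (Y \<omega>)\<^sup>2) = 1"
    and c: "0 \<le> c" "c \<le> expectation (\<lambda>\<omega>. \<bar>Y \<omega>\<bar>)"
  shows "(\<integral>\<^sup>+\<omega>. ennreal (exp (- c * \<bar>Y \<omega>\<bar>)) \<partial>M) \<le> ennreal (exp (- c\<^sup>2 / 2))"
proof -
  have point: "exp (- c * \<bar>Y \<omega>\<bar>) \<le> 1 - c * \<bar>Y \<omega>\<bar> + c\<^sup>2 / 2 * (Y \<omega>)\<^sup>2" for \<omega>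
  proof -
    define x where "x = c * \<bar>Y \<omega>\<bar>"
    have x: "x \<ge> 0" using c by (simp add: x_def)
    have "exp (-x) \<le> 1 - x + x\<^sup>2 / 2"
    proof (cases "x = 0")
      case False
      then have "-x < 0" using x by simp
      then obtain t where t: "-x < t" "t < 0" "exp (-x) = (\<Sum>m<2. exp 0 / fact m * (-x) ^ m) + exp t / fact 2 * (-x) ^ 2"
        using Maclaurin_minus[of "-x" 2 "\<lambda>_. exp" exp] by (auto intro: DERIV_exp)
      have "exp t / 2 * x\<^sup>2 \<le> 1 / 2 * x\<^sup>2" using t by (intro mult_right_mono) auto
      then show ?thesis using t(3) by (simp add: numeral_2_eq_2)
    qed simp
    then show ?thesis by (simp add: x_def power_mult_distrib)
  qed
  have "(\<integral>\<^sup>+\<omega>. ennreal (exp (- c * \<bar>Y \<omega>\<bar>)) \<partial>M) \<le> (\<integral>\<^sup>+\<omega>. ennreal (1 - c * \<bar>Y \<omega>\<bar> + c\<^sup>2 / 2 * (Y \<omega>)\<^sup>2) \<partial>M)"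
    by (intro nn_integral_mono ennreal_leI point)
  also have "\<dots> = ennreal (expectation (\<lambda>\<omega>. 1 - c * \<bar>Y \<omega>\<bar> + c\<^sup>2 / 2 * (Y \<omega>)\<^sup>2))"
    by (rule nn_integral_eq_integral)
       (use point int in \<open>auto intro!: AE_I2 order_trans[OF less_imp_le[OF exp_gt_zero]]\<close>)
  also have "expectation (\<lambda>\<omega>. 1 - c * \<bar>Y \<omega>\<bar> + c\<^sup>2 / 2 * (Y \<omega>)\<^sup>2) = 1 - c * expectation (\<lambda>\<omega>. \<bar>Y \<omega>\<bar>) + c\<^sup>2 / 2"
    using int var by (simp add: prob_space)
  also have "\<dots> \<le> 1 - c * c + c\<^sup>2 / 2"
    using c by (intro add_right_mono diff_left_mono mult_left_mono) auto
  also have "\<dots> \<le> exp (- c\<^sup>2 / 2)"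
    using exp_ge_add_one_self[of "- c\<^sup>2 / 2"] by (simp add: power2_eq_square)
  finally show ?thesis by (simp add: ennreal_leI)
qed

end

text \<open>The lower bound on the first absolute moment of unit linear forms from \<open>first_moment_lower_bound\<close>.\<close>

definition mean_abs_const :: "real \<Rightarrow> real" where "mean_abs_const K = 1 / (222 * K\<^sup>2)"

definition tail_rate :: "real \<Rightarrow> real" where "tail_rate K = min 1 ((mean_abs_const K)\<^sup>2 / 4)"

context prob_space begin

text \<open>Chernoff bounds for the sum of \<open>|Y\<^sub>i|\<close> over independent rows. For the upper tail the parameter is
\<open>1 / (2 K)\<close>: the moment contributes at most \<open>(2 e\<^sup>2)\<^sup>n \<le> e\<^sup>3\<^sup>n\<close>, and the threshold \<open>8 K n\<close> contributes
\<open>e\<^sup>-\<^sup>4\<^sup>n\<close>. For the lower tail the parameter is the first moment bound \<open>c\<close> itself.\<close>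

lemma row_sum_tails:
  fixes Y :: "'i \<Rightarrow> 'a \<Rightarrow> real"
  assumes fin: "finite R" and ind: "indep_vars (\<lambda>_. borel) Y R" and K: "K > 0"
    and e: "\<And>i. i \<in> R \<Longrightarrow> (\<integral>\<^sup>+\<omega>. ennreal (exp (\<bar>Y i \<omega>\<bar> / (2 * K))) \<partial>M) \<le> ennreal (2 * exp 2)"
    and sq: "\<And>i. i \<in> R \<Longrightarrow> integrable M (\<lambda>\<omega>. (Y i \<omega>)\<^sup>2)"
    and var: "\<And>i. i \<in> R \<Longrightarrow> expectation (\<lambda>\<omega>. (Y i \<omega>)\<^sup>2) = 1"
    and c: "c = 1 / (222 * K\<^sup>2)"
  shows "\<P>(\<omega> in M. (\<Sum>i\<in>R. \<bar>Y i \<omega>\<bar>) \<ge> 8 * K * card R) \<le> exp (- real (card R))"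
    and "\<P>(\<omega> in M. (\<Sum>i\<in>R. \<bar>Y i \<omega>\<bar>) \<le> c / 4 * card R) \<le> exp (- (c\<^sup>2 / 4) * real (card R))"
proof -
  have rv[measurable]: "Y i \<in> borel_measurable M" if "i \<in> R" for i using ind that by (simp add: indep_vars_def)
  have c0: "c > 0" using K c by simp
  define S where "S \<omega> = (\<Sum>i\<in>R. \<bar>Y i \<omega>\<bar>)" for \<omega>
  have [measurable]: "S \<in> borel_measurable M" unfolding S_def by measurable
  have mgf: "(\<integral>\<^sup>+\<omega>. ennreal (exp (\<theta> * S \<omega>)) \<partial>M) \<le> ennreal (b ^ card R)"
    if b: "\<And>i. i \<in> R \<Longrightarrow> (\<integral>\<^sup>+\<omega>. ennreal (exp (\<theta> * \<bar>Y i \<omega>\<bar>)) \<partial>M) \<le> ennreal b" "b \<ge> 0" for \<theta> b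
  proof -
    have "(\<integral>\<^sup>+\<omega>. ennreal (exp (\<theta> * S \<omega>)) \<partial>M) = (\<integral>\<^sup>+\<omega>. (\<Prod>i\<in>R. ennreal (exp (\<theta> * \<bar>Y i \<omega>\<bar>))) \<partial>M)"
      by (simp add: S_def prod_ennreal exp_sum[OF fin, symmetric] sum_distrib_left)
    also have "\<dots> = (\<Prod>i\<in>R. \<integral>\<^sup>+\<omega>. ennreal (exp (\<theta> * \<bar>Y i \<omega>\<bar>)) \<partial>M)"
      by (intro indep_vars_nn_integral fin indep_vars_compose2[OF ind]) auto
    also have "\<dots> \<le> (\<Prod>i\<in>R. ennreal b)" by (intro prod_mono_ennreal b)
    also have "\<dots> = ennreal (b ^ card R)" using b(2) by (simp add: ennreal_power)
    finally show ?thesis .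
  qed
  have "emeasure M {\<omega> \<in> space M. S \<omega> \<ge> 8 * K * card R}
      \<le> ennreal (exp (- (1 / (2 * K)) * (8 * K * card R))) * (\<integral>\<^sup>+\<omega>. ennreal (exp (1 / (2 * K) * S \<omega>)) * indicator (space M) \<omega> \<partial>M)"
    using K by (intro Chernoff_ineq_nn_integral_ge) auto
  also have "(\<integral>\<^sup>+\<omega>. ennreal (exp (1 / (2 * K) * S \<omega>)) * indicator (space M) \<omega> \<partial>M)
      = (\<integral>\<^sup>+\<omega>. ennreal (exp (1 / (2 * K) * S \<omega>)) \<partial>M)"
    by (intro nn_integral_cong) auto
  also have "\<dots> \<le> ennreal (exp 3 ^ card R)"
  proof (rule mgf)
    fix i assume i: "i \<in> R"
    have "(2::real) * exp 2 \<le> exp 1 * exp 2"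
      using exp_ge_add_one_self[of 1] by (intro mult_right_mono) auto
    then have "(2::real) * exp 2 \<le> exp 3" by (simp add: mult_exp_exp)
    then show "(\<integral>\<^sup>+\<omega>. ennreal (exp (1 / (2 * K) * \<bar>Y i \<omega>\<bar>)) \<partial>M) \<le> ennreal (exp 3)"
      using e[OF i] by (auto intro: order_trans ennreal_leI)
  qed simp
  also have "ennreal (exp (- (1 / (2 * K)) * (8 * K * card R))) * ennreal (exp 3 ^ card R) = ennreal (exp (- real (card R)))"
    using K by (simp add: ennreal_mult[symmetric] exp_of_nat_mult[symmetric] mult_exp_exp)
  finally show "\<P>(\<omega> in M. (\<Sum>i\<in>R. \<bar>Y i \<omega>\<bar>) \<ge> 8 * K * card R) \<le> exp (- real (card R))"
    by (simp add: mult_left_mono S_def emeasure_eq_measure)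

  have "emeasure M {\<omega> \<in> space M. S \<omega> \<le> c / 4 * card R}
      \<le> ennreal (exp (c * (c / 4 * card R))) * (\<integral>\<^sup>+\<omega>. ennreal (exp (- c * S \<omega>)) * indicator (space M) \<omega> \<partial>M)"
    using c0 by (intro Chernoff_ineq_nn_integral_le) auto
  also have "(\<integral>\<^sup>+\<omega>. ennreal (exp (- c * S \<omega>)) * indicator (space M) \<omega> \<partial>M)
      = (\<integral>\<^sup>+\<omega>. ennreal (exp (- c * S \<omega>)) \<partial>M)"
    by (intro nn_integral_cong) auto
  also have "\<dots> \<le> ennreal (exp (- c\<^sup>2 / 2) ^ card R)"
  proof (rule mgf)
    fix i assume i: "i \<in> R"
    show "(\<integral>\<^sup>+\<omega>. ennreal (exp (- c * \<bar>Y i \<omega>\<bar>)) \<partial>M) \<le> ennreal (exp (- c\<^sup>2 / 2))"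
      using first_moment_lower_bound[OF rv[OF i] K e[OF i] var[OF i]] c c0
      by (intro laplace_abs_bound rv i sq var) auto
  qed simp
  also have "ennreal (exp (c * (c / 4 * card R))) * ennreal (exp (- c\<^sup>2 / 2) ^ card R) = ennreal (exp (- (c\<^sup>2 / 4) * real (card R)))"
    by (simp add: ennreal_mult[symmetric] exp_of_nat_mult[symmetric] mult_exp_exp)
       (simp add: power2_eq_square field_simps)
  finally show "\<P>(\<omega> in M. (\<Sum>i\<in>R. \<bar>Y i \<omega>\<bar>) \<le> c / 4 * card R) \<le> exp (- (c\<^sup>2 / 4) * real (card R))"
    by (simp add: mult_left_mono S_def emeasure_eq_measure)
qed

end

section \<open>Random measurement blocks\<close>

locale subexponential_blocks = prob_space M for M :: "'w measure" +
  fixes X :: "nat \<times> nat \<times> nat \<Rightarrow> 'w \<Rightarrow> real" and L m d :: nat and K :: real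
  assumes indep: "indep_vars (\<lambda>_. borel) X ({..<L} \<times> {..<m} \<times> {..<d})"
    and K_pos: "K > 0"
    and exp_moment: "k \<in> {..<L} \<times> {..<m} \<times> {..<d} \<Longrightarrow> (\<integral>\<^sup>+\<omega>. ennreal (exp (\<bar>X k \<omega>\<bar> / K)) \<partial>M) \<le> 2"
    and mean: "k \<in> {..<L} \<times> {..<m} \<times> {..<d} \<Longrightarrow> expectation (X k) = 0"
    and variance_one: "k \<in> {..<L} \<times> {..<m} \<times> {..<d} \<Longrightarrow> variance (X k) = 1"
begin

lemma entry_measurable [measurable]: "k \<in> {..<L} \<times> {..<m} \<times> {..<d} \<Longrightarrow> X k \<in> borel_measurable M"
  using indep unfolding indep_vars_def by blast

lemma entry_square: "k \<in> {..<L} \<times> {..<m} \<times> {..<d} \<Longrightarrow> expectation (\<lambda>\<omega>. (X k \<omega>)\<^sup>2) = 1"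
  using mean[of k] variance_one[of k] by simp

lemma entry_square_integrable:
  assumes "k \<in> {..<L} \<times> {..<m} \<times> {..<d}" shows "integrable M (\<lambda>\<omega>. (X k \<omega>)\<^sup>2)"
  using entry_square[OF assms] not_integrable_integral_eq[of M "\<lambda>\<omega>. (X k \<omega>)\<^sup>2"] by fastforce

lemma entry_integrable:
  assumes "k \<in> {..<L} \<times> {..<m} \<times> {..<d}" shows "integrable M (X k)"
  using entry_square_integrable[OF assms] square_integrable_imp_integrable entry_measurable[OF assms] by blast

definition row_form :: "nat \<Rightarrow> (nat \<Rightarrow> real) \<Rightarrow> nat \<Rightarrow> 'w \<Rightarrow> real" where
  "row_form l a i \<omega> = (\<Sum>j<d. a j * X (l, i, j) \<omega>)"

lemma row_form_measurable: "l < L \<Longrightarrow> i < m \<Longrightarrow> row_form l a i \<in> borel_measurable M"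
  unfolding row_form_def by measurable

lemma mean_abs_const_pos: "mean_abs_const K > 0" using K_pos by (simp add: mean_abs_const_def)

lemma block_tails_unit:
  assumes l: "l < L" and a: "(\<Sum>j<d. (a j)\<^sup>2) = 1"
  shows "\<P>(\<omega> in M. (\<Sum>i<m. \<bar>row_form l a i \<omega>\<bar>) \<ge> 8 * K * m) \<le> exp (- real m)"
    and "\<P>(\<omega> in M. (\<Sum>i<m. \<bar>row_form l a i \<omega>\<bar>) \<le> mean_abs_const K / 4 * m) \<le> exp (- ((mean_abs_const K)\<^sup>2 / 4) * m)"
proof -
  have ind: "indep_vars (\<lambda>_. borel) (row_form l a) {..<m}"
  proof -
    have "indep_vars (\<lambda>i. PiM ({l} \<times> {i} \<times> {..<d}) (\<lambda>_. borel)) (\<lambda>i \<omega>. restrict (\<lambda>k. X k \<omega>) ({l} \<times> {i} \<times> {..<d})) {..<m}"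
      by (rule indep_vars_restrict[OF indep]) (use l in \<open>auto simp: disjoint_family_on_def\<close>)
    then have "indep_vars (\<lambda>_. borel) (\<lambda>i \<omega>. (\<lambda>f. \<Sum>j<d. a j * f (l, i, j)) (restrict (\<lambda>k. X k \<omega>) ({l} \<times> {i} \<times> {..<d}))) {..<m}"
      by (rule indep_vars_compose2) measurable
    then show ?thesis by (simp add: row_form_def[abs_def])
  qed
  \<comment> \<open>The entries of one row, so that a row is a linear form in an independent subfamily.\<close>
  define J where "J i = (\<lambda>j. (l, i, j)) ` {..<d}" for i :: nat
  define a' where "a' k = a (snd (snd k))" for k :: "nat \<times> nat \<times> nat"
  have sumJ: "(\<Sum>k\<in>J i. f k) = (\<Sum>j<d. f (l, i, j))" for f :: "_ \<Rightarrow> real" and i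
    unfolding J_def by (subst sum.reindex) (auto simp: inj_on_def)
  have row_form: "row_form l a i = (\<lambda>\<omega>. \<Sum>k\<in>J i. a' k * X k \<omega>)" for i
    by (simp add: sumJ a'_def row_form_def[abs_def])
  have JI: "J i \<subseteq> {..<L} \<times> {..<m} \<times> {..<d}" if "i < m" for i
    using that l by (auto simp: J_def)
  have J: "finite (J i)" "(\<Sum>k\<in>J i. (a' k)\<^sup>2) = 1" for i
    using a by (auto simp: sumJ a'_def) (simp add: J_def)
  have indj: "indep_vars (\<lambda>_. borel) X (J i)" if "i < m" for i
    by (rule indep_vars_subset[OF indep JI[OF that]])
  have e: "(\<integral>\<^sup>+\<omega>. ennreal (exp (\<bar>row_form l a i \<omega>\<bar> / (2 * K))) \<partial>M) \<le> ennreal (2 * exp 2)" if "i \<in> {..<m}" for i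
    unfolding row_form using that JI[of i]
    by (intro linear_exp_abs_bound J indj exp_moment mean K_pos) auto
  have sq: "integrable M (\<lambda>\<omega>. (row_form l a i \<omega>)\<^sup>2)" "expectation (\<lambda>\<omega>. (row_form l a i \<omega>)\<^sup>2) = 1" if "i \<in> {..<m}" for i
  proof -
    have i: "i < m" using that by simp
    have k: "k \<in> {..<L} \<times> {..<m} \<times> {..<d}" if "k \<in> J i" for k using JI[OF i] that by auto
    have "expectation (\<lambda>\<omega>. (\<Sum>k\<in>J i. a' k * X k \<omega>)\<^sup>2) = (\<Sum>k\<in>J i. (a' k)\<^sup>2)"
      "integrable M (\<lambda>\<omega>. (\<Sum>k\<in>J i. a' k * X k \<omega>)\<^sup>2)"
      by (intro linear_second_moment J indj i entry_integrable entry_square_integrable mean entry_square k; assumption)+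
    then show "integrable M (\<lambda>\<omega>. (row_form l a i \<omega>)\<^sup>2)" "expectation (\<lambda>\<omega>. (row_form l a i \<omega>)\<^sup>2) = 1"
      unfolding row_form using J(2)[of i] by simp_all
  qed
  show "\<P>(\<omega> in M. (\<Sum>i<m. \<bar>row_form l a i \<omega>\<bar>) \<ge> 8 * K * m) \<le> exp (- real m)"
    "\<P>(\<omega> in M. (\<Sum>i<m. \<bar>row_form l a i \<omega>\<bar>) \<le> mean_abs_const K / 4 * m) \<le> exp (- ((mean_abs_const K)\<^sup>2 / 4) * m)"
    using row_sum_tails[OF _ ind K_pos e sq mean_abs_const_def] by auto
qed

text \<open>The event that the rows of block \<open>l\<close> do not see the vector \<open>a\<close> at its true size. The inequalities
are homogeneous in \<open>a\<close>, so that \<open>a = 0\<close> is never bad and all other vectors reduce to unit vectors.\<close>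

definition bad_block :: "nat \<Rightarrow> (nat \<Rightarrow> real) \<Rightarrow> 'w set" where
  "bad_block l a = {\<omega> \<in> space M. \<not> (mean_abs_const K / 4 * m * L2_set a {..<d} \<le> (\<Sum>i<m. \<bar>row_form l a i \<omega>\<bar>)
     \<and> (\<Sum>i<m. \<bar>row_form l a i \<omega>\<bar>) \<le> 8 * K * m * L2_set a {..<d})}"

lemma bad_block_sets [measurable]: "l < L \<Longrightarrow> bad_block l a \<in> sets M"
proof -
  assume l: "l < L"
  have [measurable]: "(\<lambda>\<omega>. \<Sum>i<m. \<bar>row_form l a i \<omega>\<bar>) \<in> borel_measurable M"
    by (intro borel_measurable_sum borel_measurable_abs row_form_measurable l) auto
  show ?thesis unfolding bad_block_def by measurable
qed

lemma bad_block_prob: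
  assumes l: "l < L" shows "prob (bad_block l a) \<le> 2 * exp (- tail_rate K * m)"
proof (cases "L2_set a {..<d} = 0")
  case True
  then have "a j = 0" if "j < d" for j using that by (auto simp: L2_set_eq_0_iff)
  then have "row_form l a i \<omega> = 0" for i \<omega> by (simp add: row_form_def)
  then have "bad_block l a = {}" using True by (simp add: bad_block_def)
  then show ?thesis by simp
next
  case False
  define r where "r = L2_set a {..<d}"
  have r: "r > 0" using False L2_set_nonneg[of a "{..<d}"] unfolding r_def by linarith
  define b where "b j = a j / r" for j
  have "r\<^sup>2 = (\<Sum>j<d. (a j)\<^sup>2)" unfolding r_def L2_set_def by (simp add: sum_nonneg)
  then have b: "(\<Sum>j<d. (b j)\<^sup>2) = 1"
    using r by (simp add: b_def power_divide sum_divide_distrib[symmetric] del: sum_divide_distrib) (metis less_irrefl zero_eq_power2)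
  have "row_form l a i \<omega> = r * row_form l b i \<omega>" for i \<omega>
    using r by (simp add: row_form_def b_def sum_distrib_left)
  then have S: "(\<Sum>i<m. \<bar>row_form l a i \<omega>\<bar>) = r * (\<Sum>i<m. \<bar>row_form l b i \<omega>\<bar>)" for \<omega>
    using r by (simp add: abs_mult sum_distrib_left)
  let ?U = "{\<omega> \<in> space M. (\<Sum>i<m. \<bar>row_form l b i \<omega>\<bar>) \<ge> 8 * K * m}"
  let ?D = "{\<omega> \<in> space M. (\<Sum>i<m. \<bar>row_form l b i \<omega>\<bar>) \<le> mean_abs_const K / 4 * m}"
  have [measurable]: "(\<lambda>\<omega>. \<Sum>i<m. \<bar>row_form l b i \<omega>\<bar>) \<in> borel_measurable M"
    by (intro borel_measurable_sum borel_measurable_abs row_form_measurable l) auto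
  have "bad_block l a \<subseteq> ?U \<union> ?D"
  proof
    fix \<omega> assume "\<omega> \<in> bad_block l a"
    then have "\<omega> \<in> space M" and "\<not> (r * (mean_abs_const K / 4 * m) \<le> r * (\<Sum>i<m. \<bar>row_form l b i \<omega>\<bar>)
        \<and> r * (\<Sum>i<m. \<bar>row_form l b i \<omega>\<bar>) \<le> r * (8 * K * m))"
      by (auto simp: bad_block_def S r_def[symmetric] mult_ac)
    then show "\<omega> \<in> ?U \<union> ?D" using r by auto
  qed
  then have "prob (bad_block l a) \<le> prob (?U \<union> ?D)" by (intro finite_measure_mono) auto
  also have "\<dots> \<le> prob ?U + prob ?D" by (intro measure_Un_le) auto
  also have "\<dots> \<le> exp (- real m) + exp (- ((mean_abs_const K)\<^sup>2 / 4) * m)"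
    by (intro add_mono block_tails_unit l b)
  also have "\<dots> \<le> exp (- tail_rate K * m) + exp (- tail_rate K * m)"
  proof -
    have "tail_rate K * m \<le> 1 * real m" "tail_rate K * m \<le> (mean_abs_const K)\<^sup>2 / 4 * real m"
      by (intro mult_right_mono; simp add: tail_rate_def)+
    then show ?thesis by (intro add_mono) auto
  qed
  finally show ?thesis by simp
qed

end

text \<open>The entry of \<open>\<Phi>u\<close> in row \<open>i\<close> of block \<open>l\<close>. Vectors are treated as functions on \<open>nat\<close> because then
changing or restricting coordinates needs no bookkeeping of dimensions.\<close>

definition measurement :: "nat \<Rightarrow> (nat \<times> nat \<times> nat \<Rightarrow> real) \<Rightarrow> nat \<Rightarrow> nat \<Rightarrow> (nat \<Rightarrow> complex) \<Rightarrow> complex" where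
  "measurement d \<phi> l i u = (\<Sum>j<d. complex_of_real (\<phi> (l, i, j)) * u (l * d + j))"

definition block_norm :: "nat \<Rightarrow> nat \<Rightarrow> (nat \<Rightarrow> complex) \<Rightarrow> real" where
  "block_norm d l u = L2_set (\<lambda>j. cmod (u (l * d + j))) {..<d}"

text \<open>The mixed norm of the measurements: \<open>\<ell>\<^sub>1\<close> inside a block tames the subexponential tails, \<open>\<ell>\<^sub>2\<close> over
the blocks avoids any loss in the number of blocks.\<close>

definition measurement_norm :: "nat \<Rightarrow> nat \<Rightarrow> nat \<Rightarrow> (nat \<times> nat \<times> nat \<Rightarrow> real) \<Rightarrow> (nat \<Rightarrow> complex) \<Rightarrow> real" where
  "measurement_norm m d L \<phi> u = L2_set (\<lambda>l. \<Sum>i<m. cmod (measurement d \<phi> l i u)) {..<L}"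

lemma L2_set_cmod_bounds:
  "L2_set (\<lambda>j. Re (f j)) A \<le> L2_set (\<lambda>j. cmod (f j)) A"
  "L2_set (\<lambda>j. Im (f j)) A \<le> L2_set (\<lambda>j. cmod (f j)) A"
  "L2_set (\<lambda>j. cmod (f j)) A \<le> L2_set (\<lambda>j. Re (f j)) A + L2_set (\<lambda>j. Im (f j)) A"
proof -
  have *: "L2_set (\<lambda>j. \<bar>g j\<bar>) A = L2_set g A" for g :: "'a \<Rightarrow> real" by (simp add: L2_set_def)
  show "L2_set (\<lambda>j. Re (f j)) A \<le> L2_set (\<lambda>j. cmod (f j)) A"
    unfolding *[of "\<lambda>j. Re (f j)", symmetric] by (intro L2_set_mono abs_Re_le_cmod) auto
  show "L2_set (\<lambda>j. Im (f j)) A \<le> L2_set (\<lambda>j. cmod (f j)) A"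
    unfolding *[of "\<lambda>j. Im (f j)", symmetric] by (intro L2_set_mono abs_Im_le_cmod) auto
  have "L2_set (\<lambda>j. cmod (f j)) A \<le> L2_set (\<lambda>j. \<bar>Re (f j)\<bar> + \<bar>Im (f j)\<bar>) A"
    by (intro L2_set_mono cmod_le) auto
  also have "\<dots> \<le> L2_set (\<lambda>j. \<bar>Re (f j)\<bar>) A + L2_set (\<lambda>j. \<bar>Im (f j)\<bar>) A"
    by (rule L2_set_triangle_ineq)
  finally show "L2_set (\<lambda>j. cmod (f j)) A \<le> L2_set (\<lambda>j. Re (f j)) A + L2_set (\<lambda>j. Im (f j)) A"
    unfolding * .
qed

lemma sum_blocks:
  fixes f :: "nat \<Rightarrow> 'b :: comm_monoid_add"
  shows "(\<Sum>l<L. \<Sum>j<d. f (l * d + j)) = (\<Sum>j<d * L. f j)"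
proof (induction L)
  case (Suc L)
  have "(\<Sum>j<d * Suc L. f j) = (\<Sum>j<L * d + d. f j)" by (simp add: mult.commute add.commute)
  also have "\<dots> = (\<Sum>j<L * d. f j) + (\<Sum>j=L*d..<L*d+d. f j)"
    by (metis sum.atLeastLessThan_concat le0 le_add1 lessThan_atLeast0)
  also have "(\<Sum>j=L*d..<L*d+d. f j) = (\<Sum>j<d. f (L * d + j))"
    using sum.shift_bounds_nat_ivl[of f 0 "L * d" d] by (simp add: lessThan_atLeast0 add.commute)
  finally show ?case using Suc by (simp add: mult.commute)
qed simp

lemma L2_set_blocks: "L2_set (\<lambda>l. block_norm d l u) {..<L} = L2_set (\<lambda>j. cmod (u j)) {..<d * L}"
  using sum_blocks[of "\<lambda>j. (cmod (u j))\<^sup>2"]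
  by (simp add: L2_set_def block_norm_def sum_nonneg)

context subexponential_blocks begin

text \<open>The matrix entries are real, so the real and imaginary parts of a complex vector are measured
separately. This costs a factor of \<open>2\<close> in either direction.\<close>

definition bad_vector :: "(nat \<Rightarrow> complex) \<Rightarrow> 'w set" where
  "bad_vector u = (\<Union>l<L. bad_block l (\<lambda>j. Re (u (l * d + j))) \<union> bad_block l (\<lambda>j. Im (u (l * d + j))))"

lemma bad_vector_sets: "bad_vector u \<in> sets M"
  unfolding bad_vector_def by (intro sets.finite_UN sets.Un bad_block_sets) auto

lemma bad_vector_prob: "prob (bad_vector u) \<le> 4 * L * exp (- tail_rate K * m)"
proof -
  have "prob (bad_vector u) \<le> (\<Sum>l<L. prob (bad_block l (\<lambda>j. Re (u (l * d + j))) \<union> bad_block l (\<lambda>j. Im (u (l * d + j)))))"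
    unfolding bad_vector_def by (intro finite_measure_subadditive_finite) auto
  also have "\<dots> \<le> (\<Sum>l<L. 2 * exp (- tail_rate K * m) + 2 * exp (- tail_rate K * m))"
    by (intro sum_mono order_trans[OF measure_Un_le] add_mono bad_block_prob bad_block_sets) auto
  finally show ?thesis by simp
qed

lemma good_block:
  assumes l: "l < L" and \<omega>: "\<omega> \<in> space M" "\<omega> \<notin> bad_vector u"
  shows "mean_abs_const K / 8 * m * block_norm d l u \<le> (\<Sum>i<m. cmod (measurement d (\<lambda>k. X k \<omega>) l i u))"
    and "(\<Sum>i<m. cmod (measurement d (\<lambda>k. X k \<omega>) l i u)) \<le> 16 * K * m * block_norm d l u"
proof -
  let ?a = "\<lambda>j. Re (u (l * d + j))" and ?b = "\<lambda>j. Im (u (l * d + j))"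
  let ?y = "\<lambda>i. measurement d (\<lambda>k. X k \<omega>) l i u"
  let ?A = "L2_set ?a {..<d}" and ?B = "L2_set ?b {..<d}"
  have re: "Re (?y i) = row_form l ?a i \<omega>" and im: "Im (?y i) = row_form l ?b i \<omega>" for i
    by (simp_all add: measurement_def row_form_def mult.commute)
  have a: "mean_abs_const K / 4 * m * ?A \<le> (\<Sum>i<m. \<bar>Re (?y i)\<bar>)" "(\<Sum>i<m. \<bar>Re (?y i)\<bar>) \<le> 8 * K * m * ?A"
    and b: "mean_abs_const K / 4 * m * ?B \<le> (\<Sum>i<m. \<bar>Im (?y i)\<bar>)" "(\<Sum>i<m. \<bar>Im (?y i)\<bar>) \<le> 8 * K * m * ?B"
    using \<omega> l unfolding bad_vector_def bad_block_def re im by auto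
  have N: "?A \<le> block_norm d l u" "?B \<le> block_norm d l u" "block_norm d l u \<le> ?A + ?B"
    unfolding block_norm_def by (rule L2_set_cmod_bounds)+
  have "mean_abs_const K / 4 * m * block_norm d l u \<le> mean_abs_const K / 4 * m * (?A + ?B)"
    using N(3) mean_abs_const_pos by (intro mult_left_mono) auto
  also have "\<dots> \<le> (\<Sum>i<m. \<bar>Re (?y i)\<bar>) + (\<Sum>i<m. \<bar>Im (?y i)\<bar>)"
    using a(1) b(1) by (simp add: distrib_left)
  also have "\<dots> \<le> (\<Sum>i<m. cmod (?y i)) + (\<Sum>i<m. cmod (?y i))"
    by (intro add_mono sum_mono abs_Re_le_cmod abs_Im_le_cmod)
  finally show "mean_abs_const K / 8 * m * block_norm d l u \<le> (\<Sum>i<m. cmod (?y i))" by simp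
  have "(\<Sum>i<m. cmod (?y i)) \<le> (\<Sum>i<m. \<bar>Re (?y i)\<bar>) + (\<Sum>i<m. \<bar>Im (?y i)\<bar>)"
    unfolding sum.distrib[symmetric] by (intro sum_mono cmod_le)
  also have "\<dots> \<le> 8 * K * m * ?A + 8 * K * m * ?B" using a b by simp
  also have "\<dots> \<le> 8 * K * m * block_norm d l u + 8 * K * m * block_norm d l u"
    using N K_pos by (intro add_mono mult_left_mono) auto
  finally show "(\<Sum>i<m. cmod (?y i)) \<le> 16 * K * m * block_norm d l u" by simp
qed

lemma good_vector:
  assumes \<omega>: "\<omega> \<in> space M" "\<omega> \<notin> bad_vector u"
  shows "mean_abs_const K / 8 * m * L2_set (\<lambda>j. cmod (u j)) {..<d * L} \<le> measurement_norm m d L (\<lambda>k. X k \<omega>) u"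
    and "measurement_norm m d L (\<lambda>k. X k \<omega>) u \<le> 16 * K * m * L2_set (\<lambda>j. cmod (u j)) {..<d * L}"
proof -
  have "mean_abs_const K / 8 * m * L2_set (\<lambda>j. cmod (u j)) {..<d * L} = L2_set (\<lambda>l. mean_abs_const K / 8 * m * block_norm d l u) {..<L}"
    unfolding L2_set_blocks[symmetric] using mean_abs_const_pos by (intro L2_set_right_distrib) auto
  also have "\<dots> \<le> measurement_norm m d L (\<lambda>k. X k \<omega>) u"
    unfolding measurement_norm_def using mean_abs_const_pos
    by (intro L2_set_mono good_block \<omega>) (auto intro!: mult_nonneg_nonneg simp: block_norm_def)
  finally show "mean_abs_const K / 8 * m * L2_set (\<lambda>j. cmod (u j)) {..<d * L} \<le> measurement_norm m d L (\<lambda>k. X k \<omega>) u" .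
  have "measurement_norm m d L (\<lambda>k. X k \<omega>) u \<le> L2_set (\<lambda>l. 16 * K * m * block_norm d l u) {..<L}"
    unfolding measurement_norm_def by (intro L2_set_mono good_block \<omega>) (auto intro!: sum_nonneg)
  also have "\<dots> = 16 * K * m * L2_set (\<lambda>j. cmod (u j)) {..<d * L}"
    unfolding L2_set_blocks[symmetric] using K_pos by (intro L2_set_right_distrib[symmetric]) auto
  finally show "measurement_norm m d L (\<lambda>k. X k \<omega>) u \<le> 16 * K * m * L2_set (\<lambda>j. cmod (u j)) {..<d * L}" .
qed

end

section \<open>Euclidean norms on coordinate sets\<close>

definition l2_on :: "'a set \<Rightarrow> ('a \<Rightarrow> complex) \<Rightarrow> real" where
  "l2_on J f = L2_set (\<lambda>j. cmod (f j)) J"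

lemma l2_on_nonneg [simp]: "0 \<le> l2_on J f"
  by (simp add: l2_on_def)

lemma l2_on_triangle: "l2_on J (\<lambda>j. f j + g j) \<le> l2_on J f + l2_on J g"
proof -
  have "l2_on J (\<lambda>j. f j + g j) \<le> L2_set (\<lambda>j. cmod (f j) + cmod (g j)) J"
    unfolding l2_on_def by (intro L2_set_mono norm_triangle_ineq) auto
  also have "\<dots> \<le> l2_on J f + l2_on J g" unfolding l2_on_def by (rule L2_set_triangle_ineq)
  finally show ?thesis .
qed

lemma l2_on_scale: "l2_on J (\<lambda>j. complex_of_real c * f j) = \<bar>c\<bar> * l2_on J f"
  unfolding l2_on_def by (subst L2_set_right_distrib) (auto simp: norm_mult)

lemma l2_on_square: "(l2_on J f)\<^sup>2 = (\<Sum>j\<in>J. (cmod (f j))\<^sup>2)"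
  by (simp add: l2_on_def L2_set_def sum_nonneg)

lemma l2_on_cong: "(\<And>j. j \<in> J \<Longrightarrow> f j = g j) \<Longrightarrow> l2_on J f = l2_on J g"
  unfolding l2_on_def by (intro L2_set_cong) auto

lemma l2_on_supp: "finite J \<Longrightarrow> J' \<subseteq> J \<Longrightarrow> (\<And>j. j \<in> J \<Longrightarrow> j \<notin> J' \<Longrightarrow> f j = 0) \<Longrightarrow> l2_on J f = l2_on J' f"
  unfolding l2_on_def L2_set_def by (intro arg_cong[where f=sqrt] sum.mono_neutral_right) auto

lemma l2_on_eq_0: "finite J \<Longrightarrow> l2_on J f = 0 \<longleftrightarrow> (\<forall>j\<in>J. f j = 0)"
  by (simp add: l2_on_def L2_set_eq_0_iff)

lemma cmod_le_l2_on: "finite J \<Longrightarrow> j \<in> J \<Longrightarrow> cmod (f j) \<le> l2_on J f"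
  unfolding l2_on_def by (rule member_le_L2_set)

lemma sum_le_sqrt_card_L2: "(\<Sum>i\<in>I. f i) \<le> sqrt (card I) * L2_set f I" for f :: "'a \<Rightarrow> real"
proof (cases "finite I")
  case True
  have "(\<Sum>i\<in>I. \<bar>1\<bar> * \<bar>f i\<bar>) \<le> L2_set (\<lambda>_. 1) I * L2_set f I" by (rule L2_set_mult_ineq)
  moreover have "(\<Sum>i\<in>I. f i) \<le> (\<Sum>i\<in>I. \<bar>1\<bar> * \<bar>f i\<bar>)" by (intro sum_mono) auto
  moreover have "L2_set (\<lambda>_. 1) I = sqrt (card I)" by (simp add: L2_set_def)
  ultimately show ?thesis by simp
qed simp

section \<open>Seminorms controlled by a lattice net\<close>

text \<open>Real homogeneity and invariance under multiplication by \<open>\<i>\<close> bound the effect of a complex scalar up to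
a factor \<open>2\<close>.\<close>

locale vector_seminorm =
  fixes F :: "('a \<Rightarrow> complex) \<Rightarrow> real"
  assumes triangle: "F (\<lambda>j. f j + g j) \<le> F f + F g"
    and scale: "F (\<lambda>j. complex_of_real c * f j) = \<bar>c\<bar> * F f"
    and rotate: "F (\<lambda>j. \<i> * f j) = F f"
begin

lemma zero: "F (\<lambda>_. 0) = 0"
  using scale[of 0 "\<lambda>_. 0"] by simp

lemma uminus: "F (\<lambda>j. - f j) = F f"
  using scale[of "-1" f] by simp

lemma nonneg: "0 \<le> F f"
  using triangle[of f "\<lambda>j. - f j"] by (simp add: uminus zero)

lemma reverse_triangle: "F f - F (\<lambda>j. f j - g j) \<le> F g"
  using triangle[of "\<lambda>j. f j - g j" g] by simp

lemma complex_scale_le: "F (\<lambda>j. z * f j) \<le> 2 * cmod z * F f"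
proof -
  have eq: "(\<lambda>j. z * f j) = (\<lambda>j. complex_of_real (Re z) * f j + complex_of_real (Im z) * (\<i> * f j))"
    by (rule ext) (simp add: complex_eq_iff algebra_simps)
  have "F (\<lambda>j. z * f j) \<le> F (\<lambda>j. complex_of_real (Re z) * f j) + F (\<lambda>j. complex_of_real (Im z) * (\<i> * f j))"
    unfolding eq by (rule triangle)
  also have "\<dots> = (\<bar>Re z\<bar> + \<bar>Im z\<bar>) * F f"
    unfolding scale scale[of _ "\<lambda>j. \<i> * f j"] rotate by (simp add: distrib_right)
  also have "\<dots> \<le> (cmod z + cmod z) * F f"
    by (intro mult_right_mono add_mono abs_Re_le_cmod abs_Im_le_cmod nonneg)
  finally show ?thesis by simp
qed

text \<open>This finiteness starts the net argument, which bounds the supremum of \<open>F\<close> over the unit ball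
in terms of itself and would be vacuous for an infinite supremum.\<close>

lemma bounded_on_support:
  assumes "finite J"
  shows "\<exists>B\<ge>0. \<forall>f. (\<forall>j. j \<notin> J \<longrightarrow> f j = 0) \<longrightarrow> F f \<le> B * l2_on J f"
proof -
  let ?e = "\<lambda>k j. if j = k then 1 else (0::complex)"
  define B where "B = (\<Sum>k\<in>J. 2 * F (?e k))"
  have "F f \<le> (\<Sum>k\<in>S. 2 * cmod (f k) * F (?e k))" if "finite S" "\<forall>j. j \<notin> S \<longrightarrow> f j = 0" for f S
    using that
  proof (induction S arbitrary: f)
    case empty
    then have "f = (\<lambda>_. 0)" by auto
    then show ?case by (simp add: zero)
  next
    case (insert k S)
    let ?g = "\<lambda>j. if j = k then 0 else f j"
    have "f = (\<lambda>j. f k * ?e k j + ?g j)" by auto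
    then have "F f \<le> F (\<lambda>j. f k * ?e k j) + F ?g" using triangle[of "\<lambda>j. f k * ?e k j" ?g] by simp
    also have "\<dots> \<le> 2 * cmod (f k) * F (?e k) + (\<Sum>k\<in>S. 2 * cmod (?g k) * F (?e k))"
      using insert by (intro add_mono complex_scale_le insert.IH) auto
    also have "(\<Sum>k\<in>S. 2 * cmod (?g k) * F (?e k)) = (\<Sum>k\<in>S. 2 * cmod (f k) * F (?e k))"
      using insert by (intro sum.cong) auto
    finally show ?case using insert by simp
  qed
  then have "F f \<le> (\<Sum>k\<in>J. 2 * cmod (f k) * F (?e k))" if "\<forall>j. j \<notin> J \<longrightarrow> f j = 0" for f
    using that assms by blast
  moreover have "(\<Sum>k\<in>J. 2 * cmod (f k) * F (?e k)) \<le> B * l2_on J f" for f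
    unfolding B_def sum_distrib_right
  proof (rule sum_mono)
    fix k assume "k \<in> J"
    then have "cmod (f k) * (2 * F (?e k)) \<le> l2_on J f * (2 * F (?e k))"
      by (intro mult_right_mono cmod_le_l2_on assms) (simp_all add: nonneg)
    then show "2 * cmod (f k) * F (?e k) \<le> 2 * F (?e k) * l2_on J f" by (simp add: mult_ac)
  qed
  moreover have "B \<ge> 0" unfolding B_def by (intro sum_nonneg mult_nonneg_nonneg nonneg) auto
  ultimately show ?thesis by (intro exI[of _ B]) (meson order_trans)
qed

end

text \<open>Scaling the vectors up instead of scaling a net down lets the net consist of integer points, for
which counting is a matter of generating functions.\<close>

definition gauss_lattice :: "'a set \<Rightarrow> real \<Rightarrow> ('a \<Rightarrow> complex) set" where
  "gauss_lattice J r = {z. (\<forall>j. j \<notin> J \<longrightarrow> z j = 0) \<and> (\<forall>j. Re (z j) \<in> \<int> \<and> Im (z j) \<in> \<int>)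
     \<and> (\<Sum>j\<in>J. \<bar>Re (z j)\<bar> + \<bar>Im (z j)\<bar>) \<le> r}"

lemma sum_exp_neg_abs_int: "(\<Sum>p\<in>{- int b..int b}. exp (- \<bar>real_of_int p\<bar>)) \<le> 3"
proof -
  have half: "exp (- real k) \<le> (1/2) ^ k" for k
  proof -
    have "exp (-1 :: real) \<le> 1/2"
      using exp_ge_add_one_self[of 1] by (simp add: exp_minus field_simps)
    then have "exp (-1 :: real) ^ k \<le> (1/2) ^ k" by (intro power_mono) auto
    then show ?thesis by (simp add: exp_of_nat_mult[symmetric])
  qed
  have "(\<Sum>p\<in>{- int b..int b}. exp (- \<bar>real_of_int p\<bar>)) \<le> 3 - 2 * (1/2) ^ b"
  proof (induction b)
    case (Suc b)
    have "{- int (Suc b)..int (Suc b)} = insert (- int (Suc b)) (insert (int (Suc b)) {- int b..int b})"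
      by auto
    then have "(\<Sum>p\<in>{- int (Suc b)..int (Suc b)}. exp (- \<bar>real_of_int p\<bar>))
       = 2 * exp (- real (Suc b)) + (\<Sum>p\<in>{- int b..int b}. exp (- \<bar>real_of_int p\<bar>))"
      by simp
    then show ?case using Suc half[of "Suc b"] by simp
  qed simp
  moreover have "(0::real) \<le> (1/2) ^ b" by simp
  ultimately show ?thesis by linarith
qed

text \<open>Each lattice point is given the weight \<open>exp (-x)\<close> with \<open>x\<close> its \<open>\<ell>\<^sub>1\<close>-norm. The total weight factors
over the coordinates, with each real coordinate contributing at most \<open>3\<close>, while a point of norm at
most \<open>r\<close> has weight at least \<open>exp (-r)\<close>.\<close>

lemma gauss_lattice_count:
  fixes r :: real
  assumes J: "finite J"
  shows "finite (gauss_lattice J r)" and "card (gauss_lattice J r) \<le> exp (r + 3 * card J)"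
proof -
  define b where "b = nat \<lceil>r\<rceil>"
  define W where "W = (\<lambda>(p, q). Complex (real_of_int p) (real_of_int q)) ` ({- int b..int b} \<times> {- int b..int b})"
  define w where "w z = exp (- (\<bar>Re z\<bar> + \<bar>Im z\<bar>))" for z
  have W: "finite W" unfolding W_def by auto
  have "(\<Sum>z\<in>W. w z) = (\<Sum>(p,q)\<in>{- int b..int b} \<times> {- int b..int b}. exp (- \<bar>real_of_int p\<bar>) * exp (- \<bar>real_of_int q\<bar>))"
    unfolding W_def by (subst sum.reindex) (auto simp: inj_on_def w_def mult_exp_exp intro!: sum.cong)
  also have "\<dots> = (\<Sum>p\<in>{- int b..int b}. exp (- \<bar>real_of_int p\<bar>)) * (\<Sum>p\<in>{- int b..int b}. exp (- \<bar>real_of_int p\<bar>))"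
    by (simp add: sum_product sum.cartesian_product)
  also have "\<dots> \<le> 3 * 3" by (intro mult_mono sum_exp_neg_abs_int) (auto intro: sum_nonneg)
  also have "\<dots> \<le> exp (3::real)"
  proof -
    have "(2.5::real) ^ 3 \<le> exp 1 ^ 3" using exp_lower_Taylor_quadratic[of 1] by (intro power_mono) (auto simp: power2_eq_square)
    moreover have "exp 1 ^ 3 = exp (3::real)" by (simp add: exp_of_nat_mult[symmetric])
    ultimately show ?thesis by (simp add: power3_eq_cube)
  qed
  finally have sumW: "(\<Sum>z\<in>W. w z) \<le> exp 3" .
  \<comment> \<open>Restriction makes lattice points extensional functions, over which the product of sums expands.\<close>
  let ?r = "\<lambda>z. restrict z J"
  have inj: "inj_on ?r (gauss_lattice J r)"
  proof (rule inj_onI)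
    fix z z' assume *: "z \<in> gauss_lattice J r" "z' \<in> gauss_lattice J r" "?r z = ?r z'"
    show "z = z'"
    proof
      fix j show "z j = z' j"
        using * by (cases "j \<in> J") (auto simp: gauss_lattice_def dest: fun_cong[of _ _ j])
    qed
  qed
  have sub: "?r ` gauss_lattice J r \<subseteq> PiE J (\<lambda>_. W)"
  proof (rule image_subsetI)
    fix z assume z: "z \<in> gauss_lattice J r"
    show "?r z \<in> PiE J (\<lambda>_. W)"
    proof (intro restrict_PiE_iff[THEN iffD2] ballI)
      fix j assume j: "j \<in> J"
      obtain p q where pq: "Re (z j) = real_of_int p" "Im (z j) = real_of_int q"
        using z unfolding gauss_lattice_def by (auto elim!: Ints_cases dest!: spec[of _ j])
      have "\<bar>Re (z j)\<bar> + \<bar>Im (z j)\<bar> \<le> (\<Sum>j\<in>J. \<bar>Re (z j)\<bar> + \<bar>Im (z j)\<bar>)"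
        by (rule member_le_sum[OF j]) (use J in auto)
      also have "\<dots> \<le> r" using z by (simp add: gauss_lattice_def)
      finally have "\<bar>p\<bar> \<le> int b" "\<bar>q\<bar> \<le> int b" unfolding b_def pq by linarith+
      then show "z j \<in> W" unfolding W_def using pq
        by (intro image_eqI[of _ _ "(p, q)"]) (auto simp: complex_eq_iff)
    qed
  qed
  have finP: "finite (PiE J (\<lambda>_. W))" using J W by (intro finite_PiE) auto
  then show fin: "finite (gauss_lattice J r)" using inj sub finite_imageD finite_subset by blast
  have "real (card (gauss_lattice J r)) * exp (- r) = (\<Sum>z\<in>gauss_lattice J r. exp (- r))" by simp
  also have "\<dots> \<le> (\<Sum>z\<in>gauss_lattice J r. \<Prod>j\<in>J. w (?r z j))"
  proof (rule sum_mono)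
    fix z assume "z \<in> gauss_lattice J r"
    then have "exp (- r) \<le> exp (- (\<Sum>j\<in>J. \<bar>Re (z j)\<bar> + \<bar>Im (z j)\<bar>))"
      by (simp add: gauss_lattice_def)
    also have "\<dots> = (\<Prod>j\<in>J. w (?r z j))"
      unfolding sum_negf[symmetric] exp_sum[OF J] by (simp add: w_def)
    finally show "exp (- r) \<le> (\<Prod>j\<in>J. w (?r z j))" .
  qed
  also have "\<dots> = (\<Sum>z\<in>?r ` gauss_lattice J r. \<Prod>j\<in>J. w (z j))"
    by (simp add: sum.reindex[OF inj])
  also have "\<dots> \<le> (\<Sum>z\<in>PiE J (\<lambda>_. W). \<Prod>j\<in>J. w (z j))"
    by (intro sum_mono2 finP sub) (auto simp: w_def intro!: prod_nonneg)
  also have "\<dots> = (\<Prod>j\<in>J. \<Sum>z\<in>W. w z)"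
    using prod_sum_PiE[OF J, of "\<lambda>_. W" "\<lambda>_. w"] W by simp
  also have "\<dots> \<le> (\<Prod>j\<in>J. exp 3)"
    by (intro prod_mono conjI sumW sum_nonneg) (auto simp: w_def)
  also have "\<dots> = exp (3 * card J)" by (simp add: exp_of_nat_mult[symmetric] mult.commute)
  finally show "card (gauss_lattice J r) \<le> exp (r + 3 * card J)"
    by (simp add: exp_minus exp_add field_simps)
qed

lemma round_toward_zero:
  fixes x :: real
  shows "\<exists>p::int. \<bar>real_of_int p\<bar> \<le> \<bar>x\<bar> \<and> \<bar>x - real_of_int p\<bar> \<le> 1"
proof (cases "x \<ge> 0")
  case True
  then have "0 \<le> \<lfloor>x\<rfloor>" by simp
  with True show ?thesis by (intro exI[of _ "\<lfloor>x\<rfloor>"]) linarith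
next
  case False
  then have "\<lceil>x\<rceil> \<le> 0" by simp
  with False show ?thesis by (intro exI[of _ "\<lceil>x\<rceil>"]) linarith
qed

text \<open>Rounding real and imaginary parts toward zero never increases the \<open>\<ell>\<^sub>1\<close>-norm, which for \<open>2 |J|\<close> real
coordinates is at most \<open>sqrt (2 |J|)\<close> times the Euclidean norm, and it moves each real coordinate by
at most \<open>1\<close>.\<close>

lemma round_to_gauss_lattice:
  assumes J: "finite J" and w: "\<And>j. j \<notin> J \<Longrightarrow> w j = 0" and n: "l2_on J w \<le> sqrt (2 * card J) / \<delta>" and \<delta>: "\<delta> > 0"
  shows "\<exists>z\<in>gauss_lattice J (2 * card J / \<delta>). l2_on J (\<lambda>j. w j - z j) \<le> sqrt (2 * card J)"
proof -
  have "\<exists>p q :: int. \<bar>real_of_int p\<bar> \<le> \<bar>Re (w j)\<bar> \<and> \<bar>Re (w j) - real_of_int p\<bar> \<le> 1 \<and>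
      \<bar>real_of_int q\<bar> \<le> \<bar>Im (w j)\<bar> \<and> \<bar>Im (w j) - real_of_int q\<bar> \<le> 1" for j
    using round_toward_zero by meson
  then obtain p q :: "'a \<Rightarrow> int" where pq: "\<And>j. \<bar>real_of_int (p j)\<bar> \<le> \<bar>Re (w j)\<bar>" "\<And>j. \<bar>Re (w j) - real_of_int (p j)\<bar> \<le> 1"
      "\<And>j. \<bar>real_of_int (q j)\<bar> \<le> \<bar>Im (w j)\<bar>" "\<And>j. \<bar>Im (w j) - real_of_int (q j)\<bar> \<le> 1"
    by metis
  define z where "z j = Complex (p j) (q j)" for j
  have "(\<Sum>j\<in>J. \<bar>Re (z j)\<bar> + \<bar>Im (z j)\<bar>) \<le> (\<Sum>j\<in>J. sqrt 2 * cmod (w j))"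
  proof (rule sum_mono)
    fix j
    have "\<bar>Re (z j)\<bar> + \<bar>Im (z j)\<bar> \<le> \<bar>Re (w j)\<bar> + \<bar>Im (w j)\<bar>" using pq by (simp add: z_def add_mono)
    also have "\<dots> \<le> sqrt 2 * cmod (w j)" by (rule complex_abs_le_norm)
    finally show "\<bar>Re (z j)\<bar> + \<bar>Im (z j)\<bar> \<le> sqrt 2 * cmod (w j)" .
  qed
  also have "\<dots> \<le> sqrt 2 * (sqrt (card J) * l2_on J w)"
    unfolding sum_distrib_left[symmetric] l2_on_def by (intro mult_left_mono sum_le_sqrt_card_L2) auto
  also have "\<dots> \<le> sqrt 2 * (sqrt (card J) * (sqrt (2 * card J) / \<delta>))"
    by (intro mult_left_mono n) auto
  also have "\<dots> = (sqrt 2 * sqrt 2) * (sqrt (card J) * sqrt (card J)) / \<delta>"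
    unfolding real_sqrt_mult of_nat_mult by (simp add: mult_ac)
  also have "\<dots> = 2 * card J / \<delta>" by simp
  finally have "(\<Sum>j\<in>J. \<bar>Re (z j)\<bar> + \<bar>Im (z j)\<bar>) \<le> 2 * card J / \<delta>" .
  moreover have "z j = 0" if "j \<notin> J" for j
    using pq(1)[of j] pq(3)[of j] w[OF that] by (simp add: z_def complex_eq_iff)
  ultimately have "z \<in> gauss_lattice J (2 * card J / \<delta>)" by (simp add: gauss_lattice_def) (simp add: z_def)
  moreover have "l2_on J (\<lambda>j. w j - z j) \<le> L2_set (\<lambda>j. sqrt 2) J"
    unfolding l2_on_def
  proof (intro L2_set_mono)
    fix j
    have "(Re (w j - z j))\<^sup>2 \<le> 1" "(Im (w j - z j))\<^sup>2 \<le> 1" using pq by (simp_all add: z_def abs_square_le_1)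
    then show "cmod (w j - z j) \<le> sqrt 2" unfolding cmod_def by (intro real_sqrt_le_mono) linarith
  qed auto
  moreover have "L2_set (\<lambda>j. sqrt 2) J = sqrt (2 * card J)" by (simp add: L2_set_def mult.commute)
  ultimately show ?thesis by auto
qed

context vector_seminorm begin

text \<open>Scaled to norm \<open>sqrt (2 |J|) / \<delta>\<close>, every vector is within relative distance \<open>\<delta>\<close> of a lattice point.
For the upper bound let \<open>A\<close> be the best constant; approximation gives \<open>A \<le> \<beta> (1 + \<delta>) + A \<delta>\<close>, hence
\<open>A \<le> 3 \<beta>\<close>. The lower bound follows by the reverse triangle inequality, the error \<open>3 \<beta> \<delta>\<close> being a small
fraction of \<open>\<alpha>\<close>.\<close>

lemma lattice_bounds_extend:
  assumes J: "finite J" and \<delta>: "0 < \<delta>" "\<delta> \<le> 1/2" "16 * \<beta> * \<delta> \<le> \<alpha>" and \<alpha>\<beta>: "0 \<le> \<beta>"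
    and low: "\<And>z. z \<in> gauss_lattice J (2 * card J / \<delta>) \<Longrightarrow> \<alpha> * l2_on J z \<le> F z"
    and up: "\<And>z. z \<in> gauss_lattice J (2 * card J / \<delta>) \<Longrightarrow> F z \<le> \<beta> * l2_on J z"
    and f: "\<And>j. j \<notin> J \<Longrightarrow> f j = 0"
  shows "\<alpha> / 4 * l2_on J f \<le> F f" and "F f \<le> 3 * \<beta> * l2_on J f"
proof -
  have \<alpha>: "0 \<le> \<alpha>" using mult_nonneg_nonneg[of "16 * \<beta>" \<delta>] \<delta> \<alpha>\<beta> by linarith
  define \<rho> where "\<rho> = sqrt (2 * card J) / \<delta>"
  have approx: "\<exists>z\<in>gauss_lattice J (2 * card J / \<delta>). l2_on J (\<lambda>j. w j - z j) \<le> \<delta> * \<rho> \<and>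
      (1 - \<delta>) * \<rho> \<le> l2_on J z \<and> l2_on J z \<le> (1 + \<delta>) * \<rho>"
    if w0: "\<And>j. j \<notin> J \<Longrightarrow> w j = 0" and w\<rho>: "l2_on J w = \<rho>" for w
  proof -
    obtain z where z: "z \<in> gauss_lattice J (2 * card J / \<delta>)" "l2_on J (\<lambda>j. w j - z j) \<le> sqrt (2 * card J)"
      using round_to_gauss_lattice[of J w \<delta>] J w0 w\<rho> \<delta> by (auto simp: \<rho>_def)
    have e: "l2_on J (\<lambda>j. w j - z j) \<le> \<delta> * \<rho>" using z(2) \<delta> by (simp add: \<rho>_def)
    have "l2_on J w \<le> l2_on J (\<lambda>j. w j - z j) + l2_on J z"
      using l2_on_triangle[of J "\<lambda>j. w j - z j" z] by simp
    moreover have "l2_on J z \<le> l2_on J (\<lambda>j. w j - z j) + l2_on J w"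
      using l2_on_triangle[of J "\<lambda>j. z j - w j" w] l2_on_scale[of J "-1" "\<lambda>j. w j - z j"] by simp
    ultimately show ?thesis using e w\<rho> z(1) by (intro bexI[of _ z]) (auto simp: algebra_simps)
  qed
  have normalize: "\<exists>c>0. l2_on J (\<lambda>j. complex_of_real c * f j) = \<rho>" if "l2_on J f > 0" for f
  proof -
    have "J \<noteq> {}" using that by (auto simp: l2_on_def)
    then have "\<rho> > 0" using J \<delta> by (simp add: \<rho>_def card_gt_0_iff)
    then have "\<rho> / l2_on J f > 0" "l2_on J (\<lambda>j. complex_of_real (\<rho> / l2_on J f) * f j) = \<rho>"
      unfolding l2_on_scale using that by simp_all
    then show ?thesis by blast
  qed
  define S where "S = {A. A \<ge> 0 \<and> (\<forall>f. (\<forall>j. j \<notin> J \<longrightarrow> f j = 0) \<longrightarrow> F f \<le> A * l2_on J f)}"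
  define A where "A = Inf S"
  have S: "S \<noteq> {}" "bdd_below S"
    using bounded_on_support[OF J] unfolding S_def by (blast, auto intro!: bdd_belowI[of _ 0])
  have A0: "A \<ge> 0" unfolding A_def by (rule cInf_greatest[OF S(1)]) (auto simp: S_def)
  have FA: "F f \<le> A * l2_on J f" if "\<And>j. j \<notin> J \<Longrightarrow> f j = 0" for f
  proof (cases "l2_on J f = 0")
    case True
    obtain B where "\<And>f. (\<forall>j. j \<notin> J \<longrightarrow> f j = 0) \<Longrightarrow> F f \<le> B * l2_on J f"
      using S(1) unfolding S_def by blast
    from this[of f] show ?thesis using that True by simp
  next
    case False
    then have p: "l2_on J f > 0" using l2_on_nonneg[of J f] by linarith
    have "F f / l2_on J f \<le> A" unfolding A_def
      by (rule cInf_greatest[OF S(1)]) (use that p in \<open>auto simp: S_def divide_le_eq\<close>)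
    then show ?thesis using p by (simp add: divide_le_eq)
  qed
  have "F f \<le> (\<beta> * (1 + \<delta>) + A * \<delta>) * l2_on J f" if f: "\<And>j. j \<notin> J \<Longrightarrow> f j = 0" for f
  proof (cases "l2_on J f = 0")
    case True
    then show ?thesis using FA[of f] f by simp
  next
    case False
    then have p: "l2_on J f > 0" using l2_on_nonneg[of J f] by linarith
    obtain c where c: "c > 0" "l2_on J (\<lambda>j. complex_of_real c * f j) = \<rho>" using normalize[OF p] by blast
    let ?w = "\<lambda>j. complex_of_real c * f j"
    obtain z where z: "z \<in> gauss_lattice J (2 * card J / \<delta>)" "l2_on J (\<lambda>j. ?w j - z j) \<le> \<delta> * \<rho>" "l2_on J z \<le> (1 + \<delta>) * \<rho>"
      using approx[of ?w] f c by auto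
    have z0: "z j = 0" if "j \<notin> J" for j using z that by (simp add: gauss_lattice_def)
    have "F ?w \<le> F (\<lambda>j. ?w j - z j) + F z" using triangle[of "\<lambda>j. ?w j - z j" z] by simp
    also have "\<dots> \<le> A * l2_on J (\<lambda>j. ?w j - z j) + \<beta> * l2_on J z"
      by (intro add_mono FA up z) (simp add: f z0)
    also have "\<dots> \<le> A * (\<delta> * \<rho>) + \<beta> * ((1 + \<delta>) * \<rho>)"
      using z A0 \<alpha>\<beta> by (intro add_mono mult_left_mono) auto
    finally have "c * F f \<le> c * ((\<beta> * (1 + \<delta>) + A * \<delta>) * l2_on J f)"
      using c unfolding scale l2_on_scale by (simp add: algebra_simps c(2)[unfolded l2_on_scale, symmetric])
    then show ?thesis using c by simp
  qed
  then have "\<beta> * (1 + \<delta>) + A * \<delta> \<in> S" using \<alpha>\<beta> \<delta> A0 by (auto simp: S_def)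
  then have "A \<le> \<beta> * (1 + \<delta>) + A * \<delta>" unfolding A_def using S(2) by (rule cInf_lower)
  moreover have "A * \<delta> \<le> A * (1/2)" "\<beta> * \<delta> \<le> \<beta> * (1/2)"
    using \<delta> A0 \<alpha>\<beta> by (intro mult_left_mono; simp)+
  ultimately have A: "A \<le> 3 * \<beta>" by (simp add: algebra_simps)
  show "F f \<le> 3 * \<beta> * l2_on J f"
    by (rule order_trans[OF FA mult_right_mono[OF A l2_on_nonneg]]) (rule f)
  show "\<alpha> / 4 * l2_on J f \<le> F f"
  proof (cases "l2_on J f = 0")
    case True
    then show ?thesis by (simp add: nonneg)
  next
    case False
    then have p: "l2_on J f > 0" using l2_on_nonneg[of J f] by linarith
    obtain c where c: "c > 0" "l2_on J (\<lambda>j. complex_of_real c * f j) = \<rho>" using normalize[OF p] by blast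
    have \<rho>: "\<rho> \<ge> 0" using c(2) l2_on_nonneg by metis
    let ?w = "\<lambda>j. complex_of_real c * f j"
    obtain z where z: "z \<in> gauss_lattice J (2 * card J / \<delta>)" "l2_on J (\<lambda>j. ?w j - z j) \<le> \<delta> * \<rho>" "(1 - \<delta>) * \<rho> \<le> l2_on J z"
      using approx[of ?w] f c by auto
    have z0: "z j = 0" if "j \<notin> J" for j using z that by (simp add: gauss_lattice_def)
    have "(\<lambda>j. z j - ?w j) = (\<lambda>j. - (?w j - z j))" by auto
    then have "F z - F (\<lambda>j. ?w j - z j) \<le> F ?w"
      using reverse_triangle[of z ?w] uminus[of "\<lambda>j. ?w j - z j"] by simp
    moreover have "\<alpha> * ((1 - \<delta>) * \<rho>) \<le> F z"
      using mult_left_mono[OF z(3) \<alpha>] low[OF z(1)] by linarith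
    moreover have "F (\<lambda>j. ?w j - z j) \<le> 3 * \<beta> * (\<delta> * \<rho>)"
    proof -
      have "F (\<lambda>j. ?w j - z j) \<le> A * l2_on J (\<lambda>j. ?w j - z j)" by (rule FA) (simp add: f z0)
      also have "\<dots> \<le> 3 * \<beta> * (\<delta> * \<rho>)" using A A0 \<alpha>\<beta> z(2) by (intro mult_mono) auto
      finally show ?thesis .
    qed
    moreover have "16 * \<beta> * \<delta> * \<rho> \<le> \<alpha> * \<rho>" using \<delta> \<rho> by (intro mult_right_mono) auto
    moreover have "\<alpha> * \<delta> * \<rho> \<le> \<alpha> * (1/2) * \<rho>" using \<delta> \<rho> \<alpha> by (intro mult_right_mono mult_left_mono) auto
    moreover have "\<alpha> * \<rho> \<ge> 0" using \<alpha> \<rho> by simp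
    ultimately have "\<alpha> / 4 * \<rho> \<le> F ?w"  by (simp add: algebra_simps)
    then have "c * (\<alpha> / 4 * l2_on J f) \<le> c * F f"
      using c unfolding scale by (simp add: c(2)[unfolded l2_on_scale, symmetric] algebra_simps)
    then show ?thesis using c by simp
  qed
qed

end

section \<open>From restricted isometry to the null space property\<close>

lemma top_subset:
  fixes a :: "'i \<Rightarrow> real"
  assumes "finite T" "k \<le> card T"
  shows "\<exists>S\<subseteq>T. card S = k \<and> (\<forall>i\<in>S. \<forall>j\<in>T - S. a j \<le> a i)"
  using assms(2)
proof (induction k)
  case 0
  show ?case by (intro exI[of _ "{}"]) auto
next
  case (Suc k)
  then obtain S where S: "S \<subseteq> T" "card S = k" "\<forall>i\<in>S. \<forall>j\<in>T - S. a j \<le> a i" by auto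
  have fS: "finite S" using S(1) assms(1) finite_subset by blast
  have "card (T - S) > 0" using S Suc.prems fS by (simp add: card_Diff_subset)
  then have ne: "T - S \<noteq> {}" by (metis card.empty less_irrefl)
  then have "Max (a ` (T - S)) \<in> a ` (T - S)" using assms(1) by (intro Max_in) auto
  then obtain i where i: "i \<in> T - S" "a i = Max (a ` (T - S))" by auto
  have mx: "a j \<le> a i" if "j \<in> T - S" for j unfolding i(2) using that assms(1) by (intro Max_ge) auto
  show ?case
    by (rule exI[of _ "insert i S"]) (use S i mx fS in auto)
qed

lemma L2_set_le_bound:
  assumes "\<And>i. i \<in> S \<Longrightarrow> 0 \<le> a i" "\<And>i. i \<in> S \<Longrightarrow> a i \<le> b" "card S \<le> k" "0 \<le> b"
  shows "L2_set a S \<le> sqrt k * b"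
proof -
  have "L2_set a S \<le> L2_set (\<lambda>_. b) S" by (intro L2_set_mono assms)
  also have "\<dots> = sqrt (card S) * b" using assms(4) by (simp add: L2_set_def real_sqrt_mult)
  also have "\<dots> \<le> sqrt k * b" using assms by (intro mult_right_mono) auto
  finally show ?thesis .
qed

text \<open>The chunking argument of compressed sensing: split \<open>T\<close> into consecutive blocks of \<open>k\<close> elements in
decreasing order of \<open>a\<close>. Each element of a block is at most the average over the previous block, so
the Euclidean norm of a block is at most the sum over the previous block divided by \<open>sqrt k\<close>. The set
\<open>S\<close> plays the previous block for the first block of \<open>T\<close>.\<close>

lemma chunk_bound:
  fixes g :: "'i set \<Rightarrow> real" and a :: "'i \<Rightarrow> real"
  assumes sub: "\<And>S T. S \<subseteq> \<Gamma> \<Longrightarrow> T \<subseteq> \<Gamma> \<Longrightarrow> S \<inter> T = {} \<Longrightarrow> g (S \<union> T) \<le> g S + g T"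
    and small: "\<And>S. S \<subseteq> \<Gamma> \<Longrightarrow> card S \<le> k \<Longrightarrow> g S \<le> D * L2_set a S"
    and a: "\<And>i. 0 \<le> a i" and D: "0 \<le> D" and k: "0 < k" and fin: "finite \<Gamma>"
    and T: "T \<subseteq> \<Gamma>" and S: "card S = k" and le: "\<And>i j. i \<in> S \<Longrightarrow> j \<in> T \<Longrightarrow> a j \<le> a i"
  shows "g T \<le> D * ((\<Sum>i\<in>S. a i) + (\<Sum>i\<in>T. a i)) / sqrt k"
  using T S le
proof (induction "card T" arbitrary: S T rule: less_induct)
  case less
  have fT: "finite T" using less.prems fin finite_subset by blast
  have few: "g U \<le> D * (\<Sum>i\<in>S. a i) / sqrt k" if U: "U \<subseteq> T" "card U \<le> k" for U
  proof -
    have "a j \<le> (\<Sum>i\<in>S. a i) / k" if "j \<in> T" for j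
      using sum_mono[of S "\<lambda>_. a j" a] less.prems that k by (simp add: pos_le_divide_eq mult.commute)
    then have "L2_set a U \<le> sqrt k * ((\<Sum>i\<in>S. a i) / k)"
      using U a by (intro L2_set_le_bound) (auto intro!: divide_nonneg_nonneg sum_nonneg)
    also have "\<dots> = (\<Sum>i\<in>S. a i) / sqrt k"
      using real_sqrt_mult_self[of k] k by (simp add: field_simps)
    finally have "D * L2_set a U \<le> D * ((\<Sum>i\<in>S. a i) / sqrt k)" using D by (intro mult_left_mono)
    moreover have "g U \<le> D * L2_set a U" using U less.prems(1) by (intro small) auto
    ultimately show ?thesis by simp
  qed
  show ?case
  proof (cases "card T \<le> k")
    case True
    have "g T \<le> D * (\<Sum>i\<in>S. a i) / sqrt k" using True by (intro few) auto
    also have "\<dots> \<le> D * ((\<Sum>i\<in>S. a i) + (\<Sum>i\<in>T. a i)) / sqrt k"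
      using D a by (intro divide_right_mono mult_left_mono) (auto intro!: sum_nonneg)
    finally show ?thesis .
  next
    case False
    then obtain U where U: "U \<subseteq> T" "card U = k" "\<forall>i\<in>U. \<forall>j\<in>T - U. a j \<le> a i"
      using top_subset[OF fT, of k a] by auto
    obtain u where "u \<in> U" using U(2) k by fastforce
    then have "card (T - U) < card T" using U(1) fT by (intro psubset_card_mono) auto
    then have "g (T - U) \<le> D * ((\<Sum>i\<in>U. a i) + (\<Sum>i\<in>T - U. a i)) / sqrt k"
      using U less.prems by (intro less.hyps) auto
    also have "(\<Sum>i\<in>U. a i) + (\<Sum>i\<in>T - U. a i) = (\<Sum>i\<in>T. a i)"
      using sum.subset_diff[OF U(1) fT, of a] by simp
    finally have "g (T - U) \<le> D * (\<Sum>i\<in>T. a i) / sqrt k" .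
    moreover have "g U \<le> D * (\<Sum>i\<in>S. a i) / sqrt k" using U by (intro few) auto
    moreover have "g (U \<union> (T - U)) \<le> g U + g (T - U)" using U less.prems(1) by (intro sub) auto
    then have "g T \<le> g U + g (T - U)" using U(1) by (simp add: Un_absorb1)
    ultimately show ?thesis by (simp add: distrib_left add_divide_distrib)
  qed
qed

lemma sorted_tail_bound:
  fixes g :: "'i set \<Rightarrow> real" and a :: "'i \<Rightarrow> real"
  assumes sub: "\<And>S T. S \<subseteq> \<Gamma> \<Longrightarrow> T \<subseteq> \<Gamma> \<Longrightarrow> S \<inter> T = {} \<Longrightarrow> g (S \<union> T) \<le> g S + g T"
    and small: "\<And>S. S \<subseteq> \<Gamma> \<Longrightarrow> card S \<le> k \<Longrightarrow> g S \<le> D * L2_set a S"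
    and a: "\<And>i. 0 \<le> a i" and D: "0 \<le> D" and k: "0 < k" and fin: "finite \<Gamma>" and T: "T \<subseteq> \<Gamma>"
  shows "\<exists>S\<subseteq>T. card S \<le> k \<and> g (T - S) \<le> D * (\<Sum>i\<in>T. a i) / sqrt k"
proof -
  have fT: "finite T" using T fin finite_subset by blast
  show ?thesis
  proof (cases "card T \<le> k")
    case True
    have "g (T - T) \<le> 0" using small[of "{}"] by simp
    also have "0 \<le> D * (\<Sum>i\<in>T. a i) / sqrt k" using a D by (auto intro!: divide_nonneg_nonneg mult_nonneg_nonneg sum_nonneg)
    finally show ?thesis using True by blast
  next
    case False
    then obtain S where S: "S \<subseteq> T" "card S = k" "\<forall>i\<in>S. \<forall>j\<in>T - S. a j \<le> a i"
      using top_subset[OF fT, of k a] by auto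
    have "g (T - S) \<le> D * ((\<Sum>i\<in>S. a i) + (\<Sum>i\<in>T - S. a i)) / sqrt k"
      by (rule chunk_bound[OF sub small a D k fin]) (use T S in auto)
    then have "g (T - S) \<le> D * (\<Sum>i\<in>T. a i) / sqrt k"
      using sum.subset_diff[OF S(1) fT, of a] by (simp add: add.commute)
    then show ?thesis using S by (intro exI[of _ S]) auto
  qed
qed

definition zero_outside :: "'a set \<Rightarrow> ('a \<Rightarrow> complex) \<Rightarrow> 'a \<Rightarrow> complex" where
  "zero_outside J f = (\<lambda>j. if j \<in> J then f j else 0)"

text \<open>This additivity makes \<open>S \<mapsto> F (f on S)\<close> subadditive, as required by \<open>chunk_bound\<close>.\<close>

lemma zero_outside_disjoint_Un: "A \<inter> B = {} \<Longrightarrow> zero_outside (A \<union> B) f = (\<lambda>j. zero_outside A f j + zero_outside B f j)"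
  by (rule ext) (auto simp: zero_outside_def)

lemma l2_on_UN:
  assumes "finite S" "\<And>i. i \<in> S \<Longrightarrow> finite (\<I> i)" "disjoint_family_on \<I> S"
  shows "l2_on (\<Union>i\<in>S. \<I> i) f = L2_set (\<lambda>i. l2_on (\<I> i) f) S"
proof -
  have "(\<Sum>j\<in>(\<Union>i\<in>S. \<I> i). (cmod (f j))\<^sup>2) = (\<Sum>i\<in>S. (l2_on (\<I> i) f)\<^sup>2)"
    unfolding l2_on_square using assms by (intro sum.UNION_disjoint) (auto simp: disjoint_family_on_def)
  then show ?thesis by (simp add: l2_on_def[of "\<Union>i\<in>S. \<I> i"] L2_set_def)
qed

context vector_seminorm begin

text \<open>Suppose \<open>f\<close> is in the kernel and its mixed norm on \<open>S\<close> is at least that off \<open>S\<close>. Let \<open>T\<close> contain the \<open>k\<close>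
largest groups off \<open>S\<close> and \<open>R\<close> the rest. Then \<open>F (f on S \<union> T) = F (f on R)\<close>, which by sorting is at most
\<open>\<beta> / sqrt k\<close> times the mixed norm off \<open>S\<close>, hence at most \<open>\<beta> sqrt (s / k)\<close> times the Euclidean norm on
\<open>S \<union> T\<close>. As this factor is below \<open>\<alpha>\<close>, the vector vanishes on \<open>S\<close>, and then everywhere.\<close>

lemma rip_imp_null_space_property:
  fixes \<I> :: "'i \<Rightarrow> 'a set"
  assumes fin: "finite \<Gamma>" "\<And>i. i \<in> \<Gamma> \<Longrightarrow> finite (\<I> i)" and disj: "disjoint_family_on \<I> \<Gamma>"
    and low: "\<And>S. S \<subseteq> \<Gamma> \<Longrightarrow> card S \<le> k + s \<Longrightarrow> \<alpha> * l2_on (\<Union>i\<in>S. \<I> i) f \<le> F (zero_outside (\<Union>i\<in>S. \<I> i) f)"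
    and up: "\<And>S. S \<subseteq> \<Gamma> \<Longrightarrow> card S \<le> k \<Longrightarrow> F (zero_outside (\<Union>i\<in>S. \<I> i) f) \<le> \<beta> * l2_on (\<Union>i\<in>S. \<I> i) f"
    and k: "k > 0" "\<beta> * sqrt (s / k) < \<alpha>" and \<beta>: "\<beta> \<ge> 0"
    and ker: "F (zero_outside (\<Union>i\<in>\<Gamma>. \<I> i) f) = 0"
    and S: "S \<subseteq> \<Gamma>" "card S \<le> s" and cone: "(\<Sum>i\<in>\<Gamma> - S. l2_on (\<I> i) f) \<le> (\<Sum>i\<in>S. l2_on (\<I> i) f)"
    and i: "i \<in> \<Gamma>"
  shows "l2_on (\<I> i) f = 0"
proof -
  define a where "a i = l2_on (\<I> i) f" for i
  define g where "g S = F (zero_outside (\<Union>i\<in>S. \<I> i) f)" for S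
  have a0: "0 \<le> a i" for i by (simp add: a_def)
  have L2: "l2_on (\<Union>i\<in>S. \<I> i) f = L2_set a S" if "S \<subseteq> \<Gamma>" for S
    unfolding a_def using that fin disj
    by (intro l2_on_UN) (auto intro: finite_subset disjoint_family_on_mono)
  have cutU: "zero_outside (\<Union>i\<in>S \<union> T. \<I> i) f = (\<lambda>j. zero_outside (\<Union>i\<in>S. \<I> i) f j + zero_outside (\<Union>i\<in>T. \<I> i) f j)"
    if "S \<subseteq> \<Gamma>" "T \<subseteq> \<Gamma>" "S \<inter> T = {}" for S T
  proof -
    have "\<I> i \<inter> \<I> j = {}" if "i \<in> S" "j \<in> T" for i j
      by (rule disjoint_family_onD[OF disj])
         (use that \<open>S \<subseteq> \<Gamma>\<close> \<open>T \<subseteq> \<Gamma>\<close> \<open>S \<inter> T = {}\<close> in auto)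
    then have "(\<Union>i\<in>S. \<I> i) \<inter> (\<Union>i\<in>T. \<I> i) = {}" by blast
    then show ?thesis unfolding UN_Un by (rule zero_outside_disjoint_Un)
  qed
  have sub: "g (S \<union> T) \<le> g S + g T" if "S \<subseteq> \<Gamma>" "T \<subseteq> \<Gamma>" "S \<inter> T = {}" for S T
    unfolding g_def cutU[OF that] by (rule triangle)
  have small: "g S \<le> \<beta> * L2_set a S" if "S \<subseteq> \<Gamma>" "card S \<le> k" for S
    using up[OF that] by (simp add: g_def L2 that)
  obtain T where T: "T \<subseteq> \<Gamma> - S" "card T \<le> k" "g (\<Gamma> - S - T) \<le> \<beta> * (\<Sum>i\<in>\<Gamma> - S. a i) / sqrt k"
    using sorted_tail_bound[where g=g and a=a and T="\<Gamma> - S", OF sub small a0 \<beta> k(1) fin(1)] by blast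
  \<comment> \<open>The head \<open>H\<close> carries the lower bound, the rest \<open>R\<close> the sorted upper bound.\<close>
  let ?R = "\<Gamma> - S - T" and ?H = "S \<union> T"
  have H: "?H \<subseteq> \<Gamma>" "?R \<subseteq> \<Gamma>" "?H \<inter> ?R = {}" "?H \<union> ?R = \<Gamma>" using S T by auto
  have fH: "finite ?H" "finite S" "finite T" using H(1) fin(1) finite_subset by auto
  have "F (zero_outside (\<Union>i\<in>?H. \<I> i) f) \<le> F (\<lambda>j. zero_outside (\<Union>i\<in>\<Gamma>. \<I> i) f j) + F (\<lambda>j. - zero_outside (\<Union>i\<in>?R. \<I> i) f j)"
    using triangle[of "zero_outside (\<Union>i\<in>\<Gamma>. \<I> i) f" "\<lambda>j. - zero_outside (\<Union>i\<in>?R. \<I> i) f j"] cutU[OF H(1,2,3)]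
    unfolding H(4) by simp
  then have gH: "g ?H \<le> g ?R" by (simp add: uminus g_def ker)
  have "\<alpha> * L2_set a ?H \<le> g ?H"
    using low[OF H(1)] S(2) T(2) card_Un_le[of S T] unfolding L2[OF H(1)] g_def by linarith
  also have "\<dots> \<le> \<beta> * (\<Sum>i\<in>\<Gamma> - S. a i) / sqrt k" using gH T(3) by simp
  also have "\<dots> \<le> \<beta> * (sqrt s * L2_set a ?H) / sqrt k"
  proof (intro divide_right_mono mult_left_mono \<beta>)
    have "(\<Sum>i\<in>\<Gamma> - S. a i) \<le> (\<Sum>i\<in>S. a i)" using cone by (simp add: a_def)
    also have "\<dots> \<le> sqrt (card S) * L2_set a S" by (rule sum_le_sqrt_card_L2)
    also have "\<dots> \<le> sqrt s * L2_set a ?H"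
      using S(2) fH unfolding L2_set_def by (intro mult_mono real_sqrt_le_mono sum_mono2) (auto intro!: sum_nonneg)
    finally show "(\<Sum>i\<in>\<Gamma> - S. a i) \<le> sqrt s * L2_set a ?H" .
  qed simp
  also have "\<dots> = \<beta> * sqrt (s / k) * L2_set a ?H" by (simp add: real_sqrt_divide)
  finally have "(\<alpha> - \<beta> * sqrt (s / k)) * L2_set a ?H \<le> 0" by (simp add: algebra_simps)
  then have "L2_set a ?H \<le> 0" using k(2) by (simp add: mult_le_0_iff)
  then have "L2_set a ?H = 0" using L2_set_nonneg[of a ?H] by linarith
  then have "a j = 0" if "j \<in> S" for j using that fH by (auto simp: L2_set_eq_0_iff)
  then have "(\<Sum>j\<in>\<Gamma> - S. a j) \<le> 0" "\<And>j. j \<in> S \<Longrightarrow> a j = 0" using cone by (simp_all add: a_def)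
  then have "\<And>j. j \<in> \<Gamma> - S \<Longrightarrow> a j = 0"
    using sum_nonneg_eq_0_iff[of "\<Gamma> - S" a] fin(1) a0 sum_nonneg[of "\<Gamma> - S" a] by force
  then show ?thesis using \<open>\<And>j. j \<in> S \<Longrightarrow> a j = 0\<close> i by (auto simp: a_def)
qed

end

section \<open>Exact recovery and the null space property\<close>

definition null_space_property :: "(nat \<Rightarrow> nat set) \<Rightarrow> nat \<Rightarrow> nat \<Rightarrow> (nat \<Rightarrow> complex) \<Rightarrow> bool" where
  "null_space_property \<I> G s f \<longleftrightarrow>
     (\<forall>S\<subseteq>{..<G}. card S \<le> s \<longrightarrow> (\<Sum>i\<in>S. l2_on (\<I> i) f) < (\<Sum>i\<in>{..<G} - S. l2_on (\<I> i) f))"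

lemma l2norm_vec_on:
  assumes "J \<subseteq> {..<dim_vec v}" shows "l2norm (vec_on v J) = l2_on J (vec_index v)"
proof -
  have "l2norm (vec_on v J) = L2_set (\<lambda>j. cmod (if j \<in> J then vec_index v j else 0)) {..<dim_vec v}"
    unfolding l2norm_def by (intro L2_set_cong) (auto simp: vec_on_def)
  also have "\<dots> = l2_on {..<dim_vec v} (zero_outside J (vec_index v))" by (simp add: l2_on_def zero_outside_def)
  also have "\<dots> = l2_on J (zero_outside J (vec_index v))" using assms by (intro l2_on_supp) (auto simp: zero_outside_def)
  also have "\<dots> = l2_on J (vec_index v)" by (intro l2_on_cong) (simp add: zero_outside_def)
  finally show ?thesis .
qed

lemma group_partition_subset: "group_partition \<I> G n \<Longrightarrow> i < G \<Longrightarrow> \<I> i \<subseteq> {..<n}"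
  using UN_upper[of i "{..<G}" \<I>] by (simp add: group_partition_def)

lemma group_partition_finite: "group_partition \<I> G n \<Longrightarrow> i < G \<Longrightarrow> finite (\<I> i)"
  by (rule finite_subset[OF group_partition_subset finite_lessThan])

lemma group_partition_disjoint: "group_partition \<I> G n \<Longrightarrow> i < G \<Longrightarrow> j < G \<Longrightarrow> i \<noteq> j \<Longrightarrow> \<I> i \<inter> \<I> j = {}"
  unfolding group_partition_def by (auto dest: disjoint_family_onD)

lemma group_partition_bound: "group_partition \<I> G n \<Longrightarrow> i < G \<Longrightarrow> j \<in> \<I> i \<Longrightarrow> j < n"
  using group_partition_subset by blast

lemma group_l1_eq:
  assumes "group_partition \<I> G n" "v \<in> carrier_vec n"
  shows "group_l1 \<I> G v = (\<Sum>i<G. l2_on (\<I> i) (vec_index v))"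
  unfolding group_l1_def
  using group_partition_subset[OF assms(1)] assms(2) by (intro sum.cong l2norm_vec_on) auto

text \<open>If the null space property holds, any other feasible point differs from the sparse vector \<open>x\<close> by a
kernel vector and has larger mixed norm by the triangle inequality on the support of \<open>x\<close>. Conversely,
a kernel vector \<open>v\<close> makes the sparse \<open>v\<close> on \<open>S\<close> and its negative off \<open>S\<close> feasible for the same data, so
recovery of the former forces the strict inequality. Because of the equivalence, the recovery event
inherits its measurability from the null space property.\<close>

lemma exact_recovery_iff:
  assumes part: "group_partition \<I> G n" and A: "A \<in> carrier_mat r n"
  shows "(\<forall>x \<in> group_sparse \<I> G s n. group_l1_minimizers \<I> G n A (A *\<^sub>v x) = {x})
     \<longleftrightarrow> (\<forall>v \<in> carrier_vec n. A *\<^sub>v v = 0\<^sub>v r \<longrightarrow> v \<noteq> 0\<^sub>v n \<longrightarrow> null_space_property \<I> G s (vec_index v))"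
    (is "?recovery \<longleftrightarrow> ?nsp")
proof
  assume rec: ?recovery
  show ?nsp
  proof (intro ballI impI)
    fix v assume v: "v \<in> carrier_vec n" "A *\<^sub>v v = 0\<^sub>v r" "v \<noteq> 0\<^sub>v n"
    show "null_space_property \<I> G s (vec_index v)"
      unfolding null_space_property_def
    proof (intro allI impI)
      fix S assume S: "S \<subseteq> {..<G}" "card S \<le> s"
      \<comment> \<open>Both \<open>x\<close> and \<open>w\<close> have the same image, and only \<open>x\<close> is known to be sparse.\<close>
      define x where "x = vec_on v (\<Union>i\<in>S. \<I> i)"
      define w where "w = x - v"
      have x: "x \<in> carrier_vec n" using v by (simp add: x_def vec_on_def)
      have w: "w \<in> carrier_vec n" using v x by (simp add: w_def)
      have Aw: "A *\<^sub>v w = A *\<^sub>v x"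
        using mult_minus_distrib_mat_vec[OF A x v(1)] v(2) A x
        by (simp add: w_def)
      have SG: "i < G" if "i \<in> S" for i using S(1) that by auto
      have UI: "j \<notin> (\<Union>i\<in>S. \<I> i)" if "j \<in> \<I> i" "i \<in> {..<G} - S" for i j
        using group_partition_disjoint[OF part, of i] that S(1) by fastforce
      have xin: "vec_index x j = vec_index v j" if "j \<in> \<I> i" "i \<in> S" for i j
        using that group_partition_bound[OF part, of i j] SG v by (auto simp: x_def vec_on_def)
      have xout: "vec_index x j = 0" if "j \<in> \<I> i" "i \<in> {..<G} - S" for i j
        using UI[OF that] that group_partition_bound[OF part, of i j] SG v by (auto simp: x_def vec_on_def)
      have win: "vec_index w j = 0" if "j \<in> \<I> i" "i \<in> S" for i j
        using xin[OF that] that group_partition_bound[OF part, of i j] SG v by (auto simp: w_def)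
      have wout: "vec_index w j = - vec_index v j" if "j \<in> \<I> i" "i \<in> {..<G} - S" for i j
        using xout[OF that] that group_partition_bound[OF part, of i j] SG v by (auto simp: w_def)
      have "group_l0 \<I> G x \<le> card S"
        unfolding group_l0_def
      proof (intro card_mono)
        show "finite S" using S(1) finite_subset by blast
        show "{i \<in> {..<G}. vec_on x (\<I> i) \<noteq> 0\<^sub>v (dim_vec x)} \<subseteq> S"
        proof (rule subsetI, rule ccontr)
          fix i assume i: "i \<in> {i \<in> {..<G}. vec_on x (\<I> i) \<noteq> 0\<^sub>v (dim_vec x)}" "i \<notin> S"
          then have "vec_on x (\<I> i) = 0\<^sub>v (dim_vec x)" by (intro eq_vecI) (auto simp: vec_on_def xout)
          then show False using i by simp
        qed
      qed
      then have "x \<in> group_sparse \<I> G s n" using x S(2) by (simp add: group_sparse_def)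
      then have min: "group_l1_minimizers \<I> G n A (A *\<^sub>v x) = {x}" using rec by blast
      have split: "(\<Sum>i<G. h i) = (\<Sum>i\<in>{..<G} - S. h i) + (\<Sum>i\<in>S. h i)" for h :: "nat \<Rightarrow> real"
        using S(1) by (intro sum.subset_diff) auto
      have z: "l2_on J f = 0" if "\<And>j. j \<in> J \<Longrightarrow> f j = 0" for J and f :: "nat \<Rightarrow> complex"
        using that by (simp add: l2_on_def L2_set_def)
      have neg: "l2_on J f = l2_on J f'" if "\<And>j. j \<in> J \<Longrightarrow> f j = - f' j" for J and f f' :: "nat \<Rightarrow> complex"
        unfolding l2_on_def by (intro L2_set_cong) (auto simp: that)
      have "(\<Sum>i\<in>{..<G} - S. l2_on (\<I> i) (vec_index x)) = 0" by (intro sum.neutral ballI z xout)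
      moreover have "(\<Sum>i\<in>S. l2_on (\<I> i) (vec_index x)) = (\<Sum>i\<in>S. l2_on (\<I> i) (vec_index v))"
        by (intro sum.cong refl l2_on_cong xin)
      ultimately have nx: "group_l1 \<I> G x = (\<Sum>i\<in>S. l2_on (\<I> i) (vec_index v))"
        unfolding group_l1_eq[OF part x] split by simp
      have "(\<Sum>i\<in>S. l2_on (\<I> i) (vec_index w)) = 0" by (intro sum.neutral ballI z win)
      moreover have "(\<Sum>i\<in>{..<G} - S. l2_on (\<I> i) (vec_index w)) = (\<Sum>i\<in>{..<G} - S. l2_on (\<I> i) (vec_index v))"
        by (intro sum.cong refl neg wout)
      ultimately have nw: "group_l1 \<I> G w = (\<Sum>i\<in>{..<G} - S. l2_on (\<I> i) (vec_index v))"
        unfolding group_l1_eq[OF part w] split by simp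
      show "(\<Sum>i\<in>S. l2_on (\<I> i) (vec_index v)) < (\<Sum>i\<in>{..<G} - S. l2_on (\<I> i) (vec_index v))"
      proof (rule ccontr)
        assume "\<not> ?thesis"
        then have le: "group_l1 \<I> G w \<le> group_l1 \<I> G x" by (simp add: nx nw)
        have "x \<in> group_l1_minimizers \<I> G n A (A *\<^sub>v x)" using min by simp
        then have "w \<in> group_l1_minimizers \<I> G n A (A *\<^sub>v x)"
          using le w Aw unfolding group_l1_minimizers_def by (auto intro: order_trans)
        then have "w = x" using min by simp
        then have "v = 0\<^sub>v n"
          using v(1) x by (intro eq_vecI) (auto simp: w_def vec_eq_iff)
        then show False using v(3) by simp
      qed
    qed
  qed
next
  assume nsp: ?nsp
  show ?recovery
  proof
    fix x assume "x \<in> group_sparse \<I> G s n"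
    then have x: "x \<in> carrier_vec n" "group_l0 \<I> G x \<le> s" by (auto simp: group_sparse_def)
    define S where "S = {i \<in> {..<G}. vec_on x (\<I> i) \<noteq> 0\<^sub>v (dim_vec x)}"
    have S: "S \<subseteq> {..<G}" "card S \<le> s" using x(2) by (auto simp: S_def group_l0_def)
    have split: "(\<Sum>i<G. h i) = (\<Sum>i\<in>{..<G} - S. h i) + (\<Sum>i\<in>S. h i)" for h :: "nat \<Rightarrow> real"
      using S(1) by (intro sum.subset_diff) auto
    have x0: "vec_index x j = 0" if "i \<in> {..<G} - S" "j \<in> \<I> i" for i j
    proof -
      have j: "j < dim_vec x" using that group_partition_subset[OF part, of i] x(1) by auto
      have "vec_on x (\<I> i) = 0\<^sub>v (dim_vec x)" using that by (simp add: S_def)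
      then have "vec_index (vec_on x (\<I> i)) j = 0" using j by simp
      then show ?thesis using that j by (simp add: vec_on_def)
    qed
    have less: "group_l1 \<I> G x < group_l1 \<I> G w"
      if w: "w \<in> carrier_vec n" "A *\<^sub>v w = A *\<^sub>v x" "w \<noteq> x" for w
    proof -
      define v where "v = w - x"
      have v: "v \<in> carrier_vec n" using w x by (simp add: v_def)
      have "A *\<^sub>v v = 0\<^sub>v r"
        using mult_minus_distrib_mat_vec[OF A w(1) x(1)] w(2) A x by (simp add: v_def)
      moreover have "v \<noteq> 0\<^sub>v n"
      proof
        assume "v = 0\<^sub>v n"
        then have "w = x" using w(1) x(1) by (intro eq_vecI) (auto simp: v_def vec_eq_iff)
        then show False using w(3) by simp
      qed
      ultimately have "(\<Sum>i\<in>S. l2_on (\<I> i) (vec_index v)) < (\<Sum>i\<in>{..<G} - S. l2_on (\<I> i) (vec_index v))"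
        using nsp v S unfolding null_space_property_def by blast
      moreover have "(\<Sum>i\<in>{..<G} - S. l2_on (\<I> i) (vec_index v)) = (\<Sum>i\<in>{..<G} - S. l2_on (\<I> i) (vec_index w))"
      proof (intro sum.cong refl l2_on_cong)
        fix i j assume ij: "i \<in> {..<G} - S" "j \<in> \<I> i"
        then have "j < n" using group_partition_subset[OF part, of i] by auto
        then show "vec_index v j = vec_index w j" using x0[OF ij] w x by (simp add: v_def)
      qed
      moreover have "(\<Sum>i\<in>S. l2_on (\<I> i) (vec_index x)) \<le> (\<Sum>i\<in>S. l2_on (\<I> i) (vec_index w) + l2_on (\<I> i) (vec_index v))"
      proof (rule sum_mono)
        fix i assume i: "i \<in> S"
        have "l2_on (\<I> i) (vec_index x) = l2_on (\<I> i) (\<lambda>j. vec_index w j + complex_of_real (-1) * vec_index v j)"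
        proof (rule l2_on_cong)
          fix j assume "j \<in> \<I> i"
          then have "j < n" using group_partition_subset[OF part, of i] i S(1) by auto
          then show "vec_index x j = vec_index w j + complex_of_real (-1) * vec_index v j" using w x by (simp add: v_def)
        qed
        also have "\<dots> \<le> l2_on (\<I> i) (vec_index w) + l2_on (\<I> i) (vec_index v)"
          using l2_on_triangle[of "\<I> i" "vec_index w" "\<lambda>j. complex_of_real (-1) * vec_index v j"]
          unfolding l2_on_scale by simp
        finally show "l2_on (\<I> i) (vec_index x) \<le> l2_on (\<I> i) (vec_index w) + l2_on (\<I> i) (vec_index v)" .
      qed
      moreover have "(\<Sum>i\<in>{..<G} - S. l2_on (\<I> i) (vec_index x)) = 0"
        using x0 by (intro sum.neutral) (auto simp: l2_on_def L2_set_def)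
      ultimately show ?thesis
        unfolding group_l1_eq[OF part x(1)] group_l1_eq[OF part w(1)] split by (simp add: sum.distrib)
    qed
    show "group_l1_minimizers \<I> G n A (A *\<^sub>v x) = {x}"
    proof (intro equalityI subsetI)
      fix w assume w: "w \<in> group_l1_minimizers \<I> G n A (A *\<^sub>v x)"
      then have "group_l1 \<I> G w \<le> group_l1 \<I> G x" using x(1) by (auto simp: group_l1_minimizers_def)
      then have "w = x" using less[of w] w by (force simp: group_l1_minimizers_def)
      then show "w \<in> {x}" by simp
    next
      fix w assume "w \<in> {x}"
      then show "w \<in> group_l1_minimizers \<I> G n A (A *\<^sub>v x)"
        using x(1) less by (auto simp: group_l1_minimizers_def intro: less_imp_le)
    qed
  qed
qed

section \<open>Block diagonal and unitary matrices\<close>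

definition mat_apply :: "nat \<Rightarrow> complex Matrix.mat \<Rightarrow> (nat \<Rightarrow> complex) \<Rightarrow> nat \<Rightarrow> complex" where
  "mat_apply n \<Psi> f r = (\<Sum>k<n. index_mat \<Psi> (r, k) * f k)"

lemma block_diag_mat_carrier: "block_diag_mat m d L \<phi> \<in> carrier_mat (m * L) (d * L)"
  unfolding block_diag_mat_def
  by (rule carrier_matI) (simp_all add: dim_diag_block_mat comp_def sum_list_triv mult.commute)

lemma block_diag_mat_Suc:
  "block_diag_mat m d (Suc L) \<phi> = four_block_mat (block_diag_mat m d L \<phi>) (0\<^sub>m (m * L) d) (0\<^sub>m m (d * L))
     (Matrix.mat m d (\<lambda>(i, j). complex_of_real (\<phi> (L, i, j))))"
  using block_diag_mat_carrier[of m d L \<phi>]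
  by (simp add: block_diag_mat_def diag_block_mat_last Let_def)

lemma block_index_less:
  fixes l L i m :: nat
  assumes "l < L" "i < m" shows "l * m + i < m * L"
proof -
  have "l * m + i < (l + 1) * m" using assms(2) by simp
  also have "\<dots> \<le> L * m" using assms(1) by (intro mult_right_mono) auto
  finally show ?thesis by (simp add: mult.commute)
qed

text \<open>Entry \<open>(r, c)\<close> lies in a diagonal block exactly if both indices have the same quotient by the block
dimensions; the remainders are the indices within the block.\<close>

lemma block_diag_mat_index:
  assumes "r < m * L" "c < d * L"
  shows "index_mat (block_diag_mat m d L \<phi>) (r, c)
    = (if r div m = c div d then complex_of_real (\<phi> (r div m, r mod m, c mod d)) else 0)"
  using assms
proof (induction L)
  case (Suc L)
  note carr = block_diag_mat_carrier[of m d L \<phi>]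
  have md: "m > 0" "d > 0" using Suc.prems by (auto intro: gr0I)
  show ?case
  proof (cases "r < m * L")
    case r: True
    then have rd: "r div m < L" using md by (simp add: less_mult_imp_div_less mult.commute)
    show ?thesis
    proof (cases "c < d * L")
      case True
      then show ?thesis using r Suc carr by (simp add: block_diag_mat_Suc)
    next
      case False
      then have "c div d \<ge> L" using md by (metis div_le_mono linorder_not_less nonzero_mult_div_cancel_left not_gr_zero)
      then show ?thesis using r False Suc.prems carr rd by (simp add: block_diag_mat_Suc)
    qed
  next
    case r: False
    define i where "i = r - m * L"
    have i: "r = L * m + i" "i < m" using r Suc.prems by (auto simp: i_def algebra_simps)
    show ?thesis
    proof (cases "c < d * L")
      case True
      then have "c div d < L" using md by (simp add: less_mult_imp_div_less mult.commute)
      then show ?thesis using r True Suc.prems carr i by (simp add: block_diag_mat_Suc)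
    next
      case False
      define j where "j = c - d * L"
      have j: "c = L * d + j" "j < d" using False Suc.prems by (auto simp: j_def algebra_simps)
      show ?thesis using r False Suc.prems carr i j by (simp add: block_diag_mat_Suc mult.commute)
    qed
  qed
qed simp

lemma block_diag_mat_mult:
  assumes v: "v \<in> carrier_vec (d * L)" and l: "l < L" and i: "i < m"
  shows "vec_index (block_diag_mat m d L \<phi> *\<^sub>v v) (l * m + i) = measurement d \<phi> l i (vec_index v)"
proof -
  note carr = block_diag_mat_carrier[of m d L \<phi>]
  have r: "l * m + i < m * L" by (rule block_index_less[OF l i])
  have "vec_index (block_diag_mat m d L \<phi> *\<^sub>v v) (l * m + i)
     = (\<Sum>c<d * L. index_mat (block_diag_mat m d L \<phi>) (l * m + i, c) * vec_index v c)"
    using carr r v by (simp add: scalar_prod_def lessThan_atLeast0)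
  also have "\<dots> = (\<Sum>c<d * L. (if l = c div d then complex_of_real (\<phi> (l, i, c mod d)) else 0) * vec_index v c)"
    using r i by (intro sum.cong refl) (simp add: block_diag_mat_index)
  also have "\<dots> = (\<Sum>l'<L. \<Sum>j<d. (if l = (l' * d + j) div d then complex_of_real (\<phi> (l, i, (l' * d + j) mod d)) else 0) * vec_index v (l' * d + j))"
    by (rule sum_blocks[symmetric])
  also have "\<dots> = (\<Sum>l'<L. if l' = l then measurement d \<phi> l i (vec_index v) else 0)"
    by (intro sum.cong refl) (auto simp: measurement_def)
  also have "\<dots> = measurement d \<phi> l i (vec_index v)" using l by simp
  finally show ?thesis .
qed

lemma measurement_cong:
  assumes "\<And>j. j < d * L \<Longrightarrow> u j = u' j" "l < L"
  shows "measurement d \<phi> l i u = measurement d \<phi> l i u'"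
proof -
  have "l * d + j < d * L" if "j < d" for j by (rule block_index_less[OF assms(2) that])
  then show ?thesis by (simp add: measurement_def assms(1))
qed

lemma kernel_iff:
  assumes \<Psi>: "\<Psi> \<in> carrier_mat (d * L) (d * L)" and v: "v \<in> carrier_vec (d * L)"
  shows "(block_diag_mat m d L \<phi> * \<Psi>) *\<^sub>v v = 0\<^sub>v (m * L)
    \<longleftrightarrow> (\<forall>l<L. \<forall>i<m. measurement d \<phi> l i (mat_apply (d * L) \<Psi> (vec_index v)) = 0)"
proof -
  let ?B = "block_diag_mat m d L \<phi>"
  note carr = block_diag_mat_carrier[of m d L \<phi>]
  have u: "\<Psi> *\<^sub>v v \<in> carrier_vec (d * L)" using \<Psi> v by simp
  have ui: "vec_index (\<Psi> *\<^sub>v v) j = mat_apply (d * L) \<Psi> (vec_index v) j" if "j < d * L" for j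
    using that \<Psi> v by (simp add: mat_apply_def scalar_prod_def lessThan_atLeast0)
  have meas: "vec_index (?B *\<^sub>v (\<Psi> *\<^sub>v v)) (l * m + i) = measurement d \<phi> l i (mat_apply (d * L) \<Psi> (vec_index v))"
    if "l < L" "i < m" for l i
    using block_diag_mat_mult[OF u that] measurement_cong[OF ui that(1)] by simp
  have "(?B * \<Psi>) *\<^sub>v v = 0\<^sub>v (m * L) \<longleftrightarrow> (\<forall>r<m * L. vec_index (?B *\<^sub>v (\<Psi> *\<^sub>v v)) r = 0)"
    using carr \<Psi> v by (auto simp: assoc_mult_mat_vec[OF carr \<Psi> v] vec_eq_iff)
  also have "\<dots> \<longleftrightarrow> (\<forall>l<L. \<forall>i<m. vec_index (?B *\<^sub>v (\<Psi> *\<^sub>v v)) (l * m + i) = 0)"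
  proof (intro iffI allI impI)
    fix r assume *: "\<forall>l<L. \<forall>i<m. vec_index (?B *\<^sub>v (\<Psi> *\<^sub>v v)) (l * m + i) = 0" and r: "r < m * L"
    then have "m > 0" by (auto intro: gr0I)
    then have "r div m < L" "r mod m < m" using r by (auto simp: less_mult_imp_div_less mult.commute)
    then have "vec_index (?B *\<^sub>v (\<Psi> *\<^sub>v v)) (r div m * m + r mod m) = 0" using * by blast
    then show "vec_index (?B *\<^sub>v (\<Psi> *\<^sub>v v)) r = 0" by simp
  next
    fix l i assume *: "\<forall>r<m * L. vec_index (?B *\<^sub>v (\<Psi> *\<^sub>v v)) r = 0" and "l < L" "i < m"
    then have "l * m + i < m * L" by (intro block_index_less)
    then show "vec_index (?B *\<^sub>v (\<Psi> *\<^sub>v v)) (l * m + i) = 0" using * by blast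
  qed
  finally show ?thesis using meas by auto
qed

lemma unitary_isometry:
  assumes U: "unitary_mat n \<Psi>"
  shows "l2_on {..<n} (mat_apply n \<Psi> f) = l2_on {..<n} f"
proof -
  have \<Psi>: "\<Psi> \<in> carrier_mat n n" and UU: "mat_adjoint \<Psi> * \<Psi> = 1\<^sub>m n" using U by (auto simp: unitary_mat_def)
  have orth: "(\<Sum>r<n. cnj (index_mat \<Psi> (r, k)) * index_mat \<Psi> (r, k')) = (if k = k' then 1 else 0)"
    if "k < n" "k' < n" for k k'
  proof -
    have "index_mat (mat_adjoint \<Psi> * \<Psi>) (k, k') = (\<Sum>r<n. cnj (index_mat \<Psi> (r, k)) * index_mat \<Psi> (r, k'))"
      using \<Psi> that by (simp add: mat_adjoint_def scalar_prod_def lessThan_atLeast0 mat_of_rows_def)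
    then show ?thesis using that by (simp add: UU)
  qed
  have "complex_of_real (\<Sum>r<n. (cmod (mat_apply n \<Psi> f r))\<^sup>2)
     = (\<Sum>r<n. mat_apply n \<Psi> f r * cnj (mat_apply n \<Psi> f r))"
    unfolding of_real_sum complex_norm_square ..
  also have "\<dots> = (\<Sum>r<n. \<Sum>k'<n. \<Sum>k<n. f k' * cnj (f k) * (cnj (index_mat \<Psi> (r, k)) * index_mat \<Psi> (r, k')))"
    by (simp add: mat_apply_def sum_product mult_ac)
  also have "\<dots> = (\<Sum>k'<n. \<Sum>k<n. \<Sum>r<n. f k' * cnj (f k) * (cnj (index_mat \<Psi> (r, k)) * index_mat \<Psi> (r, k')))"
    by (rule trans[OF sum.swap]) (intro sum.cong refl sum.swap)
  also have "\<dots> = (\<Sum>k'<n. \<Sum>k<n. f k' * cnj (f k) * (if k = k' then 1 else 0))"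
    by (intro sum.cong refl) (simp add: sum_distrib_left[symmetric] orth)
  also have "\<dots> = (\<Sum>k<n. f k * cnj (f k))"
    by (intro sum.cong refl) (simp add: if_distrib[of "\<lambda>x. _ * x"] cong: if_cong)
  also have "\<dots> = complex_of_real (\<Sum>k<n. (cmod (f k))\<^sup>2)" unfolding of_real_sum complex_norm_square ..
  finally have "(\<Sum>r<n. (cmod (mat_apply n \<Psi> f r))\<^sup>2) = (\<Sum>k<n. (cmod (f k))\<^sup>2)"
    using of_real_eq_iff by blast
  then show ?thesis by (simp add: l2_on_def L2_set_def)
qed

section \<open>Measurability of the recovery event\<close>

text \<open>Closed sets stay closed when a compact factor is projected away, by the tube lemma. It is stated for
arbitrary topological spaces because here the factors are function spaces.\<close>

lemma closed_projection_compact: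
  fixes C :: "'b::topological_space set" and T :: "('a::topological_space \<times> 'b) set"
  assumes C: "compact C" and T: "closed T"
  shows "closed {x. \<exists>y\<in>C. (x, y) \<in> T}"
proof -
  have "open {x. \<not> (\<exists>y\<in>C. (x, y) \<in> T)}"
  proof (rule open_subopen[THEN iffD2], rule ballI)
    fix x assume "x \<in> {x. \<not> (\<exists>y\<in>C. (x, y) \<in> T)}"
    then have "{x} \<times> C \<subseteq> - T" by auto
    from Elementary_Topology.tube_lemma[OF C open_Compl[OF T] this]
    obtain U where "x \<in> U" "open U" "U \<times> C \<subseteq> - T" by (elim exE conjE)
    then show "\<exists>U. open U \<and> x \<in> U \<and> U \<subseteq> {x. \<not> (\<exists>y\<in>C. (x, y) \<in> T)}"
      by (intro exI[of _ U]) auto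
  qed
  moreover have "- {x. \<exists>y\<in>C. (x, y) \<in> T} = {x. \<not> (\<exists>y\<in>C. (x, y) \<in> T)}" by auto
  ultimately show ?thesis by (simp add: closed_def)
qed

definition unit_vectors :: "nat \<Rightarrow> (nat \<Rightarrow> complex) set" where
  "unit_vectors n = {f. (\<forall>j\<ge>n. f j = 0) \<and> l2_on {..<n} f = 1}"

lemma continuous_on_coordinate: "continuous_on S f \<Longrightarrow> continuous_on S (\<lambda>x. f x i)"
  for f :: "'a::topological_space \<Rightarrow> 'i \<Rightarrow> 'b::topological_space"
  by (rule continuous_on_product_then_coordinatewise)

lemma continuous_on_l2_on:
  assumes "continuous_on S f" shows "continuous_on S (\<lambda>x. l2_on J (f x))"
proof -
  have [continuous_intros]: "continuous_on S (\<lambda>x. f x j)" for j using assms by (rule continuous_on_coordinate)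
  show ?thesis unfolding l2_on_def L2_set_def by (intro continuous_intros)
qed

text \<open>By Tychonoff's theorem: the coordinates beyond \<open>n\<close> are pinned to zero, and all others have modulus at
most \<open>1\<close>.\<close>

lemma compact_unit_vectors: "compact (unit_vectors n)"
proof -
  have "compact (PiE UNIV (\<lambda>_::nat. cball (0::complex) 1))"
    using compactin_PiE[of "\<lambda>_::nat. euclidean :: complex topology" UNIV "\<lambda>_. cball 0 1"]
    by (simp add: euclidean_product_topology)
  moreover have "closed (unit_vectors n)"
  proof -
    have c: "continuous_on UNIV (\<lambda>f :: nat \<Rightarrow> complex. f j)" for j by simp
    have "continuous_on UNIV (\<lambda>f :: nat \<Rightarrow> complex. l2_on {..<n} f)"
      by (rule continuous_on_l2_on[OF continuous_on_id])
    then show ?thesis unfolding unit_vectors_def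
      by (intro closed_Collect_conj closed_Collect_all closed_Collect_imp closed_Collect_eq open_Collect_const
            c continuous_on_const)
  qed
  moreover have "unit_vectors n \<subseteq> PiE UNIV (\<lambda>_. cball 0 1)"
  proof
    fix f assume f: "f \<in> unit_vectors n"
    have "cmod (f j) \<le> 1" for j
      using f cmod_le_l2_on[of "{..<n}" j f] by (cases "j < n") (auto simp: unit_vectors_def)
    then show "f \<in> PiE UNIV (\<lambda>_. cball 0 1)" by (auto simp: PiE_UNIV_domain)
  qed
  ultimately show ?thesis using compact_Int_closed[of _ "unit_vectors n"] by (metis inf.absorb2)
qed

text \<open>The null space property of the kernel, expressed without matrices so that it depends on the array of
entries through finitely many continuous functions.\<close>

definition kernel_nsp :: "nat \<Rightarrow> nat \<Rightarrow> nat \<Rightarrow> complex Matrix.mat \<Rightarrow> (nat \<Rightarrow> nat set) \<Rightarrow> nat \<Rightarrow> nat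
    \<Rightarrow> (nat \<times> nat \<times> nat \<Rightarrow> real) \<Rightarrow> bool" where
  "kernel_nsp m d L \<Psi> \<I> G s \<phi> \<longleftrightarrow>
     (\<forall>f. (\<exists>j<d * L. f j \<noteq> 0) \<longrightarrow> (\<forall>l<L. \<forall>i<m. measurement d \<phi> l i (mat_apply (d * L) \<Psi> f) = 0) \<longrightarrow>
        null_space_property \<I> G s f)"

lemma mat_apply_cong: "(\<And>k. k < n \<Longrightarrow> f k = g k) \<Longrightarrow> mat_apply n \<Psi> f = mat_apply n \<Psi> g"
  by (simp add: mat_apply_def fun_eq_iff)

lemma exact_recovery_iff_kernel_nsp:
  assumes part: "group_partition \<I> G (d * L)" and \<Psi>: "\<Psi> \<in> carrier_mat (d * L) (d * L)"
  shows "(\<forall>x \<in> group_sparse \<I> G s (d * L).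
      group_l1_minimizers \<I> G (d * L) (block_diag_mat m d L \<phi> * \<Psi>) ((block_diag_mat m d L \<phi> * \<Psi>) *\<^sub>v x) = {x})
    \<longleftrightarrow> kernel_nsp m d L \<Psi> \<I> G s \<phi>"
proof -
  let ?n = "d * L"
  have A: "block_diag_mat m d L \<phi> * \<Psi> \<in> carrier_mat (m * L) ?n"
    using block_diag_mat_carrier[of m d L \<phi>] \<Psi> by simp
  have nz: "v \<noteq> 0\<^sub>v ?n \<longleftrightarrow> (\<exists>j<?n. vec_index v j \<noteq> 0)" if "v \<in> carrier_vec ?n" for v :: "complex Matrix.vec"
    using that by (auto simp: vec_eq_iff)
  have nsp: "null_space_property \<I> G s f \<longleftrightarrow> null_space_property \<I> G s g" if "\<And>j. j < ?n \<Longrightarrow> f j = g j" for f g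
  proof -
    have "l2_on (\<I> i) f = l2_on (\<I> i) g" if "i < G" for i
      using group_partition_bound[OF part that] \<open>\<And>j. j < ?n \<Longrightarrow> f j = g j\<close> by (intro l2_on_cong) auto
    then have "(\<Sum>i\<in>S. l2_on (\<I> i) f) = (\<Sum>i\<in>S. l2_on (\<I> i) g)" if "S \<subseteq> {..<G}" for S
      using that by (intro sum.cong) auto
    then show ?thesis by (simp add: null_space_property_def)
  qed
  show ?thesis
    unfolding exact_recovery_iff[OF part A] kernel_nsp_def
  proof (intro iffI ballI allI impI)
    fix f assume *: "\<forall>v\<in>carrier_vec ?n. (block_diag_mat m d L \<phi> * \<Psi>) *\<^sub>v v = 0\<^sub>v (m * L) \<longrightarrow> v \<noteq> 0\<^sub>v ?n \<longrightarrow>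
        null_space_property \<I> G s (vec_index v)"
      and f: "\<exists>j<?n. f j \<noteq> 0" "\<forall>l<L. \<forall>i<m. measurement d \<phi> l i (mat_apply ?n \<Psi> f) = 0"
    let ?v = "Matrix.vec ?n f"
    have "mat_apply ?n \<Psi> (vec_index ?v) = mat_apply ?n \<Psi> f" by (rule mat_apply_cong) simp
    then have "(block_diag_mat m d L \<phi> * \<Psi>) *\<^sub>v ?v = 0\<^sub>v (m * L)"
      using f(2) kernel_iff[OF \<Psi>, of ?v m \<phi>] by simp
    moreover have "?v \<noteq> 0\<^sub>v ?n"
    proof -
      have "?v \<noteq> 0\<^sub>v ?n \<longleftrightarrow> (\<exists>j<?n. vec_index ?v j \<noteq> 0)" by (rule nz) simp
      moreover have "\<exists>j<?n. vec_index ?v j \<noteq> 0" using f(1) by auto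
      ultimately show ?thesis by blast
    qed
    ultimately have "null_space_property \<I> G s (vec_index ?v)" using * by simp
    then show "null_space_property \<I> G s f" using nsp[of f "vec_index ?v"] by simp
  next
    fix v :: "complex Matrix.vec"
    assume *: "\<forall>f. (\<exists>j<?n. f j \<noteq> 0) \<longrightarrow> (\<forall>l<L. \<forall>i<m. measurement d \<phi> l i (mat_apply ?n \<Psi> f) = 0) \<longrightarrow>
        null_space_property \<I> G s f"
      and v: "v \<in> carrier_vec ?n" "(block_diag_mat m d L \<phi> * \<Psi>) *\<^sub>v v = 0\<^sub>v (m * L)" "v \<noteq> 0\<^sub>v ?n"
    show "null_space_property \<I> G s (vec_index v)"
      using * v(2,3) unfolding kernel_iff[OF \<Psi> v(1)] nz[OF v(1)] by blast
  qed
qed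

lemma mat_apply_scale: "mat_apply n \<Psi> (\<lambda>j. c * f j) = (\<lambda>j. c * mat_apply n \<Psi> f j)"
  by (simp add: mat_apply_def fun_eq_iff sum_distrib_left mult_ac)

lemma mat_apply_add: "mat_apply n \<Psi> (\<lambda>j. f j + g j) = (\<lambda>j. mat_apply n \<Psi> f j + mat_apply n \<Psi> g j)"
  by (simp add: mat_apply_def fun_eq_iff sum.distrib distrib_left)

lemma measurement_scale: "measurement d \<phi> l i (\<lambda>j. c * u j) = c * measurement d \<phi> l i u"
  by (simp add: measurement_def sum_distrib_left mult_ac)

lemma measurement_add: "measurement d \<phi> l i (\<lambda>j. u j + w j) = measurement d \<phi> l i u + measurement d \<phi> l i w"
  by (simp add: measurement_def sum.distrib distrib_left)

text \<open>By homogeneity it is enough to test unit vectors, where the witnesses of failure form a compact set.\<close>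

lemma kernel_nsp_unit:
  assumes part: "group_partition \<I> G (d * L)"
  shows "kernel_nsp m d L \<Psi> \<I> G s \<phi> \<longleftrightarrow> \<not> (\<exists>S\<in>{S. S \<subseteq> {..<G} \<and> card S \<le> s}. \<exists>f\<in>unit_vectors (d * L).
      (\<forall>l. \<forall>i. l < L \<and> i < m \<longrightarrow> measurement d \<phi> l i (mat_apply (d * L) \<Psi> f) = 0) \<and>
      (\<Sum>i\<in>{..<G} - S. l2_on (\<I> i) f) \<le> (\<Sum>i\<in>S. l2_on (\<I> i) f))" (is "?K \<longleftrightarrow> \<not> ?E")
proof -
  let ?n = "d * L"
  have "?K" if "\<not> ?E"
    unfolding kernel_nsp_def null_space_property_def
  proof (intro allI impI, rule ccontr)
    fix f S assume f: "\<exists>j<?n. f j \<noteq> 0" "\<forall>l<L. \<forall>i<m. measurement d \<phi> l i (mat_apply ?n \<Psi> f) = 0"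
      and S: "S \<subseteq> {..<G}" "card S \<le> s"
      and le: "\<not> (\<Sum>i\<in>S. l2_on (\<I> i) f) < (\<Sum>i\<in>{..<G} - S. l2_on (\<I> i) f)"
    define r where "r = l2_on {..<?n} f"
    have "r \<noteq> 0" using f(1) by (auto simp: r_def l2_on_eq_0)
    then have r: "r > 0" using l2_on_nonneg[of "{..<?n}" f] unfolding r_def by linarith
    define g where "g = (\<lambda>j. complex_of_real (1 / r) * zero_outside {..<?n} f j)"
    have "l2_on {..<?n} (zero_outside {..<?n} f) = r" unfolding r_def by (intro l2_on_cong) (simp add: zero_outside_def)
    then have "l2_on {..<?n} g = 1" using r unfolding g_def l2_on_scale by simp
    then have "g \<in> unit_vectors ?n" by (simp add: unit_vectors_def) (simp add: g_def zero_outside_def)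
    moreover have "mat_apply ?n \<Psi> (zero_outside {..<?n} f) = mat_apply ?n \<Psi> f" by (rule mat_apply_cong) (simp add: zero_outside_def)
    then have "\<forall>l. \<forall>i. l < L \<and> i < m \<longrightarrow> measurement d \<phi> l i (mat_apply ?n \<Psi> g) = 0"
      using f(2) unfolding g_def mat_apply_scale measurement_scale by simp
    moreover have sg: "l2_on (\<I> i) g = 1 / r * l2_on (\<I> i) f" if "i < G" for i
    proof -
      have "l2_on (\<I> i) (zero_outside {..<?n} f) = l2_on (\<I> i) f"
        using group_partition_bound[OF part that] by (intro l2_on_cong) (auto simp: zero_outside_def)
      then show ?thesis unfolding g_def l2_on_scale using r by simp
    qed
    have "(\<Sum>i\<in>T. l2_on (\<I> i) g) = 1 / r * (\<Sum>i\<in>T. l2_on (\<I> i) f)" if "T \<subseteq> {..<G}" for T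
      unfolding sum_distrib_left using that by (intro sum.cong refl sg) auto
    then have "(\<Sum>i\<in>{..<G} - S. l2_on (\<I> i) g) \<le> (\<Sum>i\<in>S. l2_on (\<I> i) g)"
      using S le r by (simp add: divide_right_mono)
    ultimately have ?E using S by (intro bexI[of _ S] bexI[of _ g] conjI CollectI)
    then show False using \<open>\<not> ?E\<close> by contradiction
  qed
  moreover have "\<not> ?K" if E: ?E
  proof -
    obtain S f where S: "S \<subseteq> {..<G}" "card S \<le> s" and f: "f \<in> unit_vectors ?n"
      "\<forall>l. \<forall>i. l < L \<and> i < m \<longrightarrow> measurement d \<phi> l i (mat_apply ?n \<Psi> f) = 0"
      "(\<Sum>i\<in>{..<G} - S. l2_on (\<I> i) f) \<le> (\<Sum>i\<in>S. l2_on (\<I> i) f)"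
      using E by auto
    have "\<not> null_space_property \<I> G s f"
    proof
      assume "null_space_property \<I> G s f"
      then have "S \<subseteq> {..<G} \<longrightarrow> card S \<le> s \<longrightarrow> (\<Sum>i\<in>S. l2_on (\<I> i) f) < (\<Sum>i\<in>{..<G} - S. l2_on (\<I> i) f)"
        unfolding null_space_property_def by (rule spec)
      then show False using S f(3) by linarith
    qed
    moreover have "\<exists>j<?n. f j \<noteq> 0"
    proof (rule ccontr)
      assume "\<not> ?thesis"
      then have "l2_on {..<?n} f = 0" by (auto simp: l2_on_eq_0)
      then show False using f(1) by (simp add: unit_vectors_def)
    qed
    ultimately show ?thesis using f(2) unfolding kernel_nsp_def by blast
  qed
  ultimately show ?thesis by blast
qed

lemma open_kernel_nsp:
  assumes part: "group_partition \<I> G (d * L)"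
  shows "open {\<phi>. kernel_nsp m d L \<Psi> \<I> G s \<phi>}"
proof -
  let ?n = "d * L"
  let ?T = "\<lambda>S. {p :: (nat \<times> nat \<times> nat \<Rightarrow> real) \<times> (nat \<Rightarrow> complex).
      (\<forall>l. \<forall>i. l < L \<and> i < m \<longrightarrow> measurement d (fst p) l i (mat_apply ?n \<Psi> (snd p)) = 0) \<and>
      (\<Sum>i\<in>{..<G} - S. l2_on (\<I> i) (snd p)) \<le> (\<Sum>i\<in>S. l2_on (\<I> i) (snd p))}"
  have c1: "continuous_on UNIV (\<lambda>p :: (nat \<times> nat \<times> nat \<Rightarrow> real) \<times> (nat \<Rightarrow> complex). fst p k)" for k
    by (rule continuous_on_coordinate[OF continuous_on_fst[OF continuous_on_id]])
  have c2: "continuous_on UNIV (\<lambda>p :: (nat \<times> nat \<times> nat \<Rightarrow> real) \<times> (nat \<Rightarrow> complex). snd p j)" for j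
    by (rule continuous_on_coordinate[OF continuous_on_snd[OF continuous_on_id]])
  have cm: "continuous_on UNIV (\<lambda>p. measurement d (fst p) l i (mat_apply ?n \<Psi> (snd p)))" for l i
    unfolding measurement_def mat_apply_def by (intro continuous_intros c1 c2)
  have cn: "continuous_on UNIV (\<lambda>p :: (nat \<times> nat \<times> nat \<Rightarrow> real) \<times> (nat \<Rightarrow> complex). \<Sum>i\<in>S. l2_on (\<I> i) (snd p))" for S
    by (intro continuous_on_sum continuous_on_l2_on continuous_on_snd continuous_on_id)
  have "closed (?T S)" for S
    by (intro closed_Collect_conj closed_Collect_all closed_Collect_imp closed_Collect_eq closed_Collect_le open_Collect_const
          cm cn continuous_on_const)
  then have "closed (\<Union>S\<in>{S. S \<subseteq> {..<G} \<and> card S \<le> s}. {\<phi>. \<exists>f\<in>unit_vectors ?n. (\<phi>, f) \<in> ?T S})"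
    by (intro closed_UN ballI closed_projection_compact compact_unit_vectors) simp_all
  moreover have "- {\<phi>. kernel_nsp m d L \<Psi> \<I> G s \<phi>}
     = (\<Union>S\<in>{S. S \<subseteq> {..<G} \<and> card S \<le> s}. {\<phi>. \<exists>f\<in>unit_vectors ?n. (\<phi>, f) \<in> ?T S})"
    by (rule Set.set_eqI) (simp only: Compl_iff mem_Collect_eq UN_iff kernel_nsp_unit[OF part] not_not fst_conv snd_conv)
  ultimately show ?thesis by (simp only: open_closed)
qed

lemma kernel_nsp_measurable:
  assumes part: "group_partition \<I> G (d * L)"
    and X: "\<And>k. k \<in> {..<L} \<times> {..<m} \<times> {..<d} \<Longrightarrow> X k \<in> borel_measurable M"
  shows "{\<omega> \<in> space M. kernel_nsp m d L \<Psi> \<I> G s (\<lambda>k. X k \<omega>)} \<in> sets M"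
proof -
  let ?I = "{..<L} \<times> {..<m} \<times> {..<d}"
  \<comment> \<open>Only the entries in the index set are known to be measurable, and only they matter.\<close>
  let ?Y = "\<lambda>\<omega> k. if k \<in> ?I then X k \<omega> else 0"
  have "?Y \<in> borel_measurable M"
  proof (rule measurable_coordinatewise_then_product)
    fix k show "(\<lambda>\<omega>. ?Y \<omega> k) \<in> borel_measurable M" using X by (cases "k \<in> ?I") auto
  qed
  then have "?Y -` {\<phi>. kernel_nsp m d L \<Psi> \<I> G s \<phi>} \<inter> space M \<in> sets M"
    by (rule measurable_sets) (intro borel_open open_kernel_nsp part)
  moreover have "kernel_nsp m d L \<Psi> \<I> G s (?Y \<omega>) = kernel_nsp m d L \<Psi> \<I> G s (\<lambda>k. X k \<omega>)" for \<omega>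
    unfolding kernel_nsp_def measurement_def by simp
  then have "?Y -` {\<phi>. kernel_nsp m d L \<Psi> \<I> G s \<phi>} \<inter> space M = {\<omega> \<in> space M. kernel_nsp m d L \<Psi> \<I> G s (\<lambda>k. X k \<omega>)}"
    by auto
  ultimately show ?thesis by simp
qed

section \<open>Union bound over the net\<close>

lemma sum_power_card_Pow:
  fixes x :: real assumes "finite A" shows "(\<Sum>S\<in>Pow A. x ^ card S) = (1 + x) ^ card A"
  using prod_add[OF assms, of "\<lambda>_. x" "\<lambda>_. 1"] by (simp add: add.commute)

text \<open>Generating function again: each subset \<open>S\<close> is weighted by \<open>x\<close> to the power \<open>|S|\<close>, for a total of
\<open>(1 + x)\<close> to the power \<open>|A|\<close>. Choosing \<open>x = min 1 (y / N)\<close> makes this at most \<open>exp y\<close> and puts the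
logarithm of \<open>N / y\<close> into the bound. With \<open>N = dL\<close> and \<open>y = g s\<close> the logarithm is the one of the
sampling condition, even if there are more than \<open>dL / g\<close> groups.\<close>

lemma card_small_subsets:
  assumes A: "finite A" and N: "real (card A) \<le> N" and y: "0 < y" and Npos: "0 < N"
  shows "card {S. S \<subseteq> A \<and> card S \<le> k} \<le> exp (y + k * log1 (N / y))"
proof -
  define x where "x = min 1 (y / N)"
  have x: "0 < x" "x \<le> 1" "x * N \<le> y" using y Npos by (auto simp: x_def min_def field_simps)
  let ?T = "{S. S \<subseteq> A \<and> card S \<le> k}"
  have "- ln x \<le> log1 (N / y)"
  proof (cases "y \<le> N")
    case True
    then have "x = y / N" using Npos by (simp add: x_def)
    then have "- ln x = ln (N / y)" using y Npos by (simp add: ln_div)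
    then show ?thesis by (simp add: log1_def)
  next
    case False
    then have "x = 1" using Npos by (simp add: x_def field_simps)
    then show ?thesis by (simp add: log1_def)
  qed
  then have "x \<ge> exp (- log1 (N / y))" using x(1) ln_ge_iff[of x "- log1 (N / y)"] by linarith
  then have "exp (- log1 (N / y)) ^ k \<le> x ^ k" by (intro power_mono) auto
  then have xk: "exp (- (k * log1 (N / y))) \<le> x ^ k" by (simp add: exp_of_nat_mult[symmetric])
  have "card ?T * exp (- (k * log1 (N / y))) \<le> card ?T * x ^ k" using xk by (intro mult_left_mono) auto
  also have "\<dots> = (\<Sum>S\<in>?T. x ^ k)" by simp
  also have "\<dots> \<le> (\<Sum>S\<in>?T. x ^ card S)" using x by (intro sum_mono power_decreasing) auto
  also have "\<dots> \<le> (\<Sum>S\<in>Pow A. x ^ card S)" using A x by (intro sum_mono2) auto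
  also have "\<dots> = (1 + x) ^ card A" by (rule sum_power_card_Pow[OF A])
  also have "\<dots> \<le> exp x ^ card A" using x by (intro power_mono exp_ge_add_one_self) auto
  also have "\<dots> = exp (card A * x)" by (simp add: exp_of_nat_mult)
  also have "\<dots> \<le> exp y"
  proof -
    have "card A * x \<le> N * x" using N x by (intro mult_right_mono) auto
    then show ?thesis using x(3) by (simp add: mult.commute)
  qed
  finally show ?thesis by (simp add: exp_add exp_minus field_simps)
qed

lemma vector_seminorm_measurement: "vector_seminorm (\<lambda>f. measurement_norm m d L \<phi> (mat_apply n \<Psi> f))"
proof
  fix f g :: "nat \<Rightarrow> complex" and c :: real
  have "measurement_norm m d L \<phi> (mat_apply n \<Psi> (\<lambda>j. f j + g j))
      \<le> L2_set (\<lambda>l. (\<Sum>i<m. cmod (measurement d \<phi> l i (mat_apply n \<Psi> f))) + (\<Sum>i<m. cmod (measurement d \<phi> l i (mat_apply n \<Psi> g)))) {..<L}"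
    unfolding measurement_norm_def mat_apply_add measurement_add sum.distrib[symmetric]
    by (intro L2_set_mono sum_mono norm_triangle_ineq sum_nonneg norm_ge_zero)
  also have "\<dots> \<le> measurement_norm m d L \<phi> (mat_apply n \<Psi> f) + measurement_norm m d L \<phi> (mat_apply n \<Psi> g)"
    unfolding measurement_norm_def by (rule L2_set_triangle_ineq)
  finally show "measurement_norm m d L \<phi> (mat_apply n \<Psi> (\<lambda>j. f j + g j))
     \<le> measurement_norm m d L \<phi> (mat_apply n \<Psi> f) + measurement_norm m d L \<phi> (mat_apply n \<Psi> g)" .
  show "measurement_norm m d L \<phi> (mat_apply n \<Psi> (\<lambda>j. complex_of_real c * f j)) = \<bar>c\<bar> * measurement_norm m d L \<phi> (mat_apply n \<Psi> f)"
    unfolding measurement_norm_def mat_apply_scale measurement_scale norm_mult sum_distrib_left[symmetric]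
    by (subst L2_set_right_distrib) auto
  show "measurement_norm m d L \<phi> (mat_apply n \<Psi> (\<lambda>j. \<i> * f j)) = measurement_norm m d L \<phi> (mat_apply n \<Psi> f)"
    unfolding measurement_norm_def mat_apply_scale measurement_scale norm_mult by simp
qed

lemma nonempty_groups_cover:
  assumes "group_partition \<I> G n" shows "(\<Union>i\<in>{i \<in> {..<G}. \<I> i \<noteq> {}}. \<I> i) = {..<n}"
proof -
  have "(\<Union>i\<in>{i \<in> {..<G}. \<I> i \<noteq> {}}. \<I> i) = (\<Union>i<G. \<I> i)" by blast
  then show ?thesis using assms by (simp add: group_partition_def)
qed

text \<open>The relative resolution of the net: \<open>1/16\<close> of the ratio \<open>(c / 8) / (16 K)\<close> of the two constants in
\<open>good_vector\<close>, capped at \<open>1/2\<close>, as \<open>lattice_bounds_extend\<close> requires.\<close>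

definition net_width :: "real \<Rightarrow> real" where
  "net_width K = min (1/2) (mean_abs_const K / (2048 * K))"

text \<open>The factor \<open>k / s\<close> in \<open>rip_imp_null_space_property\<close>. After the passage from the net to all vectors the
ratio of the upper and lower constants is \<open>(3 * 16 K) / (c / 32) = 1536 K / c\<close>, and its square has to
be exceeded.\<close>

definition tail_sparsity :: "real \<Rightarrow> nat" where
  "tail_sparsity K = nat \<lceil>(1536 * K / mean_abs_const K)\<^sup>2\<rceil> + 1"

text \<open>Bounds the exponents, in units of \<open>g L s log (dL / (g s))\<close>, of the number of supports, of the number
of lattice points per support and of the factor \<open>4 L\<close> from the union bound over the blocks.\<close>

definition entropy_factor :: "real \<Rightarrow> real" where
  "entropy_factor K = 1 + (real (tail_sparsity K) + 1) * (2 / net_width K + 4) + 4"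

context subexponential_blocks begin

definition bad_vectors :: "complex Matrix.mat \<Rightarrow> (nat \<Rightarrow> complex) set \<Rightarrow> 'w set" where
  "bad_vectors \<Psi> Z = (\<Union>z\<in>Z. bad_vector (mat_apply (d * L) \<Psi> z))"

lemma net_width_bounds: "0 < net_width K" "net_width K \<le> 1/2" "m > 0 \<Longrightarrow> 16 * (16 * K * m) * net_width K \<le> mean_abs_const K / 8 * m"
proof -
  show "0 < net_width K" "net_width K \<le> 1/2" using K_pos mean_abs_const_pos by (auto simp: net_width_def)
  have "2048 * K * net_width K \<le> 2048 * K * (mean_abs_const K / (2048 * K))"
    using K_pos by (intro mult_left_mono) (auto simp: net_width_def)
  then have "2048 * K * net_width K * m \<le> mean_abs_const K * m" using K_pos by (intro mult_right_mono) auto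
  then show "16 * (16 * K * m) * net_width K \<le> mean_abs_const K / 8 * m" by (simp add: mult_ac)
qed

text \<open>The deterministic part. Empty groups are discarded first: they contribute nothing to either norm, but
their number is unbounded and would spoil the count of supports.\<close>

lemma kernel_nsp_of_good_net:
  assumes \<omega>: "\<omega> \<in> space M" and U: "unitary_mat (d * L) \<Psi>" and part: "group_partition \<I> G (d * L)" and m: "m > 0"
    and s: "s > 0"
    and \<Gamma>: "\<Gamma> = {i \<in> {..<G}. \<I> i \<noteq> {}}"
    and good: "\<And>S z. S \<subseteq> \<Gamma> \<Longrightarrow> card S \<le> (tail_sparsity K + 1) * s \<Longrightarrow>
        z \<in> gauss_lattice (\<Union>i\<in>S. \<I> i) (2 * card (\<Union>i\<in>S. \<I> i) / net_width K) \<Longrightarrow>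
        \<omega> \<notin> bad_vector (mat_apply (d * L) \<Psi> z)"
  shows "kernel_nsp m d L \<Psi> \<I> G s (\<lambda>k. X k \<omega>)"
proof -
  let ?n = "d * L" and ?k = "tail_sparsity K * s"
  define F where "F f = measurement_norm m d L (\<lambda>k. X k \<omega>) (mat_apply ?n \<Psi> f)" for f
  interpret F: vector_seminorm F unfolding F_def by (rule vector_seminorm_measurement)
  define \<alpha> where "\<alpha> = mean_abs_const K / 8 * m"
  define \<beta> where "\<beta> = 16 * K * m"
  have \<alpha>\<beta>: "\<alpha> > 0" "\<beta> > 0" using m mean_abs_const_pos K_pos by (auto simp: \<alpha>_def \<beta>_def)
  have JS: "(\<Union>i\<in>S. \<I> i) \<subseteq> {..<?n}" if "S \<subseteq> \<Gamma>" for S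
    using that group_partition_subset[OF part] unfolding \<Gamma> by blast
  have rip: "\<alpha> / 4 * l2_on (\<Union>i\<in>S. \<I> i) f \<le> F (zero_outside (\<Union>i\<in>S. \<I> i) f)
      \<and> F (zero_outside (\<Union>i\<in>S. \<I> i) f) \<le> 3 * \<beta> * l2_on (\<Union>i\<in>S. \<I> i) f"
    if S: "S \<subseteq> \<Gamma>" "card S \<le> (tail_sparsity K + 1) * s" for S f
  proof -
    define J where "J = (\<Union>i\<in>S. \<I> i)"
    have Jn: "J \<subseteq> {..<?n}" using JS[OF S(1)] by (simp add: J_def)
    have J: "finite J" using Jn finite_subset by blast
    have lat: "\<alpha> * l2_on J z \<le> F z \<and> F z \<le> \<beta> * l2_on J z" if z: "z \<in> gauss_lattice J (2 * card J / net_width K)" for z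
    proof -
      have ng: "\<omega> \<notin> bad_vector (mat_apply ?n \<Psi> z)" using good[OF S] z unfolding J_def by blast
      have "l2_on J z = l2_on {..<?n} z"
        using z Jn by (intro l2_on_supp[symmetric]) (auto simp: gauss_lattice_def)
      also have "\<dots> = L2_set (\<lambda>j. cmod (mat_apply ?n \<Psi> z j)) {..<?n}"
        using unitary_isometry[OF U, of z] by (simp add: l2_on_def)
      finally show ?thesis using good_vector[OF \<omega> ng] by (simp add: F_def \<alpha>_def \<beta>_def)
    qed
    have c: "l2_on J (zero_outside J f) = l2_on J f" by (intro l2_on_cong) (simp add: zero_outside_def)
    have "\<alpha> / 4 * l2_on J (zero_outside J f) \<le> F (zero_outside J f)" "F (zero_outside J f) \<le> 3 * \<beta> * l2_on J (zero_outside J f)"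
      using lat by (intro F.lattice_bounds_extend[OF J net_width_bounds(1,2), of \<beta> \<alpha>];
          use net_width_bounds(3)[OF m] \<alpha>\<beta> in \<open>auto simp: \<alpha>_def \<beta>_def zero_outside_def\<close>)+
    then show ?thesis unfolding c unfolding J_def by simp
  qed
  show ?thesis
    unfolding kernel_nsp_def null_space_property_def
  proof (intro allI impI, rule ccontr)
    fix f S
    assume f: "\<exists>j<?n. f j \<noteq> 0" "\<forall>l<L. \<forall>i<m. measurement d (\<lambda>k. X k \<omega>) l i (mat_apply ?n \<Psi> f) = 0"
      and S: "S \<subseteq> {..<G}" "card S \<le> s"
      and le: "\<not> (\<Sum>i\<in>S. l2_on (\<I> i) f) < (\<Sum>i\<in>{..<G} - S. l2_on (\<I> i) f)"
    have UG: "(\<Union>i\<in>\<Gamma>. \<I> i) = {..<?n}" unfolding \<Gamma> by (rule nonempty_groups_cover[OF part])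
    have drop: "(\<Sum>i\<in>T \<inter> \<Gamma>. l2_on (\<I> i) f) = (\<Sum>i\<in>T. l2_on (\<I> i) f)" if "T \<subseteq> {..<G}" for T
    proof (rule sum.mono_neutral_left)
      show "finite T" using that finite_subset by blast
      show "\<forall>i\<in>T - T \<inter> \<Gamma>. l2_on (\<I> i) f = 0" using that by (auto simp: \<Gamma> l2_on_def)
    qed auto
    have "({..<G} - S) \<inter> \<Gamma> = \<Gamma> - S \<inter> \<Gamma>" by (auto simp: \<Gamma>)
    then have cone: "(\<Sum>i\<in>\<Gamma> - S \<inter> \<Gamma>. l2_on (\<I> i) f) \<le> (\<Sum>i\<in>S \<inter> \<Gamma>. l2_on (\<I> i) f)"
      using le drop[of "{..<G} - S"] drop[OF S(1)] by simp
    have "finite S" using S(1) finite_subset by blast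
    then have cS: "card (S \<inter> \<Gamma>) \<le> s" using S(2) card_mono[of S "S \<inter> \<Gamma>"] by simp
    have "mat_apply ?n \<Psi> (zero_outside (\<Union>i\<in>\<Gamma>. \<I> i) f) = mat_apply ?n \<Psi> f" unfolding UG by (rule mat_apply_cong) (simp add: zero_outside_def)
    then have ker: "F (zero_outside (\<Union>i\<in>\<Gamma>. \<I> i) f) = 0" using f(2) by (simp add: F_def measurement_norm_def L2_set_def)
    have k: "?k > 0" using s by (simp add: tail_sparsity_def)
    have ratio: "3 * \<beta> * sqrt (s / ?k) < \<alpha> / 4"
    proof -
      let ?q = "1536 * K / mean_abs_const K"
      have "?q\<^sup>2 < real (tail_sparsity K)" unfolding tail_sparsity_def by linarith
      then have "sqrt (?q\<^sup>2) < sqrt (tail_sparsity K)" by (rule real_sqrt_less_mono)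
      then have q: "?q < sqrt (tail_sparsity K)" using K_pos mean_abs_const_pos by simp
      have "3 * \<beta> * sqrt (s / ?k) = 3 * \<beta> / sqrt (tail_sparsity K)" using s by (simp add: real_sqrt_divide real_sqrt_mult)
      also have "\<dots> < \<alpha> / 4"
      proof -
        have "0 < tail_sparsity K" by (simp add: tail_sparsity_def)
        then have "0 < sqrt (tail_sparsity K)" by simp
        moreover have "1536 * K < mean_abs_const K * sqrt (tail_sparsity K)" using q mean_abs_const_pos by (simp add: divide_less_eq mult.commute)
        then have "1536 * K * m < mean_abs_const K * sqrt (tail_sparsity K) * m" using m by simp
        ultimately show ?thesis by (simp add: \<alpha>_def \<beta>_def divide_less_eq mult_ac)
      qed
      finally show ?thesis .
    qed
    have z: "l2_on (\<I> i) f = 0" if "i \<in> \<Gamma>" for i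
    proof (rule F.rip_imp_null_space_property[where \<Gamma>=\<Gamma> and k="?k" and s=s and \<alpha>="\<alpha> / 4" and \<beta>="3 * \<beta>" and S="S \<inter> \<Gamma>"])
      show "finite \<Gamma>" by (simp add: \<Gamma>)
      show "finite (\<I> i)" if "i \<in> \<Gamma>" for i using that group_partition_finite[OF part] by (simp add: \<Gamma>)
      show "disjoint_family_on \<I> \<Gamma>" using part unfolding group_partition_def \<Gamma> by (auto intro: disjoint_family_on_mono)
      show "\<alpha> / 4 * l2_on (\<Union>i\<in>T. \<I> i) f \<le> F (zero_outside (\<Union>i\<in>T. \<I> i) f)" if "T \<subseteq> \<Gamma>" "card T \<le> ?k + s" for T
        using rip[of T f] that by simp
      show "F (zero_outside (\<Union>i\<in>T. \<I> i) f) \<le> 3 * \<beta> * l2_on (\<Union>i\<in>T. \<I> i) f" if "T \<subseteq> \<Gamma>" "card T \<le> ?k" for T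
        using rip[of T f] that by simp
    qed (use k ratio \<alpha>\<beta> ker cS cone that in auto)
    obtain j where j: "j < ?n" "f j \<noteq> 0" using f(1) by blast
    then obtain i where i: "i \<in> \<Gamma>" "j \<in> \<I> i" using UG by auto
    then have "finite (\<I> i)" using group_partition_finite[OF part] by (simp add: \<Gamma>)
    then have "f j = 0" using z[OF i(1)] i(2) by (simp add: l2_on_eq_0)
    then show False using j by simp
  qed
qed

text \<open>All factors of the union bound are exponentials: the number of supports, the number of lattice points
on each, and \<open>4 L \<le> exp (4 L)\<close> for the blocks. Their exponents are compared to the common quantity
\<open>g L s log (dL / (g s))\<close>, of which \<open>L\<close>, \<open>g s\<close> and \<open>s log (dL / (g s))\<close> are all lower bounds.\<close>

lemma kernel_nsp_failure_prob:
  assumes U: "unitary_mat (d * L) \<Psi>" and part: "group_partition \<I> G (d * L)"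
    and pos: "m > 0" "s > 0" "d > 0" "L > 0"
  shows "prob {\<omega> \<in> space M. \<not> kernel_nsp m d L \<Psi> \<I> G s (\<lambda>k. X k \<omega>)}
     \<le> exp (entropy_factor K * (max_group_size \<I> G * L * s * log1 (real (d * L) / (max_group_size \<I> G * s))) - tail_rate K * m)"
proof -
  let ?n = "d * L" and ?g = "max_group_size \<I> G" and ?k = "(tail_sparsity K + 1) * s"
  define \<Gamma> where "\<Gamma> = {i \<in> {..<G}. \<I> i \<noteq> {}}"
  define J where "J S = (\<Union>i\<in>S. \<I> i)" for S
  define \<S> where "\<S> = {S. S \<subseteq> \<Gamma> \<and> card S \<le> ?k}"
  define Z where "Z = (\<Union>S\<in>\<S>. gauss_lattice (J S) (2 * card (J S) / net_width K))"
  have fin\<Gamma>: "finite \<Gamma>" by (simp add: \<Gamma>_def)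
  have fin\<S>: "finite \<S>" unfolding \<S>_def using fin\<Gamma> by (auto intro: finite_subset[of _ "Pow \<Gamma>"])
  have fI: "finite (\<I> i)" if "i \<in> \<Gamma>" for i using that group_partition_finite[OF part] by (simp add: \<Gamma>_def)
  have fJ: "finite (J S)" if "S \<in> \<S>" for S
    using that fI fin\<Gamma> unfolding J_def \<S>_def by (auto intro: finite_subset)
  have finZ: "finite Z"
    unfolding Z_def
  proof (rule finite_UN_I[OF fin\<S>])
    fix S assume "S \<in> \<S>"
    then show "finite (gauss_lattice (J S) (2 * card (J S) / net_width K))"
      by (rule gauss_lattice_count(1)[OF fJ])
  qed
  have gi: "card (\<I> i) \<le> ?g" if "i \<in> \<Gamma>" for i
    using that unfolding max_group_size_def \<Gamma>_def by (intro Max_ge) auto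
  have UG: "(\<Union>i\<in>\<Gamma>. \<I> i) = {..<?n}" unfolding \<Gamma>_def by (rule nonempty_groups_cover[OF part])
  have card\<Gamma>: "card \<Gamma> \<le> ?n"
  proof -
    have "?n = card (\<Union>i\<in>\<Gamma>. \<I> i)" by (simp add: UG)
    also have "\<dots> = (\<Sum>i\<in>\<Gamma>. card (\<I> i))"
      using fI fin\<Gamma> group_partition_disjoint[OF part] by (intro card_UN_disjoint) (auto simp: \<Gamma>_def)
    also have "\<dots> \<ge> (\<Sum>i\<in>\<Gamma>. 1)"
      using fI by (intro sum_mono) (auto simp: \<Gamma>_def Suc_le_eq card_gt_0_iff)
    finally show ?thesis by simp
  qed
  have n: "?n > 0" using pos by simp
  then have "0 \<in> (\<Union>i\<in>\<Gamma>. \<I> i)" unfolding UG by simp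
  then obtain i0 where i0: "i0 \<in> \<Gamma>" by (elim UN_E)
  then have "card (\<I> i0) > 0" using fI[OF i0] by (auto simp: \<Gamma>_def card_gt_0_iff)
  then have g: "?g > 0" using gi[OF i0] by simp
  define \<Lambda> where "\<Lambda> = log1 (real ?n / (?g * s))"
  have \<Lambda>: "\<Lambda> \<ge> 1" by (simp add: \<Lambda>_def log1_def)
  have cJ: "card (J S) \<le> ?k * ?g" if "S \<in> \<S>" for S
  proof -
    have S: "S \<subseteq> \<Gamma>" "card S \<le> ?k" "finite S" using that fin\<Gamma> finite_subset by (auto simp: \<S>_def)
    have "card (J S) \<le> (\<Sum>i\<in>S. card (\<I> i))" unfolding J_def by (rule card_UN_le[OF S(3)])
    also have "\<dots> \<le> card S * ?g" using sum_bounded_above[of S "\<lambda>i. card (\<I> i)" ?g] gi S(1) by auto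
    also have "\<dots> \<le> ?k * ?g" using S(2) by (rule mult_right_mono) simp
    finally show ?thesis .
  qed
  define cL where "cL S = card (gauss_lattice (J S) (2 * card (J S) / net_width K))" for S
  have "card Z \<le> (\<Sum>S\<in>\<S>. cL S)"
    unfolding Z_def cL_def by (intro card_UN_le[OF fin\<S>] gauss_lattice_count(1) fJ)
  then have "real (card Z) \<le> real (\<Sum>S\<in>\<S>. cL S)" by (rule of_nat_mono)
  also have "\<dots> = (\<Sum>S\<in>\<S>. real (cL S))" by (rule of_nat_sum)
  also have "\<dots> \<le> (\<Sum>S\<in>\<S>. exp ((2 / net_width K + 3) * (?k * ?g)))"
  proof (rule sum_mono)
    fix S assume S: "S \<in> \<S>"
    have "real (cL S) \<le> exp (2 * card (J S) / net_width K + 3 * card (J S))"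
      unfolding cL_def by (rule gauss_lattice_count(2)[OF fJ[OF S]])
    also have "2 * card (J S) / net_width K + 3 * card (J S) = (2 / net_width K + 3) * card (J S)"
      by (simp add: distrib_right)
    also have "exp \<dots> \<le> exp ((2 / net_width K + 3) * (?k * ?g))"
      using cJ[OF S] net_width_bounds(1) unfolding exp_le_cancel_iff
      by (intro mult_left_mono of_nat_mono add_nonneg_nonneg) auto
    finally show "real (cL S) \<le> exp ((2 / net_width K + 3) * (?k * ?g))" .
  qed
  also have "\<dots> = card \<S> * exp ((2 / net_width K + 3) * (?k * ?g))" by simp
  also have "\<dots> \<le> exp (real (?g * s) + ?k * \<Lambda>) * exp ((2 / net_width K + 3) * (?k * ?g))"
    unfolding \<S>_def \<Lambda>_def
    using g pos n card_small_subsets[OF fin\<Gamma> of_nat_mono[OF card\<Gamma>], of "real (?g * s)" ?k]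
    by (intro mult_right_mono) auto
  finally have cZ: "real (card Z) \<le> exp (real (?g * s) + ?k * \<Lambda> + (2 / net_width K + 3) * (?k * ?g))"
    by (simp add: exp_add)
  have L4: "real (4 * L) \<le> exp (4 * L)" using exp_ge_add_one_self[of "real (4 * L)"] by linarith
  have "{\<omega> \<in> space M. \<not> kernel_nsp m d L \<Psi> \<I> G s (\<lambda>k. X k \<omega>)} \<subseteq> bad_vectors \<Psi> Z"
  proof
    fix \<omega> assume \<omega>: "\<omega> \<in> {\<omega> \<in> space M. \<not> kernel_nsp m d L \<Psi> \<I> G s (\<lambda>k. X k \<omega>)}"
    show "\<omega> \<in> bad_vectors \<Psi> Z"
    proof (rule ccontr)
      assume "\<omega> \<notin> bad_vectors \<Psi> Z"
      then have "kernel_nsp m d L \<Psi> \<I> G s (\<lambda>k. X k \<omega>)"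
        using \<omega> by (intro kernel_nsp_of_good_net[OF _ U part pos(1,2) \<Gamma>_def])
          (auto simp: bad_vectors_def Z_def \<S>_def J_def)
      then show False using \<omega> by simp
    qed
  qed
  moreover have sets: "bad_vectors \<Psi> Z \<in> sets M"
    unfolding bad_vectors_def by (intro sets.finite_UN finZ bad_vector_sets)
  ultimately have "prob {\<omega> \<in> space M. \<not> kernel_nsp m d L \<Psi> \<I> G s (\<lambda>k. X k \<omega>)} \<le> prob (bad_vectors \<Psi> Z)"
    by (intro finite_measure_mono)
  also have "\<dots> \<le> (\<Sum>z\<in>Z. prob (bad_vector (mat_apply ?n \<Psi> z)))"
    unfolding bad_vectors_def by (intro finite_measure_subadditive_finite finZ) (auto simp: bad_vector_sets)
  also have "\<dots> \<le> (\<Sum>z\<in>Z. 4 * L * exp (- tail_rate K * m))" by (intro sum_mono bad_vector_prob)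
  also have "\<dots> = real (card Z) * real (4 * L) * exp (- tail_rate K * m)" by simp
  also have "\<dots> \<le> exp (real (?g * s) + ?k * \<Lambda> + (2 / net_width K + 3) * (?k * ?g)) * exp (4 * L) * exp (- tail_rate K * m)"
    by (rule mult_right_mono[OF mult_mono[OF cZ L4]]) auto
  also have "\<dots> = exp (real (?g * s) + ?k * \<Lambda> + (2 / net_width K + 3) * (?k * ?g) + 4 * L - tail_rate K * m)"
    by (simp add: exp_add[symmetric] exp_diff exp_minus field_simps)
  also have "\<dots> \<le> exp (entropy_factor K * (?g * L * s * \<Lambda>) - tail_rate K * m)"
  proof -
    define E where "E = real ?g * L * s * \<Lambda>"
    have ge1: "real ?g \<ge> 1" "real L \<ge> 1" "real s \<ge> 1" using g pos by auto
    have gs: "real (?g * s) \<le> E"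
    proof -
      have "(real ?g * s) * (1 * 1) \<le> (real ?g * s) * (L * \<Lambda>)"
        using ge1 \<Lambda> by (intro mult_left_mono mult_mono) auto
      then show ?thesis by (simp add: E_def mult_ac)
    qed
    have s\<Lambda>: "real s * \<Lambda> \<le> E"
    proof -
      have "(s * \<Lambda>) * (1 * 1) \<le> (s * \<Lambda>) * (real ?g * L)"
        using ge1 \<Lambda> by (intro mult_left_mono mult_mono) auto
      then show ?thesis by (simp add: E_def mult_ac)
    qed
    have LE: "real L \<le> E"
    proof -
      have "real L * (1 * 1 * 1) \<le> real L * (real ?g * s * \<Lambda>)"
        using ge1 \<Lambda> by (intro mult_left_mono mult_mono) auto
      then show ?thesis by (simp add: E_def mult_ac)
    qed
    let ?t = "real (tail_sparsity K) + 1"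
    have "?k * \<Lambda> = ?t * (s * \<Lambda>)" by (simp add: algebra_simps)
    also have "\<dots> \<le> ?t * E" using s\<Lambda> by (intro mult_left_mono) auto
    finally have a: "?k * \<Lambda> \<le> ?t * E" .
    have "(2 / net_width K + 3) * (?k * ?g) = ?t * (2 / net_width K + 3) * real (?g * s)"
      by (simp only: of_nat_mult of_nat_add of_nat_1 mult_ac)
    also have "\<dots> \<le> ?t * (2 / net_width K + 3) * E" using gs net_width_bounds(1) by (intro mult_left_mono) auto
    finally have b: "(2 / net_width K + 3) * (?k * ?g) \<le> ?t * (2 / net_width K + 3) * E" .
    have "entropy_factor K * E = E + ?t * E + ?t * (2 / net_width K + 3) * E + 4 * E"
      unfolding entropy_factor_def by (simp add: algebra_simps)
    then have "real (?g * s) + ?k * \<Lambda> + (2 / net_width K + 3) * (?k * ?g) + 4 * L \<le> entropy_factor K * E"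
      using a b gs LE by linarith
    then show ?thesis by (simp add: E_def)
  qed
  finally show ?thesis by (simp add: \<Lambda>_def)
qed

end

theorem theorem2:
  fixes \<tau> :: real
  assumes "\<tau> > 0"
  shows "\<exists>C>0. \<forall>(m::nat) (d::nat) (L::nat) (G::nat) (s::nat) (\<eta>::real)
      (\<I> :: nat \<Rightarrow> nat set) (\<Psi> :: complex Matrix.mat)
      (M :: (nat \<times> nat \<times> nat \<Rightarrow> real) measure)
      (X :: nat \<times> nat \<times> nat \<Rightarrow> (nat \<times> nat \<times> nat \<Rightarrow> real) \<Rightarrow> real).
      m > 0 \<and> d > 0 \<and> L > 0 \<and> G > 0 \<and> s > 0 \<and> 0 < \<eta> \<and> \<eta> < 1 \<and>
      group_partition \<I> G (d * L) \<and>
      unitary_mat (d * L) \<Psi> \<and>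
      prob_space M \<and>
      iid M X ({..<L} \<times> {..<m} \<times> {..<d}) \<and>
      (\<forall>k \<in> {..<L} \<times> {..<m} \<times> {..<d}.
         subexponential M (X k) \<and>
         prob_space.expectation M (X k) = 0 \<and>
         prob_space.variance M (X k) = 1 \<and>
         subexp_norm M (X k) = \<tau>) \<and>
      (let g = max_group_size \<I> G in
         real m \<ge> C * max (real g * real L * real s
                             * log1 (real (d * L) / (real g * real s)))
                           (ln (1 / \<eta>)))
      \<longrightarrow>
      \<P>(\<omega> in M. let \<Phi> = block_diag_mat m d L (\<lambda>k. X k \<omega>) in
         \<forall>x \<in> group_sparse \<I> G s (d * L).
           group_l1_minimizers \<I> G (d * L) (\<Phi> * \<Psi>) ((\<Phi> * \<Psi>) *\<^sub>v x) = {x})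
        \<ge> 1 - \<eta>"
proof -
  \<comment> \<open>The infimum in the subexponential norm need not be attained a priori; any \<open>K > \<tau>\<close> would do.\<close>
  define K where "K = 2 * \<tau>"
  \<comment> \<open>Half of the sampling condition pays for the entropy, the other half for the failure probability.\<close>
  define C where "C = 2 * entropy_factor K / tail_rate K"
  have K: "K > 0" using assms by (simp add: K_def)
  have c: "mean_abs_const K > 0" using K by (simp add: mean_abs_const_def)
  have rate: "tail_rate K > 0" using c by (simp add: tail_rate_def)
  have nw: "net_width K > 0" using K c by (simp add: net_width_def)
  have ef: "entropy_factor K \<ge> 1" unfolding entropy_factor_def using nw by (simp add: add_nonneg_nonneg)
  have C: "C > 0" using rate ef by (simp add: C_def)
  show ?thesis
  proof (intro exI[of _ C] conjI C allI impI, elim conjE)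
    fix m d L G s :: nat and \<eta> :: real and \<I> :: "nat \<Rightarrow> nat set" and \<Psi> :: "complex Matrix.mat"
      and M :: "(nat \<times> nat \<times> nat \<Rightarrow> real) measure" and X :: "nat \<times> nat \<times> nat \<Rightarrow> (nat \<times> nat \<times> nat \<Rightarrow> real) \<Rightarrow> real"
    let ?I = "{..<L} \<times> {..<m} \<times> {..<d}" and ?g = "max_group_size \<I> G"
    assume pos: "m > 0" "d > 0" "L > 0" "G > 0" "s > 0" and \<eta>: "0 < \<eta>" "\<eta> < 1"
      and part: "group_partition \<I> G (d * L)" and U: "unitary_mat (d * L) \<Psi>"
      and M: "prob_space M" and iid: "iid M X ?I"
      and X: "\<forall>k\<in>?I. subexponential M (X k) \<and> prob_space.expectation M (X k) = 0 \<and>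
         prob_space.variance M (X k) = 1 \<and> subexp_norm M (X k) = \<tau>"
      and m: "let g = ?g in real m \<ge> C * max (real g * real L * real s * log1 (real (d * L) / (real g * real s))) (ln (1 / \<eta>))"
    interpret prob_space M by (rule M)
    have ind: "indep_vars (\<lambda>_. borel) X ?I" using iid by (simp add: iid_def)
    then have rv: "X k \<in> borel_measurable M" if "k \<in> ?I" for k using that unfolding indep_vars_def by blast
    interpret subexponential_blocks M X L m d K
    proof
      show "indep_vars (\<lambda>_. borel) X ?I" by (rule ind)
      show "K > 0" by (rule K)
      fix k assume k: "k \<in> ?I"
      show "(\<integral>\<^sup>+\<omega>. ennreal (exp (\<bar>X k \<omega>\<bar> / K)) \<partial>M) \<le> 2"
        using X k assms by (intro exp_moment_of_subexp_norm[OF M rv[OF k]]) (auto simp: K_def)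
      show "expectation (X k) = 0" "variance (X k) = 1" using X k by auto
    qed
    define E where "E = real ?g * real L * real s * log1 (real (d * L) / (real ?g * real s))"
    define P where "P \<omega> \<longleftrightarrow> kernel_nsp m d L \<Psi> \<I> G s (\<lambda>k. X k \<omega>)" for \<omega>
    have "tail_rate K * (C * max E (ln (1 / \<eta>))) \<le> tail_rate K * m"
      using m rate by (intro mult_left_mono) (auto simp: E_def Let_def)
    then have "2 * entropy_factor K * max E (ln (1 / \<eta>)) \<le> tail_rate K * m" using rate by (simp add: C_def)
    moreover have "entropy_factor K * E \<le> entropy_factor K * max E (ln (1 / \<eta>))" using ef by (intro mult_left_mono) auto
    moreover have "ln (1 / \<eta>) \<le> entropy_factor K * max E (ln (1 / \<eta>))"
    proof -
      have "1 * ln (1 / \<eta>) \<le> entropy_factor K * max E (ln (1 / \<eta>))"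
        using ef \<eta> by (intro mult_mono) (auto simp: ln_div)
      then show ?thesis by simp
    qed
    ultimately have "entropy_factor K * E - tail_rate K * m \<le> - ln (1 / \<eta>)" by linarith
    then have "exp (entropy_factor K * E - tail_rate K * m) \<le> exp (- ln (1 / \<eta>))" by simp
    also have "\<dots> = \<eta>" using \<eta> by (simp add: ln_div)
    finally have "prob {\<omega> \<in> space M. \<not> P \<omega>} \<le> \<eta>"
      using kernel_nsp_failure_prob[OF U part pos(1,5,2,3)] by (simp add: E_def P_def)
    moreover have "{\<omega> \<in> space M. P \<omega>} \<in> events" unfolding P_def by (rule kernel_nsp_measurable[OF part rv])
    then have "prob {\<omega> \<in> space M. \<not> P \<omega>} = 1 - prob {\<omega> \<in> space M. P \<omega>}" by (rule prob_neg)
    ultimately have "1 - \<eta> \<le> \<P>(\<omega> in M. P \<omega>)" by simp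
    moreover have "\<Psi> \<in> carrier_mat (d * L) (d * L)" using U by (simp add: unitary_mat_def)
    note exact_recovery_iff_kernel_nsp[OF part this, of s m]
    ultimately show "\<P>(\<omega> in M. let \<Phi> = block_diag_mat m d L (\<lambda>k. X k \<omega>) in
         \<forall>x \<in> group_sparse \<I> G s (d * L).
           group_l1_minimizers \<I> G (d * L) (\<Phi> * \<Psi>) ((\<Phi> * \<Psi>) *\<^sub>v x) = {x}) \<ge> 1 - \<eta>"
      by (simp add: P_def Let_def)
  qed
qed

end
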